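(* Let $0<k<1$ be the modulus, $z:=2K(k)/\pi$, and $q:=\exp(-\pi K(\sqrt{1-k^2})/K(k))$. Put $$\mathcal{T}:=\det\begin{pmatrix} T_2(q) & T_4(q) \\ T_4(q) & T_6(q) \end{pmatrix},\qquad \widehat{\mathcal{T}}:=\det\begin{pmatrix} \widehat{T}_2(q) & \widehat{T}_4(q) \\ \widehat{T}_4(q) & \widehat{T}_6(q) \end{pmatrix},$$ $$\mathcal{N}_{\pm}:=\det\begin{pmatrix} N_2(\pm q) & N_4(\pm q) \\ N_4(\pm q) & N_6(\pm q) \end{pmatrix},\qquad \mathcal{R}_{\pm}:=\det\begin{pmatrix} 4R_2(\pm q)+1 & 4R_4(\pm q)-5 \\ 4R_4(\pm q)-5 & 4R_6(\pm q)+61 \end{pmatrix}.$$ Then $$(kz)^{10}=\tfrac{2^{10}}{3}\left\{\mathcal{N}_+-\mathcal{N}_-\right\}-\tfrac{2^3}{3^2}\left\{\mathcal{T}+\widehat{\mathcal{T}}\right\},$$ $$k^8z^{10}=\tfrac{2^{10}}{3^2}\left\{2\mathcal{N}_+-\mathcal{N}_-\right\}-\tfrac{2^2}{3^2}\left\{\mathcal{T}+\widehat{\mathcal{T}}\right\},$$ $$k^6z^{10}=\tfrac{2^{10}}{3^2}\mathcal{N}_+,$$ $$k^4z^{10}=\tfrac{2^2}{3^2}\mathcal{T},$$ $$k^2z^{10}=\tfrac{2^3}{3^2}\mathcal{T}-\tfrac{2^{10}}{3^2}\mathcal{N}_++\tfrac1{6^2}\left\{\mathcal{R}_+-\mathcal{R}_-\right\},$$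 $$z^{10}=\tfrac{2^2}{3}\mathcal{T}-\tfrac{2^{11}}{3^2}\mathcal{N}_++\tfrac1{18}\left\{\tfrac32\mathcal{R}_+-\mathcal{R}_-\right\}.$$
   Context: $K(k):=\int_0^1\frac{dt}{\sqrt{(1-t^2)(1-k^2t^2)}}$ is the complete elliptic integral of the first kind. For $m\ge0$ and $|x|<1$: $$T_{2m}(x)=\sum_{r\ge1}\frac{(2r-1)^{2m}x^{r-1/2}}{1+x^{2r-1}},\qquad \widehat{T}_{2m}(x)=\sum_{r\ge1}\frac{(2r-1)^{2m}(-1)^rx^{r-1/2}}{1-x^{2r-1}},$$ $$N_{2m}(x)=\sum_{r\ge1}\frac{r^{2m}x^r}{1+x^{2r}},\qquad R_{2m}(x)=\sum_{r\ge1}(-1)^{r+1}\frac{(2r-1)^{2m}x^{2r-1}}{1+x^{2r-1}}.$$ Half-integer powers of $q\in(0,1)$ are the positive ones. *)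

theory Defs
  imports "HOL-Analysis.Analysis"
begin

definition elliptic_K :: "real \<Rightarrow> real" where
  "elliptic_K k = integral {0..1} (\<lambda>t. 1 / sqrt ((1 - t\<^sup>2) * (1 - k\<^sup>2 * t\<^sup>2)))"

(* In the four series below the first argument m stands for the subscript 2m, so that
   for instance T_series 1 is T_2 and T_series 3 is T_6. They are meant for |x| < 1,
   where all sums converge absolutely. T_series and That_series involve half-integer
   powers and are meaningful only for 0 \<le> x < 1, where powr is the nonnegative power. *)

definition T_series :: "nat \<Rightarrow> real \<Rightarrow> real" where
  "T_series m x =
     (\<Sum>\<^sub>\<infinity>r\<in>{1::nat..}. (2 * real r - 1) ^ (2 * m) * x powr (real r - 1 / 2) / (1 + x ^ (2 * r - 1)))"

definition That_series :: "nat \<Rightarrow> real \<Rightarrow> real" where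
  "That_series m x =
     (\<Sum>\<^sub>\<infinity>r\<in>{1::nat..}. (2 * real r - 1) ^ (2 * m) * (- 1) ^ r * x powr (real r - 1 / 2) / (1 - x ^ (2 * r - 1)))"

definition N_series :: "nat \<Rightarrow> real \<Rightarrow> real" where
  "N_series m x = (\<Sum>\<^sub>\<infinity>r\<in>{1::nat..}. real r ^ (2 * m) * x ^ r / (1 + x ^ (2 * r)))"

definition R_series :: "nat \<Rightarrow> real \<Rightarrow> real" where
  "R_series m x =
     (\<Sum>\<^sub>\<infinity>r\<in>{1::nat..}. (- 1) ^ (r + 1) * ((2 * real r - 1) ^ (2 * m) * x ^ (2 * r - 1) / (1 + x ^ (2 * r - 1))))"

definition mat2 :: "real \<Rightarrow> real \<Rightarrow> real \<Rightarrow> real \<Rightarrow> real ^ 2 ^ 2" where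
  "mat2 a b c d = vector [vector [a, b], vector [c, d]]"

definition T_det :: "real \<Rightarrow> real" where
  "T_det x = det (mat2 (T_series 1 x) (T_series 2 x)
                       (T_series 2 x) (T_series 3 x))"

definition That_det :: "real \<Rightarrow> real" where
  "That_det x = det (mat2 (That_series 1 x) (That_series 2 x)
                          (That_series 2 x) (That_series 3 x))"

definition N_det :: "real \<Rightarrow> real" where
  "N_det x = det (mat2 (N_series 1 x) (N_series 2 x)
                       (N_series 2 x) (N_series 3 x))"

definition R_det :: "real \<Rightarrow> real" where
  "R_det x = det (mat2 (4 * R_series 1 x + 1) (4 * R_series 2 x - 5)
                       (4 * R_series 2 x - 5) (4 * R_series 3 x + 61))"

end

theory Submission
  imports Defs
begin

text \<open>
  Up to normalisation and a shift of the argument, the six families of series are the even Taylor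
  coefficients of Fourier series of Jacobian elliptic functions. With \<open>q = e\<^sup>-\<^sup>2\<^sup>h\<close> let
  \<open>C\<close>, \<open>D\<close> and \<open>S\<close> be the sums of \<open>sech (jh) e\<^sup>i\<^sup>j\<^sup>w\<close> over odd \<open>j\<close>, of
  \<open>sech (jh) e\<^sup>i\<^sup>j\<^sup>w\<close> over even \<open>j\<close>, and of \<open>-i csch (jh) e\<^sup>i\<^sup>j\<^sup>w\<close> over odd \<open>j\<close>; they turn
  out to be \<open>kz cn (zw)\<close>, \<open>z dn (zw)\<close> and \<open>kz sn (zw)\<close>. The addition theorems for
  \<open>tanh\<close> and \<open>coth\<close> make the convolutions of their coefficients telescope, which yields
  \<open>S' = CD\<close>, \<open>C' = -SD\<close>, \<open>D' = -SC\<close>.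

  On \<open>[0, \<pi>/2]\<close> the function \<open>S/(kz)\<close> and on \<open>i[0, h)\<close> the function \<open>S/(iC)\<close> parametrise the
  integrals \<open>K(k)\<close> and \<open>K(k')\<close>, so \<open>K(k) = z\<pi>/2\<close> and \<open>K(k') = zh\<close>. As \<open>K(k')/K(k)\<close> is
  strictly decreasing in \<open>k\<close>, the modulus belonging to the given nome is the given one.

  Each \<open>X\<close> among \<open>S, C, D\<close> satisfies \<open>X'\<^sup>2 = eX\<^sup>4 + bX\<^sup>2 + c\<close>, hence
  \<open>X'' X\<^sup>(\<^sup>6\<^sup>) - (X\<^sup>(\<^sup>4\<^sup>))\<^sup>2\<close> is a polynomial in \<open>X\<^sup>2\<close>. Evaluating it at \<open>0\<close>, at \<open>\<pi>/2\<close> and, as a limit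
  along the boundary of the strip of convergence, at \<open>\<pi>/2 + ih\<close> gives all six determinants.
\<close>

section \<open>Trigonometric series indexed by the integers\<close>

text \<open>The construction runs from the nome to the modulus: \<open>h\<close> is given, and k and
  z are read off from the values of the series at 0, so no elliptic integral has to be inverted. Put
  A = k^2 z^2 and B = z^2. At each evaluation point X' = 0, so Y = X^2 is a root of the quadratic e
  Y^2 + b Y + c, and the Hankel expression collapses to a single product. Both Y and 2 e Y + b are
  then, up to sign, among A, B and B - A, so each determinant is a constant times the square of one
  of these and the cube of another. The six formulas thus become linear relations between binary
  forms of degree 5 in A and B. The obstacle is pi/2 + ih. It is a regular point of all three
  functions, but their poles at ih lie at the same height, so the Fourier series diverge there. For
  S and C the divergent part has a secant as closed form; its derivatives at 0 are the Euler numbers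
  1, 5, 61, the source of the constants in \<open>R_det\<close>.\<close>

definition lser :: "(int \<Rightarrow> complex) \<Rightarrow> complex \<Rightarrow> complex" where
  "lser a w = (\<Sum>\<^sub>\<infinity>j. a j * exp (\<i> * of_int j * w))"

text \<open>The modulus of \<open>exp (\<i> * of_int j * w)\<close> depends only on
  \<open>Im w\<close>, so this is absolute convergence on an open horizontal strip. Unordered
  absolute summation over the integers makes reflections and Cauchy products free of ordering
  questions.\<close>

definition lconv :: "real \<Rightarrow> real \<Rightarrow> (int \<Rightarrow> complex) \<Rightarrow> bool" where
  "lconv lo hi a \<longleftrightarrow>
     (\<forall>y. lo < y \<longrightarrow> y < hi \<longrightarrow> (\<lambda>j. norm (a j) * exp (- (of_int j * y))) summable_on UNIV)"

lemma lconv_abs_summable: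
  assumes "lconv lo hi a" "lo < Im w" "Im w < hi"
  shows "(\<lambda>j. norm (a j * exp (\<i> * of_int j * w))) summable_on UNIV"
  using assms unfolding lconv_def by (simp add: norm_mult)

lemma lconv_summable:
  assumes "lconv lo hi a" "lo < Im w" "Im w < hi"
  shows "(\<lambda>j. a j * exp (\<i> * of_int j * w)) summable_on UNIV"
  using lconv_abs_summable[OF assms] by (rule abs_summable_summable)

lemma lconv_has_sum:
  assumes "lconv lo hi a" "lo < Im w" "Im w < hi"
  shows "((\<lambda>j. a j * exp (\<i> * of_int j * w)) has_sum lser a w) UNIV"
  unfolding lser_def using lconv_summable[OF assms] by (rule has_sum_infsum)

text \<open>The bound \<open>t * exp (- (t * \<delta>)) \<le> 1 / \<delta>\<close> absorbs the
  factor j coming from differentiation at the cost of a slightly wider strip. The right side is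
  independent of \<open>y\<close>, as a Weierstrass majorant must be.\<close>

lemma abs_times_exp_le:
  fixes j :: int and y y0 \<delta> :: real
  assumes "\<delta> > 0" "\<bar>y - y0\<bar> \<le> \<delta>"
  shows "\<bar>of_int j\<bar> * exp (- (of_int j * y))
           \<le> (exp (- (of_int j * (y0 - 2 * \<delta>))) + exp (- (of_int j * (y0 + 2 * \<delta>)))) / \<delta>"
proof -
  have e: "t * exp (- (t * \<delta>)) \<le> 1 / \<delta>" for t
  proof -
    have "t * \<delta> \<le> exp (t * \<delta>)" using exp_ge_add_one_self[of "t * \<delta>"] by linarith
    then show ?thesis using assms(1) by (simp add: exp_minus field_simps)
  qed
  show ?thesis
  proof (cases "j \<ge> 0")
    case True
    have "\<bar>of_int j\<bar> * exp (- (of_int j * y)) = (of_int j * exp (- (of_int j * \<delta>))) * exp (- (of_int j * (y - \<delta>)))"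
      using True by (simp add: exp_add[symmetric] algebra_simps)
    also have "\<dots> \<le> 1 / \<delta> * exp (- (of_int j * (y0 - 2 * \<delta>)))"
      using True assms e by (intro mult_mono) (auto intro!: mult_left_mono)
    also have "\<dots> \<le> (exp (- (of_int j * (y0 - 2 * \<delta>))) + exp (- (of_int j * (y0 + 2 * \<delta>)))) / \<delta>"
      using assms(1) by (simp add: field_simps)
    finally show ?thesis .
  next
    case False
    have "\<bar>of_int j\<bar> * exp (- (of_int j * y)) = (- of_int j * exp (- (- of_int j * \<delta>))) * exp (- (of_int j * (y + \<delta>)))"
      using False by (simp add: exp_add[symmetric] algebra_simps)
    also have "\<dots> \<le> 1 / \<delta> * exp (- (of_int j * (y0 + 2 * \<delta>)))"
      using False assms e[of "- of_int j"] by (intro mult_mono) (auto intro!: mult_left_mono_neg)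
    also have "\<dots> \<le> (exp (- (of_int j * (y0 - 2 * \<delta>))) + exp (- (of_int j * (y0 + 2 * \<delta>)))) / \<delta>"
      using assms(1) by (simp add: field_simps)
    finally show ?thesis .
  qed
qed

text \<open>Termwise differentiation: on a thin substrip around \<open>w\<close> the differentiated
  series has a summable majorant built from the two edges \<open>Im w - 2 * \<delta>\<close> and
  \<open>Im w + 2 * \<delta>\<close>.\<close>

lemma
  assumes a: "lconv lo hi a" and w: "lo < Im w" "Im w < hi"
  shows lser_deriv_summable: "(\<lambda>j. norm (\<i> * of_int j * a j) * exp (- (of_int j * Im w))) summable_on UNIV"
    and has_field_derivative_lser:
      "(lser a has_field_derivative lser (\<lambda>j. \<i> * of_int j * a j) w) (at w)"
proof -
  \<comment> \<open>A third of the distance to the boundary keeps both edges at distance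
    \<open>2 * \<delta>\<close> inside the strip.\<close>
  define \<delta> where "\<delta> = min (Im w - lo) (hi - Im w) / 3"
  have \<delta>: "\<delta> > 0" "lo < Im w - 2 * \<delta>" "Im w + 2 * \<delta> < hi" using w by (auto simp: \<delta>_def min_def field_simps)
  define M where "M j = norm (a j) * ((exp (- (of_int j * (Im w - 2 * \<delta>))) + exp (- (of_int j * (Im w + 2 * \<delta>)))) / \<delta>)" for j
  define U where "U = {v. \<bar>Im v - Im w\<bar> < \<delta>}"
  define f where "f j v = a j * exp (\<i> * of_int j * v)" for j v
  define f' where "f' j v = \<i> * of_int j * a j * exp (\<i> * of_int j * v)" for j v
  have Msum: "M summable_on UNIV"
  proof -
    have "(\<lambda>j. norm (a j) * exp (- (of_int j * (Im w - 2 * \<delta>))) + norm (a j) * exp (- (of_int j * (Im w + 2 * \<delta>)))) summable_on UNIV"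
      using a \<delta> w unfolding lconv_def by (intro summable_on_add) auto
    from summable_on_cmult_left[OF this, of "1 / \<delta>"] show ?thesis
      unfolding M_def by (simp add: field_simps)
  qed
  have f'M: "norm (f' j v) \<le> M j" if "v \<in> U" for j v
  proof -
    have "norm (f' j v) = norm (a j) * (\<bar>of_int j\<bar> * exp (- (of_int j * Im v)))"
      unfolding f'_def by (simp add: norm_mult)
    also have "\<dots> \<le> M j" unfolding M_def
      using that abs_times_exp_le[OF \<delta>(1), of "Im v" "Im w" j] by (intro mult_left_mono) (auto simp: U_def)
    finally show ?thesis .
  qed
  have wU: "w \<in> U" using \<delta> by (simp add: U_def)
  have "(\<lambda>j. norm (f' j w)) summable_on UNIV"
    by (rule summable_on_comparison_test[OF Msum]) (use f'M[OF wU] in auto)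
  then show "(\<lambda>j. norm (\<i> * of_int j * a j) * exp (- (of_int j * Im w))) summable_on UNIV"
    by (simp add: f'_def norm_mult)
  \<comment> \<open>The M-test concerns sequences of partial sums; any enumeration of the integers
    will do, since convergence is absolute.\<close>
  let ?d = int_decode
  have bij: "bij_betw ?d UNIV UNIV" by (rule bij_int_decode)
  have U: "U = {v. Im v > Im w - \<delta>} \<inter> {v. Im v < Im w + \<delta>}" unfolding U_def by auto
  have oU: "open U" unfolding U by (intro open_Int open_halfspace_Im_gt open_halfspace_Im_lt)
  have cU: "convex U" unfolding U by (intro convex_Int convex_halfspace_Im_gt convex_halfspace_Im_lt)
  have MsumN: "summable (\<lambda>n. M (?d n))"
    using Msum summable_on_reindex_bij_betw[OF bij, of M] by (intro summable_on_imp_summable) auto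
  have S: "(f j has_field_derivative f' j v) (at v within U)" for j v
    unfolding f_def f'_def by (auto intro!: derivative_eq_intros)
  have unif: "uniformly_convergent_on U (\<lambda>n x. \<Sum>i<n. f' (?d i) x)"
    by (rule Weierstrass_m_test'[OF _ MsumN]) (use f'M in auto)
  have sumU: "(\<lambda>j. norm (f j v)) summable_on UNIV" if "v \<in> U" for v
    using lconv_abs_summable[OF a, of v] that \<delta> unfolding f_def U_def by auto
  have sums: "(\<lambda>n. f (?d n) v) sums lser a v" if "v \<in> U" for v
    unfolding lser_def f_def[symmetric]
    using has_sum_infsum[OF abs_summable_summable[OF sumU[OF that]]]
      has_sum_reindex_bij_betw[OF bij, of "\<lambda>j. f j v"] by (intro has_sum_imp_sums) auto
  have sums': "(\<lambda>n. f' (?d n) w) sums lser (\<lambda>j. \<i> * of_int j * a j) w"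
    unfolding lser_def f'_def[symmetric]
    using has_sum_infsum[OF abs_summable_summable[OF \<open>(\<lambda>j. norm (f' j w)) summable_on UNIV\<close>]]
      has_sum_reindex_bij_betw[OF bij, of "\<lambda>j. f' j w"] by (intro has_sum_imp_sums) auto
  have wi: "w \<in> interior U" using oU wU by (simp add: interior_open)
  have "((\<lambda>x. \<Sum>n. f (?d n) x) has_field_derivative (\<Sum>n. f' (?d n) w)) (at w)"
    by (rule has_field_derivative_series'(2)[OF cU S unif wU sums_summable[OF sums[OF wU]] wi])
  then have "((\<lambda>x. \<Sum>n. f (?d n) x) has_field_derivative lser (\<lambda>j. \<i> * of_int j * a j) w) (at w)"
    using sums_unique[OF sums'] by simp
  then show "(lser a has_field_derivative lser (\<lambda>j. \<i> * of_int j * a j) w) (at w)"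
    by (rule has_field_derivative_transform_within_open[OF _ oU wU])
      (use sums in \<open>simp add: sums_iff\<close>)
qed

lemma lconv_deriv: "lconv lo hi a \<Longrightarrow> lconv lo hi (\<lambda>j. \<i> * of_int j * a j)"
  unfolding lconv_def[of _ _ "\<lambda>j. \<i> * of_int j * a j"]
proof (intro allI impI)
  fix y assume "lconv lo hi a" "lo < y" "y < hi"
  then show "(\<lambda>j. norm (\<i> * of_int j * a j) * exp (- (of_int j * y))) summable_on UNIV"
    using lser_deriv_summable[of lo hi a "Complex 0 y"] by simp
qed

definition lder :: "nat \<Rightarrow> (int \<Rightarrow> complex) \<Rightarrow> int \<Rightarrow> complex" where
  "lder n a = (\<lambda>j. (\<i> * of_int j) ^ n * a j)"

lemma lder_0 [simp]: "lder 0 a = a" by (simp add: lder_def)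

lemma lder_Suc: "lder (Suc n) a = (\<lambda>j. \<i> * of_int j * lder n a j)"
  by (simp add: lder_def mult_ac)

lemma lconv_lder: "lconv lo hi a \<Longrightarrow> lconv lo hi (lder n a)"
  by (induction n) (auto simp: lder_Suc intro: lconv_deriv)

lemma has_field_derivative_lser_lder:
  assumes "lconv lo hi a" "lo < Im w" "Im w < hi"
  shows "(lser (lder n a) has_field_derivative lser (lder (Suc n) a) w) (at w)"
  unfolding lder_Suc by (rule has_field_derivative_lser[OF lconv_lder]) (use assms in auto)

text \<open>The two halves are dominated by geometric series: the lower edge controls j \<ge> 0, the
  upper edge j < 0.\<close>

lemma lconv_bounded:
  assumes "M \<ge> 0"
    and "\<And>j. j \<ge> 0 \<Longrightarrow> norm (a j) \<le> M * exp (of_int j * lo)"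
    and "\<And>j. j < 0 \<Longrightarrow> norm (a j) \<le> M * exp (of_int j * hi)"
  shows "lconv lo hi a"
  unfolding lconv_def
proof (intro allI impI)
  fix y assume y: "lo < y" "y < hi"
  let ?f = "\<lambda>j. norm (a j) * exp (- (of_int j * y))"
  have geo: "(\<lambda>n. exp (- c) ^ n) summable_on (UNIV :: nat set)" if "c > 0" for c :: real
    by (rule summable_nonneg_imp_summable_on) (use that in \<open>auto intro!: summable_geometric\<close>)
  have 1: "?f summable_on {0..}"
  proof -
    have "(\<lambda>n. ?f (int n)) summable_on (UNIV :: nat set)"
    proof (rule summable_on_comparison_test[OF summable_on_cmult_right[OF geo[of "y - lo"], of M]])
      fix n :: nat
      have "?f (int n) \<le> (M * exp (of_int (int n) * lo)) * exp (- (of_int (int n) * y))"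
        by (intro mult_right_mono assms) auto
      also have "\<dots> = M * exp (- (y - lo)) ^ n"
        by (simp add: exp_of_nat_mult[symmetric] exp_add[symmetric] algebra_simps)
      finally show "?f (int n) \<le> M * exp (- (y - lo)) ^ n" .
    qed (use y in auto)
    moreover have "bij_betw int UNIV {0..}"
      by (rule bij_betwI[where g = nat]) auto
    ultimately show ?thesis using summable_on_reindex_bij_betw[of int UNIV "{0..}" ?f] by simp
  qed
  have 2: "?f summable_on {..<0}"
  proof -
    \<comment> \<open>Starts at -1, because index 0 belongs to the other half.\<close>
    let ?g = "\<lambda>n. - int n - 1"
    have "(\<lambda>n. ?f (?g n)) summable_on (UNIV :: nat set)"
    proof (rule summable_on_comparison_test[OF summable_on_cmult_right[OF geo[of "hi - y"], of M]])
      fix n :: nat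
      have "?f (?g n) \<le> (M * exp (of_int (?g n) * hi)) * exp (- (of_int (?g n) * y))"
        by (intro mult_right_mono assms) auto
      also have "\<dots> = M * exp (- (hi - y)) ^ Suc n"
        unfolding exp_of_nat_mult[symmetric] by (simp add: exp_add[symmetric] algebra_simps)
      also have "\<dots> \<le> M * exp (- (hi - y)) ^ n"
        using y assms(1) by (intro mult_left_mono power_decreasing) auto
      finally show "?f (?g n) \<le> M * exp (- (hi - y)) ^ n" .
    qed (use y in auto)
    moreover have "bij_betw ?g UNIV {..<0}"
      by (rule bij_betwI[where g = "\<lambda>j. nat (- j - 1)"]) auto
    ultimately show ?thesis using summable_on_reindex_bij_betw[of ?g UNIV "{..<0}" ?f] by simp
  qed
  have "?f summable_on ({0..} \<union> {..<0})" by (rule summable_on_Un_disjoint[OF 1 2]) auto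
  moreover have "{0..} \<union> {..<0} = (UNIV :: int set)" by auto
  ultimately show "?f summable_on UNIV" by simp
qed

lemma abs_summable_times:
  fixes f g :: "_ \<Rightarrow> complex"
  assumes f: "(\<lambda>j. norm (f j)) summable_on A" and g: "(\<lambda>j. norm (g j)) summable_on B"
  shows "(\<lambda>p. norm (case p of (j, l) \<Rightarrow> f j * g l)) summable_on A \<times> B"
proof -
  have "((\<lambda>l. norm (f j * g l)) has_sum norm (f j) * (\<Sum>\<^sub>\<infinity>l\<in>B. norm (g l))) B" for j
    unfolding norm_mult by (intro has_sum_cmult_right has_sum_infsum g)
  then show ?thesis
    by (intro summable_on_SigmaI[where g = "\<lambda>j. norm (f j) * (\<Sum>\<^sub>\<infinity>l\<in>B. norm (g l))"]
        summable_on_cmult_left f) auto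
qed

text \<open>Absolute convergence lets the double family be summed by rows or along the diagonals j +
  l = m. The diagonal sums are a hypothesis, so that closed forms found by telescoping can be
  inserted.\<close>

lemma lser_mult:
  assumes a: "lconv lo hi a" and b: "lconv lo hi b" and w: "lo < Im w" "Im w < hi"
    and c: "\<And>m. ((\<lambda>j. a j * b (m - j)) has_sum c m) UNIV"
  shows "lser a w * lser b w = lser c w"
proof -
  let ?e = "\<lambda>j. exp (\<i> * of_int j * w)"
  let ?f = "\<lambda>(j, l). (a j * ?e j) * (b l * ?e l)"
  have "(\<lambda>p. norm (?f p)) summable_on UNIV \<times> UNIV"
    by (rule abs_summable_times[OF lconv_abs_summable[OF a w] lconv_abs_summable[OF b w]])
  then have "?f summable_on UNIV \<times> UNIV" by (rule abs_summable_summable)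
  then have hs: "(?f has_sum infsum ?f (UNIV \<times> UNIV)) (UNIV \<times> UNIV)" by (rule has_sum_infsum)
  have 1: "lser a w * lser b w = infsum ?f (UNIV \<times> UNIV)"
  proof -
    have "((\<lambda>j. a j * ?e j * lser b w) has_sum infsum ?f (UNIV \<times> UNIV)) UNIV"
      by (rule has_sum_SigmaD[OF hs]) (use has_sum_cmult_right[OF lconv_has_sum[OF b w]] in auto)
    moreover have "((\<lambda>j. a j * ?e j * lser b w) has_sum lser a w * lser b w) UNIV"
      by (rule has_sum_cmult_left[OF lconv_has_sum[OF a w]])
    ultimately show ?thesis using has_sum_unique by blast
  qed
  have "bij_betw (\<lambda>(m, j). (j, m - j)) (UNIV \<times> UNIV) (UNIV \<times> UNIV :: (int \<times> int) set)"
    by (rule bij_betwI[where g = "\<lambda>(j, l). (j + l, j)"]) auto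
  from has_sum_reindex_bij_betw[OF this, of ?f] hs
  have hs2: "((\<lambda>(m, j). ?f (j, m - j)) has_sum infsum ?f (UNIV \<times> UNIV)) (UNIV \<times> UNIV)"
    by (simp add: case_prod_unfold)
  have "((\<lambda>m. c m * ?e m) has_sum infsum ?f (UNIV \<times> UNIV)) UNIV"
  proof (rule has_sum_SigmaD[OF hs2])
    fix m :: int
    have "(\<lambda>j. ?f (j, m - j)) = (\<lambda>j. (a j * b (m - j)) * ?e m)"
    proof
      fix j
      have "?e j * ?e (m - j) = ?e m" by (simp add: exp_add[symmetric] algebra_simps)
      then show "?f (j, m - j) = (a j * b (m - j)) * ?e m" by (simp add: mult_ac)
    qed
    then show "((\<lambda>j. (case (m, j) of (m, j) \<Rightarrow> ?f (j, m - j))) has_sum c m * ?e m) UNIV"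
      using has_sum_cmult_left[OF c[of m], of "?e m"] by simp
  qed
  then show ?thesis using 1 unfolding lser_def by (simp add: infsumI)
qed

text \<open>The strip contains the real axis, so both coefficient families are absolutely summable,
  and one of them is then used only through a bound.\<close>

lemma lconv_conv_summable:
  assumes a: "lconv lo hi a" and b: "lconv lo hi b" and "lo < 0" "0 < hi"
  shows "(\<lambda>j. a j * b (m - j)) summable_on UNIV"
proof -
  have b': "(\<lambda>j. norm (b j)) summable_on UNIV" and a': "(\<lambda>j. norm (a j)) summable_on UNIV"
    using lconv_abs_summable[OF b, of 0] lconv_abs_summable[OF a, of 0] assms by auto
  have "norm (b j) \<le> (\<Sum>\<^sub>\<infinity>j. norm (b j))" for j
    using finite_sum_le_infsum[OF b', of "{j}"] by auto
  then have "(\<lambda>j. norm (a j * b (m - j))) summable_on UNIV"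
    by (intro summable_on_comparison_test[OF summable_on_cmult_left[OF a', of "\<Sum>\<^sub>\<infinity>j. norm (b j)"]])
      (auto simp: norm_mult intro!: mult_left_mono)
  then show ?thesis by (rule abs_summable_summable)
qed

section \<open>The functions C, D, S and their differential equations\<close>

text \<open>Monotonicity makes all differences nonnegative; this turns the ordered telescoping
  limits at both ends into an unordered sum.\<close>

lemma has_sum_int_telescope:
  fixes g :: "int \<Rightarrow> real"
  assumes mono: "mono g" and L: "(\<lambda>n. g (int n)) \<longlonglongrightarrow> L" and M: "(\<lambda>n. g (- int n)) \<longlonglongrightarrow> M"
  shows "((\<lambda>l. g (l + 1) - g l) has_sum (L - M)) UNIV"
proof -
  let ?f = "\<lambda>l. g (l + 1) - g l"
  have nonneg: "?f l \<ge> 0" for l using monoD[OF mono, of l "l + 1"] by simp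
  have "(\<lambda>n. ?f (int n)) sums (L - g (int 0))"
    using telescope_sums[OF L] by (simp add: add.commute)
  then have "((\<lambda>n. ?f (int n)) has_sum (L - g 0)) UNIV"
    by (intro sums_nonneg_imp_has_sum) (use nonneg in auto)
  moreover have "bij_betw int UNIV {0..}"
    by (rule bij_betwI[where g = nat]) auto
  ultimately have 1: "(?f has_sum (L - g 0)) {0..}"
    using has_sum_reindex_bij_betw[of int UNIV "{0..}" ?f] by simp
  let ?k = "\<lambda>n. - int n - 1"
  have k: "- int (Suc n) = ?k n" "?k n + 1 = - int n" for n by simp_all
  have "(\<lambda>n. ?f (?k n)) sums (g 0 - M)"
    using telescope_sums'[OF M] unfolding k by simp
  then have "((\<lambda>n. ?f (?k n)) has_sum (g 0 - M)) UNIV"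
    by (intro sums_nonneg_imp_has_sum nonneg)
  moreover have "bij_betw ?k UNIV {..<0}"
    by (rule bij_betwI[where g = "\<lambda>j. nat (- j - 1)"]) auto
  ultimately have 2: "(?f has_sum (g 0 - M)) {..<0}"
    using has_sum_reindex_bij_betw[of ?k UNIV "{..<0}" ?f] by simp
  have "(?f has_sum (L - g 0 + (g 0 - M))) ({0..} \<union> {..<0})"
    by (rule has_sum_Un_disjoint[OF 1 2]) auto
  moreover have "{0..} \<union> {..<0} = (UNIV :: int set)" by auto
  ultimately show ?thesis by simp
qed

lemma bij_int_add: "bij (\<lambda>l. l + c :: int)"
  by (rule bij_betwI[where g = "\<lambda>l. l - c"]) auto

lemma bij_int_uminus: "bij (uminus :: int \<Rightarrow> int)"
  by (rule bij_betwI[where g = uminus]) auto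

lemma has_sum_int_uminus:
  assumes "(f has_sum s) (UNIV :: int set)"
  shows "((\<lambda>j. f (- j)) has_sum s) UNIV"
  using has_sum_reindex_bij_betw[OF bij_int_uminus, of f s] assms by simp

text \<open>A difference over \<open>n\<close> steps is a sum of \<open>n\<close> shifted one-step
  differences, each contributing \<open>L - M\<close>.\<close>

lemma has_sum_int_telescope_steps:
  fixes g :: "int \<Rightarrow> real"
  assumes "mono g" "(\<lambda>n. g (int n)) \<longlonglongrightarrow> L" "(\<lambda>n. g (- int n)) \<longlonglongrightarrow> M"
  shows "((\<lambda>l. g (l + int n) - g l) has_sum (of_nat n * (L - M))) UNIV"
proof (induction n)
  case (Suc n)
  have "((\<lambda>l. g ((l + int n) + 1) - g (l + int n)) has_sum (L - M)) UNIV"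
    using has_sum_reindex_bij_betw[OF bij_int_add[of "int n"], of "\<lambda>l. g (l + 1) - g l" "L - M"]
      has_sum_int_telescope[OF assms] by simp
  from has_sum_add[OF this Suc] show ?case by (simp add: algebra_simps)
qed simp

lemma has_sum_int_odd:
  assumes "((\<lambda>l. f (2 * l + 1)) has_sum s) (UNIV :: int set)"
  shows "((\<lambda>j. if odd j then f j else 0) has_sum s) UNIV"
proof -
  have inj: "inj (\<lambda>l :: int. 2 * l + 1)" by (rule injI) simp
  have "(f has_sum s) (range (\<lambda>l :: int. 2 * l + 1))"
    using has_sum_reindex[OF inj, of f s] assms by (simp add: o_def)
  then show ?thesis
    by (rule has_sum_cong_neutral[THEN iffD1, rotated -1]) (auto elim!: oddE)
qed

lemma tanh_progression_limits:
  fixes a b :: real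
  assumes "a > 0"
  shows "(\<lambda>n. tanh (a * real n + b)) \<longlonglongrightarrow> 1" and "(\<lambda>n. tanh (- a * real n + b)) \<longlonglongrightarrow> - 1"
proof -
  have "filterlim (\<lambda>n. a * real n + b) at_top sequentially"
    using assms filterlim_real_sequentially
    by (intro filterlim_tendsto_add_at_top[OF tendsto_const, of _ _ b, simplified add.commute[of b]]
        filterlim_tendsto_pos_mult_at_top[OF tendsto_const]) auto
  then show "(\<lambda>n. tanh (a * real n + b)) \<longlonglongrightarrow> 1"
    by (rule filterlim_compose[OF tanh_real_at_top])
  have "filterlim (\<lambda>n. a * real n - b) at_top sequentially"
    using assms filterlim_real_sequentially
    by (intro filterlim_tendsto_add_at_top[OF tendsto_const, of _ _ "- b", simplified add.commute[of "- b"], simplified]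
        filterlim_tendsto_pos_mult_at_top[OF tendsto_const]) auto
  then have "(\<lambda>n. tanh (a * real n - b)) \<longlonglongrightarrow> 1"
    by (rule filterlim_compose[OF tanh_real_at_top])
  then have "(\<lambda>n. - tanh (a * real n - b)) \<longlonglongrightarrow> - 1" by (rule tendsto_minus)
  then show "(\<lambda>n. tanh (- a * real n + b)) \<longlonglongrightarrow> - 1"
    by (simp flip: tanh_minus)
qed

lemma sech_le: "1 / cosh x \<le> 2 * exp (- \<bar>x\<bar>)" for x :: real
proof -
  have "exp \<bar>x\<bar> / 2 \<le> cosh x" unfolding cosh_def by (cases "x \<ge> 0") auto
  then have "exp \<bar>x\<bar> \<le> 2 * cosh x" by simp
  then show ?thesis by (simp add: exp_minus field_simps)
qed

text \<open>In a convolution a + b is fixed, so this form of the addition theorem pulls the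
  denominator out of the sum and leaves coth plus tanh.\<close>

lemma csch_mult_sech:
  fixes a b :: real
  assumes "sinh a \<noteq> 0"
  shows "1 / sinh a * (1 / cosh b) = (cosh a / sinh a + tanh b) / cosh (a + b)"
proof -
  have "cosh a / sinh a + tanh b = cosh (a + b) / (sinh a * cosh b)"
    using assms by (simp add: divide_simps tanh_def cosh_add)
  then show ?thesis by simp
qed

lemma sech_mult_sech:
  fixes a b :: real
  assumes "sinh (a + b) \<noteq> 0"
  shows "1 / cosh a * (1 / cosh b) = (tanh a + tanh b) / sinh (a + b)"
proof -
  have "tanh a + tanh b = sinh (a + b) / (cosh a * cosh b)"
    by (simp add: divide_simps tanh_def sinh_add)
  then show ?thesis using assms by simp
qed

lemma lser_uminus: "lser (\<lambda>j. - a j) w = - lser a w"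
  unfolding lser_def by (simp add: infsum_uminus)

text \<open>At x = jh the square of exp (-x) is the j-th power of the nome; this is the shape of the
  terms in the theorem.\<close>

lemma sech_eq: "1 / cosh x = 2 * exp (- x) / (1 + exp (- x) ^ 2)" for x :: real
proof -
  have "exp x * exp (- x) = 1" by (simp add: exp_minus)
  then have "2 * exp (- x) * cosh x = 1 + exp (- x) ^ 2"
    unfolding cosh_def by (simp add: power2_eq_square algebra_simps)
  moreover have "1 + exp (- x) ^ 2 > 0" by (simp add: add_pos_pos)
  ultimately show ?thesis by (simp add: field_simps)
qed

lemma csch_eq: "x \<noteq> 0 \<Longrightarrow> 1 / sinh x = 2 * exp (- x) / (1 - exp (- x) ^ 2)" for x :: real
proof -
  assume "x \<noteq> 0"
  have "exp x * exp (- x) = 1" by (simp add: exp_minus)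
  then have "2 * exp (- x) * sinh x = 1 - exp (- x) ^ 2"
    unfolding sinh_def by (simp add: power2_eq_square algebra_simps)
  moreover have "sinh x \<noteq> 0" using \<open>x \<noteq> 0\<close> by simp
  moreover have "1 - exp (- x) ^ 2 \<noteq> 0" using calculation by (metis exp_not_eq_zero mult_eq_0_iff zero_neq_numeral)
  ultimately show ?thesis by (simp add: field_simps)
qed

locale half_period =
  fixes h :: real
  assumes h_pos: "h > 0"
begin

text \<open>As tanh is odd, the summand at j = 2l + 1 is a difference over m steps of a monotone
  function with limits 1 and -1, whence m * 2. Negative m follows by changing all signs.\<close>

lemma has_sum_odd_tanh:
  "((\<lambda>j. if odd j then tanh (of_int (m + j) * h) + tanh (of_int (m - j) * h) else 0) has_sum (2 * of_int m)) UNIV"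
proof -
  have nat: "((\<lambda>j. if odd j then tanh (of_int (int n + j) * h) + tanh (of_int (int n - j) * h) else 0)
      has_sum (2 * real n)) UNIV" for n
  proof (rule has_sum_int_odd)
    \<comment> \<open>The shift l \<mapsto> l + n changes 2l + 1 - n into 2l + 1 + n, which is the
      other argument.\<close>
    define g where "g l = tanh (of_int (2 * l + 1 - int n) * h)" for l
    have mono: "mono g" unfolding g_def using h_pos by (intro monoI) (auto intro!: mult_right_mono)
    have L: "(\<lambda>k. g (int k)) \<longlonglongrightarrow> 1" "(\<lambda>k. g (- int k)) \<longlonglongrightarrow> - 1"
      using tanh_progression_limits[of "2 * h" "(1 - real n) * h"] h_pos by (auto simp: g_def algebra_simps)
    have "((\<lambda>l. g (l + int n) - g l) has_sum (of_nat n * (1 - (- 1)))) UNIV"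
      by (rule has_sum_int_telescope_steps[OF mono L])
    moreover have "g (l + int n) - g l = tanh (of_int (int n + (2 * l + 1)) * h) + tanh (of_int (int n - (2 * l + 1)) * h)" for l
    proof -
      have "- g l = tanh (of_int (int n - (2 * l + 1)) * h)"
        unfolding g_def tanh_minus[symmetric] by (simp add: algebra_simps)
      then show ?thesis unfolding g_def by (simp add: algebra_simps)
    qed
    ultimately show "((\<lambda>l. tanh (of_int (int n + (2 * l + 1)) * h) + tanh (of_int (int n - (2 * l + 1)) * h)) has_sum 2 * real n) UNIV"
      by (simp add: mult.commute)
  qed
  show ?thesis
  proof (cases "m \<ge> 0")
    case True
    then obtain n where "m = int n" using nonneg_int_cases by blast
    show ?thesis using nat[of n] unfolding \<open>m = int n\<close> by (simp only: of_int_of_nat_eq)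
  next
    case False
    then have m: "m = - int (nat (- m))" by simp
    define n where "n = nat (- m)"
    have "- (if odd j then tanh (of_int (int n + j) * h) + tanh (of_int (int n - j) * h) else 0)
       = (if odd j then tanh (of_int (m + j) * h) + tanh (of_int (m - j) * h) else 0)" for j
      using m unfolding n_def[symmetric] by (simp flip: tanh_minus add: algebra_simps)
    then show ?thesis using has_sum_uminusI[OF nat[of n]] m n_def by simp
  qed
qed

text \<open>Since \<open>\<phi>\<close> is odd, adding the series to its reflection \<open>j \<mapsto> -j\<close> removes \<open>\<phi>\<close>.\<close>

lemma has_sum_odd_tanh_conv:
  fixes \<phi> :: "int \<Rightarrow> real"
  assumes "(\<lambda>j. if odd j then \<phi> j + tanh (of_int (m - j) * h) else 0) summable_on UNIV"
    and \<phi>: "\<And>j. \<phi> (- j) = - \<phi> j"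
  shows "((\<lambda>j. if odd j then \<phi> j + tanh (of_int (m - j) * h) else 0) has_sum of_int m) UNIV"
proof -
  let ?f = "\<lambda>j. if odd j then \<phi> j + tanh (of_int (m - j) * h) else 0"
  obtain s where s: "(?f has_sum s) UNIV" using assms(1) by (auto simp: summable_on_def)
  have "((\<lambda>j. ?f j + ?f (- j)) has_sum (s + s)) UNIV"
    by (intro has_sum_add s has_sum_int_uminus)
  moreover have "?f j + ?f (- j) = (if odd j then tanh (of_int (m + j) * h) + tanh (of_int (m - j) * h) else 0)" for j
    by (simp add: \<phi>)
  ultimately have "s + s = 2 * of_int m"
    using has_sum_unique[OF has_sum_odd_tanh[of m]] by auto
  with s show ?thesis by simp
qed

definition cD :: "int \<Rightarrow> complex" where
  "cD j = (if even j then of_real (1 / cosh (of_int j * h)) else 0)"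

definition cC :: "int \<Rightarrow> complex" where
  "cC j = (if odd j then of_real (1 / cosh (of_int j * h)) else 0)"

text \<open>csch is odd in j, so the factor \<open>- \<i>\<close> makes the series a real sine
  series with coefficients 2 csch (jh), j > 0.\<close>

definition cS :: "int \<Rightarrow> complex" where
  "cS j = (if odd j then - \<i> * of_real (1 / sinh (of_int j * h)) else 0)"

text \<open>csch has a pole at 0, so the bound needs a distance from it; odd multiples of
  \<open>h\<close> keep the distance \<open>h\<close>.\<close>

lemma csch_le: "\<bar>1 / sinh x\<bar> \<le> 2 / (1 - exp (- 2 * h)) * exp (- \<bar>x\<bar>)" if "\<bar>x\<bar> \<ge> h" for x :: real
proof -
  have x: "\<bar>sinh x\<bar> = (exp \<bar>x\<bar> - exp (- \<bar>x\<bar>)) / 2"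
    unfolding sinh_real_abs[symmetric] by (simp add: sinh_def)
  have p: "1 - exp (- 2 * h) > 0" using h_pos by simp
  have "exp (- 2 * \<bar>x\<bar>) \<le> exp (- 2 * h)" using that by simp
  then have "exp \<bar>x\<bar> * (1 - exp (- 2 * h)) \<le> exp \<bar>x\<bar> * (1 - exp (- 2 * \<bar>x\<bar>))" by (intro mult_left_mono) auto
  also have "\<dots> = 2 * \<bar>sinh x\<bar>" unfolding x by (simp add: right_diff_distrib exp_add[symmetric])
  finally have "exp \<bar>x\<bar> * (1 - exp (- 2 * h)) \<le> 2 * \<bar>sinh x\<bar>" .
  moreover have "\<bar>sinh x\<bar> > 0" using that h_pos by auto
  ultimately show ?thesis using p by (simp add: exp_minus field_simps abs_divide)
qed

lemma odd_abs_ge: "\<bar>of_int j * h\<bar> \<ge> h" if "odd j" for j :: int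
proof -
  have "\<bar>j\<bar> \<ge> 1" using that by presburger
  then have "1 \<le> \<bar>of_int j :: real\<bar>" by linarith
  then have "1 * h \<le> \<bar>of_int j\<bar> * h" using h_pos by (intro mult_right_mono) auto
  then show ?thesis using h_pos by (simp add: abs_mult)
qed

lemma sinh_odd_nonzero: "sinh (of_int j * h) \<noteq> 0" if "odd j" for j :: int
  using odd_abs_ge[OF that] h_pos by auto

lemma norm_coeff_le:
  "norm (cC j) \<le> 2 * exp (- \<bar>of_int j * h\<bar>)"
  "norm (cD j) \<le> 2 * exp (- \<bar>of_int j * h\<bar>)"
  "norm (cS j) \<le> 2 / (1 - exp (- 2 * h)) * exp (- \<bar>of_int j * h\<bar>)"
  using sech_le[of "of_int j * h"] csch_le[OF odd_abs_ge, of j] h_pos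
  by (auto simp: cC_def cD_def cS_def norm_mult norm_divide simp del: abs_divide)

lemma lconv_exp_decay:
  assumes "M \<ge> 0" "\<And>j. norm (a j) \<le> M * exp (- \<bar>of_int j * h\<bar>)"
  shows "lconv (- h) h a"
proof (rule lconv_bounded[OF assms(1)])
  fix j :: int
  show "norm (a j) \<le> M * exp (of_int j * - h)" if "j \<ge> 0"
    using assms(2)[of j] that h_pos by (simp add: abs_mult)
  show "norm (a j) \<le> M * exp (of_int j * h)" if "j < 0"
    using assms(2)[of j] that h_pos by (simp add: abs_mult)
qed

lemma lconv_main: "lconv (- h) h cC" "lconv (- h) h cD" "lconv (- h) h cS"
  by (rule lconv_exp_decay[OF _ norm_coeff_le(1)] lconv_exp_decay[OF _ norm_coeff_le(2)]
      lconv_exp_decay[OF _ norm_coeff_le(3)], use h_pos in simp)+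

text \<open>One computation for both products S C and S D. The prefactor depends on m only; the coth
  terms are odd in j and cancel under reflection, leaving the tanh sum.\<close>

lemma odd_conv_csch:
  assumes X: "lconv (- h) h X"
    and Xm: "\<And>j. odd j \<Longrightarrow> X (m - j) = of_real (1 / cosh (of_int (m - j) * h))"
  shows "((\<lambda>j. cS j * X (m - j)) has_sum (- \<i> * of_int m / of_real (cosh (of_int m * h)))) UNIV"
proof -
  define f where "f j = (if odd j then cosh (of_int j * h) / sinh (of_int j * h) + tanh (of_int (m - j) * h) else 0)" for j
  let ?c = "cosh (of_int m * h)"
  have eq: "cS j * X (m - j) = (- \<i> / of_real ?c) * of_real (f j)" for j
  proof (cases "odd j")
    case True
    have r: "1 / sinh (of_int j * h) * (1 / cosh (of_int (m - j) * h)) = f j / ?c"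
      using csch_mult_sech[OF sinh_odd_nonzero[OF True], of "of_int (m - j) * h"] True
      by (simp add: f_def distrib_right[symmetric])
    have "complex_of_real (1 / sinh (of_int j * h)) * of_real (1 / cosh (of_int (m - j) * h)) = of_real (f j / ?c)"
      unfolding of_real_mult[symmetric] r ..
    then show ?thesis using True Xm[OF True] by (simp add: cS_def mult.assoc del: of_real_divide) (simp add: field_simps)
  qed (simp add: f_def cS_def)
  \<comment> \<open>Summability of the coth-tanh family is recovered from that of the convolution,
    by dividing out the prefactor.\<close>
  have "(\<lambda>j. cS j * X (m - j)) summable_on UNIV"
    by (rule lconv_conv_summable[OF lconv_main(3) X]) (use h_pos in auto)
  from summable_on_cmult_right[OF this, of "\<i> * of_real ?c"]
  have "(\<lambda>j. complex_of_real (f j)) summable_on UNIV"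
    unfolding eq by (simp add: field_simps)
  from summable_on_Re[OF this] have "f summable_on UNIV" by simp
  then have "(f has_sum of_int m) UNIV"
    unfolding f_def by (intro has_sum_odd_tanh_conv) auto
  from has_sum_cmult_right[OF has_sum_of_real[OF this], of "- \<i> / of_real ?c"]
  show ?thesis unfolding eq by simp
qed

text \<open>The coefficient form of D' = -S C. Two odd indices have an even sum, so for odd m both
  sides vanish.\<close>

lemma conv_S_C: "((\<lambda>j. cS j * cC (m - j)) has_sum - lder 1 cD m) UNIV"
proof (cases "even m")
  case True
  then show ?thesis using odd_conv_csch[OF lconv_main(1), of m]
    by (simp add: lder_def cD_def cC_def)
next
  case False
  then have z: "(\<lambda>j. cS j * cC (m - j)) = (\<lambda>_. 0)" by (auto simp: cS_def cC_def)
  have "lder 1 cD m = 0" using False by (simp add: lder_def cD_def)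
  then show ?thesis unfolding z by simp
qed

lemma conv_S_D: "((\<lambda>j. cS j * cD (m - j)) has_sum - lder 1 cC m) UNIV"
proof (cases "odd m")
  case True
  then show ?thesis using odd_conv_csch[OF lconv_main(2), of m]
    by (simp add: lder_def cD_def cC_def)
next
  case False
  then have z: "(\<lambda>j. cS j * cD (m - j)) = (\<lambda>_. 0)" by (auto simp: cS_def cD_def)
  have "lder 1 cC m = 0" using False by (simp add: lder_def cC_def)
  then show ?thesis unfolding z by simp
qed

lemma conv_C_D: "((\<lambda>j. cC j * cD (m - j)) has_sum lder 1 cS m) UNIV"
proof (cases "odd m")
  case m: True
  define f where "f j = (if odd j then tanh (of_int j * h) + tanh (of_int (m - j) * h) else 0)" for j
  let ?c = "sinh (of_int m * h)"
  have c: "?c \<noteq> 0" by (rule sinh_odd_nonzero[OF m])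
  have eq: "cC j * cD (m - j) = (1 / of_real ?c) * of_real (f j)" for j
  proof (cases "odd j")
    case True
    have r: "1 / cosh (of_int j * h) * (1 / cosh (of_int (m - j) * h)) = f j / ?c"
      using sech_mult_sech[of "of_int j * h" "of_int (m - j) * h"] True c
      by (simp add: f_def distrib_right[symmetric])
    have "complex_of_real (1 / cosh (of_int j * h)) * of_real (1 / cosh (of_int (m - j) * h)) = of_real (f j / ?c)"
      unfolding of_real_mult[symmetric] r ..
    then show ?thesis using True m by (simp add: cC_def cD_def)
  qed (simp add: f_def cC_def)
  have "(\<lambda>j. cC j * cD (m - j)) summable_on UNIV"
    by (rule lconv_conv_summable[OF lconv_main(1,2)]) (use h_pos in auto)
  from summable_on_cmult_right[OF this, of "of_real ?c"]
  have "(\<lambda>j. complex_of_real (f j)) summable_on UNIV"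
    unfolding eq using c by (simp add: field_simps)
  from summable_on_Re[OF this] have "f summable_on UNIV" by simp
  then have "(f has_sum of_int m) UNIV"
    unfolding f_def by (intro has_sum_odd_tanh_conv) auto
  from has_sum_cmult_right[OF has_sum_of_real[OF this], of "1 / complex_of_real ?c"]
  moreover have "lder 1 cS m = 1 / of_real ?c * of_int m"
    using m c by (simp add: lder_def cS_def field_simps)
  ultimately show ?thesis unfolding eq by simp
next
  case False
  then have z: "(\<lambda>j. cC j * cD (m - j)) = (\<lambda>_. 0)" by (auto simp: cC_def cD_def)
  have "lder 1 cS m = 0" using False by (simp add: lder_def cS_def)
  then show ?thesis unfolding z by simp
qed

abbreviation "S \<equiv> lser cS"
abbreviation "C \<equiv> lser cC"
abbreviation "D \<equiv> lser cD"

lemma strip_ode: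
  assumes w: "- h < Im w" "Im w < h"
  shows "lser (lder 1 cS) w = C w * D w"
    and "lser (lder 1 cC) w = - S w * D w"
    and "lser (lder 1 cD) w = - S w * C w"
  using lser_mult[OF lconv_main(1,2) w conv_C_D] lser_mult[OF lconv_main(3,2) w conv_S_D]
    lser_mult[OF lconv_main(3,1) w conv_S_C] by (auto simp: lser_uminus)

lemma strip_deriv:
  assumes w: "- h < Im w" "Im w < h"
  shows "(S has_field_derivative C w * D w) (at w)"
    and "(C has_field_derivative - S w * D w) (at w)"
    and "(D has_field_derivative - S w * C w) (at w)"
  using has_field_derivative_lser_lder[OF lconv_main(1) w, of 0]
    has_field_derivative_lser_lder[OF lconv_main(2) w, of 0]
    has_field_derivative_lser_lder[OF lconv_main(3) w, of 0] strip_ode[OF w] by auto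

text \<open>The conserved quantities C^2 + S^2 and D^2 + S^2; they turn out to be k^2 z^2 and
  z^2.\<close>

definition al :: complex where "al = (C 0)\<^sup>2"
definition be :: complex where "be = (D 0)\<^sup>2"

lemma S_0: "S 0 = 0"
proof -
  have "(cS has_sum S 0) UNIV" using lconv_has_sum[OF lconv_main(3), of 0] h_pos by simp
  moreover have "cS (- j) = - cS j" for j by (simp add: cS_def)
  ultimately have "((\<lambda>j. - cS j) has_sum S 0) UNIV"
    using has_sum_int_uminus[of cS "S 0"] by simp
  from has_sum_uminusI[OF this] have "(cS has_sum - S 0) UNIV" by simp
  with \<open>(cS has_sum S 0) UNIV\<close> have "S 0 = - S 0" by (rule has_sum_unique)
  then show ?thesis by simp
qed

lemma strip_convex: "convex {w. - h < Im w \<and> Im w < h}" "open {w. - h < Im w \<and> Im w < h}"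
proof -
  have "{w. - h < Im w \<and> Im w < h} = {w. Im w > - h} \<inter> {w. Im w < h}" by auto
  then show "convex {w. - h < Im w \<and> Im w < h}" "open {w. - h < Im w \<and> Im w < h}"
    by (auto intro!: convex_Int convex_halfspace_Im_gt convex_halfspace_Im_lt open_Int open_halfspace_Im_gt open_halfspace_Im_lt)
qed

lemma strip_const:
  assumes "\<And>w. - h < Im w \<Longrightarrow> Im w < h \<Longrightarrow> (f has_field_derivative 0) (at w)"
    and "- h < Im w" "Im w < h"
  shows "f w = f 0"
proof -
  have "\<exists>c. \<forall>w\<in>{w. - h < Im w \<and> Im w < h}. f w = c"
    by (rule has_field_derivative_zero_constant[OF strip_convex(1)])
      (use assms(1) in \<open>auto intro: has_field_derivative_at_within\<close>)
  then show ?thesis using assms h_pos by auto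
qed

lemma strip_squares:
  assumes w: "- h < Im w" "Im w < h"
  shows "(C w)\<^sup>2 = al - (S w)\<^sup>2" and "(D w)\<^sup>2 = be - (S w)\<^sup>2"
proof -
  have "(C w)\<^sup>2 + (S w)\<^sup>2 = (C 0)\<^sup>2 + (S 0)\<^sup>2"
    by (rule strip_const[OF _ w]) (auto intro!: derivative_eq_intros strip_deriv simp: algebra_simps)
  then show "(C w)\<^sup>2 = al - (S w)\<^sup>2" by (simp add: al_def S_0 algebra_simps)
  have "(D w)\<^sup>2 + (S w)\<^sup>2 = (D 0)\<^sup>2 + (S 0)\<^sup>2"
    by (rule strip_const[OF _ w]) (auto intro!: derivative_eq_intros strip_deriv simp: algebra_simps)
  then show "(D w)\<^sup>2 = be - (S w)\<^sup>2" by (simp add: be_def S_0 algebra_simps)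
qed

end

section \<open>The complete elliptic integral\<close>

text \<open>The substitution u = t(x): \<open>t\<close> increases from 0 to 1, and \<open>c\<close>
  times its inverse is a primitive of the integrand. Differentiability is asked only in the open
  interval because the integrand is singular at u = 1; continuity covers the endpoints.\<close>

lemma elliptic_K_parametrized:
  fixes t :: "real \<Rightarrow> real"
  assumes b: "0 < b" and c: "0 < c"
    and cont: "continuous_on {0..b} t" and t0: "t 0 = 0" and tb: "t b = 1"
    and pos: "\<And>x. 0 < x \<Longrightarrow> x < b \<Longrightarrow> (1 - (t x)\<^sup>2) * (1 - k\<^sup>2 * (t x)\<^sup>2) > 0"
    and deriv: "\<And>x. 0 < x \<Longrightarrow> x < b \<Longrightarrow>
      (t has_real_derivative c * sqrt ((1 - (t x)\<^sup>2) * (1 - k\<^sup>2 * (t x)\<^sup>2))) (at x)"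
  shows "elliptic_K k = c * b"
proof -
  have inc: "t x < t y" if "0 \<le> x" "x < y" "y \<le> b" for x y
  proof (rule DERIV_pos_imp_increasing_open[OF \<open>x < y\<close>])
    show "continuous_on {x..y} t" by (rule continuous_on_subset[OF cont]) (use that in auto)
    fix u assume "x < u" "u < y"
    then have u: "0 < u" "u < b" using that by auto
    show "\<exists>d. (t has_real_derivative d) (at u) \<and> 0 < d"
      using deriv[OF u] pos[OF u] c by (auto intro!: exI mult_pos_pos)
  qed
  then have inj: "inj_on t {0..b}"
    by (intro linorder_inj_onI) fastforce+
  define g where "g = inv_into {0..b} t"
  have gt: "g (t x) = x" if "x \<in> {0..b}" for x unfolding g_def using inj that by simp
  have im: "t ` {0..b} = {0..1}"
  proof
    show "t ` {0..b} \<subseteq> {0..1}"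
    proof clarsimp
      fix x assume "0 \<le> x" "x \<le> b"
      then show "0 \<le> t x \<and> t x \<le> 1"
        using inc[of 0 x] inc[of x b] t0 tb by (cases "x = 0"; cases "x = b") auto
    qed
    show "{0..1} \<subseteq> t ` {0..b}"
    proof
      fix u :: real assume "u \<in> {0..1}"
      then have "\<exists>x\<ge>0. x \<le> b \<and> t x = u"
        using b t0 tb cont by (intro IVT') auto
      then show "u \<in> t ` {0..b}" by auto
    qed
  qed
  have contg: "continuous_on {0..1} g"
    unfolding im[symmetric] by (rule continuous_on_inv[OF cont]) (use gt in auto)
  have tg: "t (g u) = u" "g u \<in> {0..b}" if "u \<in> {0..1}" for u
    using that unfolding g_def im[symmetric] by (rule f_inv_into_f, rule inv_into_into)
  have g01: "g 0 = 0" "g 1 = b" using gt[of 0] gt[of b] b t0 tb by auto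
  have dg: "((\<lambda>u. c * g u) has_real_derivative 1 / sqrt ((1 - u\<^sup>2) * (1 - k\<^sup>2 * u\<^sup>2))) (at u)"
    if "u \<in> {0<..<1}" for u
  proof -
    have u: "u \<in> {0..1}" using that by auto
    have "g u \<noteq> 0" "g u \<noteq> b" using tg(1)[OF u] t0 tb that by auto
    then have gu: "0 < g u" "g u < b" using tg(2)[OF u] by auto
    have isC: "isCont g u"
      using contg that by (auto intro: continuous_on_interior)
    let ?r = "sqrt ((1 - u\<^sup>2) * (1 - k\<^sup>2 * u\<^sup>2))"
    have "?r > 0" using pos[OF gu] unfolding tg(1)[OF u] by simp
    have "(g has_real_derivative inverse (c * ?r)) (at u)"
      by (rule DERIV_inverse_function[where f = t and a = 0 and b = 1])
        (use deriv[OF gu] tg(1) that c \<open>?r > 0\<close> isC in auto)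
    from DERIV_cmult[OF this, of c] show ?thesis using c by (simp add: field_simps)
  qed
  have "((\<lambda>u. 1 / sqrt ((1 - u\<^sup>2) * (1 - k\<^sup>2 * u\<^sup>2))) has_integral (c * g 1 - c * g 0)) {0..1}"
    using dg contg
    by (intro fundamental_theorem_of_calculus_interior)
      (auto intro!: continuous_intros simp: has_real_derivative_iff_has_vector_derivative[symmetric])
  then show ?thesis unfolding elliptic_K_def g01 by (simp add: integral_unique)
qed

definition elliptic_integrand :: "real \<Rightarrow> real \<Rightarrow> real" where
  "elliptic_integrand k t = 1 / sqrt ((1 - t\<^sup>2) * (1 - k\<^sup>2 * t\<^sup>2))"

lemma has_integral_arcsin_deriv: "((\<lambda>t. 1 / sqrt (1 - t\<^sup>2)) has_integral pi / 2) {0..1}"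
proof -
  have "((\<lambda>t. 1 / sqrt (1 - t\<^sup>2)) has_integral (arcsin 1 - arcsin 0)) {0..1::real}"
    by (intro fundamental_theorem_of_calculus_interior)
      (auto intro!: continuous_intros derivative_eq_intros
        simp: has_real_derivative_iff_has_vector_derivative[symmetric] divide_inverse)
  then show ?thesis by simp
qed

lemma elliptic_bounds:
  assumes "0 \<le> k" "k < 1" "0 \<le> t" "t \<le> (1::real)"
  shows "k\<^sup>2 * t\<^sup>2 \<le> k\<^sup>2" "k\<^sup>2 < 1" "k\<^sup>2 * t\<^sup>2 < 1" "t\<^sup>2 \<le> 1"
proof -
  show "t\<^sup>2 \<le> 1" using assms by (simp add: power_le_one)
  then show "k\<^sup>2 * t\<^sup>2 \<le> k\<^sup>2" using mult_left_mono[of "t\<^sup>2" 1 "k\<^sup>2"] by simp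
  moreover show "k\<^sup>2 < 1" using assms by (simp add: power_less_one_iff)
  ultimately show "k\<^sup>2 * t\<^sup>2 < 1" by linarith
qed

text \<open>Since 1 - k^2 t^2 \<ge> 1 - k^2, the integrand is dominated by a multiple of the
  derivative of arcsin.\<close>

lemma elliptic_integrable:
  assumes k: "0 \<le> k" "k < 1"
  shows "elliptic_integrand k integrable_on {0..1}"
proof (rule measurable_bounded_by_integrable_imp_integrable)
  have "elliptic_integrand k \<in> borel_measurable borel"
    unfolding elliptic_integrand_def by measurable
  then show "elliptic_integrand k \<in> borel_measurable (lebesgue_on {0..1})"
    by (intro measurable_restrict_space1 measurable_completion) simp
  show "(\<lambda>t. 1 / sqrt (1 - k\<^sup>2) * (1 / sqrt (1 - t\<^sup>2))) integrable_on {0..1}"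
    by (intro integrable_on_mult_right) (use has_integral_arcsin_deriv in auto)
  fix t :: real assume t: "t \<in> {0..1}"
  have "1 / sqrt (1 - k\<^sup>2 * t\<^sup>2) \<le> 1 / sqrt (1 - k\<^sup>2)"
    using elliptic_bounds[OF k, of t] t by (intro divide_left_mono) auto
  then have "1 / sqrt (1 - k\<^sup>2 * t\<^sup>2) * (1 / sqrt (1 - t\<^sup>2)) \<le> 1 / sqrt (1 - k\<^sup>2) * (1 / sqrt (1 - t\<^sup>2))"
    using elliptic_bounds[OF k, of t] t by (intro mult_right_mono) auto
  moreover have "norm (elliptic_integrand k t) = 1 / sqrt (1 - k\<^sup>2 * t\<^sup>2) * (1 / sqrt (1 - t\<^sup>2))"
    using elliptic_bounds[OF k, of t] t by (auto simp: elliptic_integrand_def real_sqrt_mult)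
  ultimately show "norm (elliptic_integrand k t) \<le> 1 / sqrt (1 - k\<^sup>2) * (1 / sqrt (1 - t\<^sup>2))" by simp
qed auto

text \<open>For 0 < x \<le> y \<le> 1: 1/x - 1/y = (y - x)/(xy) \<ge> y - x \<ge> (y^2 -
  x^2)/2.\<close>

lemma inverse_sqrt_diff_ge:
  assumes "0 \<le> a" "a \<le> b" "b < (1::real)"
  shows "(b - a) / 2 \<le> 1 / sqrt (1 - b) - 1 / sqrt (1 - a)"
proof -
  define x y where "x = sqrt (1 - b)" and "y = sqrt (1 - a)"
  have xy: "0 < x" "x \<le> y" "y \<le> 1" using assms by (auto simp: x_def y_def)
  have "b - a = y\<^sup>2 - x\<^sup>2" using assms by (simp add: x_def y_def)
  also have "\<dots> = (y - x) * (y + x)" by (simp add: power2_eq_square algebra_simps)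
  also have "\<dots> \<le> (y - x) * 2" using xy by (intro mult_left_mono) auto
  finally have 1: "(b - a) / 2 \<le> y - x" by simp
  have "x * y \<le> 1" using xy by (simp add: mult_le_one)
  then have "(y - x) * (x * y) \<le> (y - x) * 1" using xy by (intro mult_left_mono) auto
  then have "y - x \<le> (y - x) / (x * y)" using xy by (simp add: pos_le_divide_eq)
  also have "\<dots> = 1 / x - 1 / y" using xy by (simp add: field_simps)
  finally show ?thesis using 1 by (simp add: x_def y_def)
qed

text \<open>An explicit gap gives strict monotonicity without a strict comparison of integrals. The
  6 comes from integrating (l^2 - k^2) t^2 / 2 over the unit interval.\<close>

lemma elliptic_K_ge:
  assumes k: "0 \<le> k" "k \<le> l" "l < 1"
  shows "elliptic_K k + (l\<^sup>2 - k\<^sup>2) / 6 \<le> elliptic_K l"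
proof -
  \<comment> \<open>At t = 1 both integrands have the default value 1 / 0 = 0, so the gap function
    must vanish there; one point does not affect the integral.\<close>
  define d where "d t = (if t = 1 then 0 else (l\<^sup>2 - k\<^sup>2) / 2 * t\<^sup>2)" for t :: real
  have sq: "(d has_integral ((l\<^sup>2 - k\<^sup>2) / 6)) {0..1::real}"
  proof -
    have "((\<lambda>t. (l\<^sup>2 - k\<^sup>2) / 2 * t\<^sup>2) has_integral ((l\<^sup>2 - k\<^sup>2) / 6 * 1 ^ 3 - (l\<^sup>2 - k\<^sup>2) / 6 * 0 ^ 3)) {0..1::real}"
      by (intro fundamental_theorem_of_calculus)
        (auto intro!: derivative_eq_intros simp: has_real_derivative_iff_has_vector_derivative[symmetric] field_simps)
    then have "((\<lambda>t. (l\<^sup>2 - k\<^sup>2) / 2 * t\<^sup>2) has_integral ((l\<^sup>2 - k\<^sup>2) / 6)) {0..1::real}" by simp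
    then show ?thesis by (rule has_integral_spike_finite[of "{1}", rotated 2]) (auto simp: d_def)
  qed
  have K: "elliptic_K m = integral {0..1} (elliptic_integrand m)" for m
    unfolding elliptic_K_def elliptic_integrand_def ..
  have "integral {0..1} (\<lambda>t. elliptic_integrand k t + d t) \<le> integral {0..1} (elliptic_integrand l)"
  proof (rule integral_le)
    show "(\<lambda>t. elliptic_integrand k t + d t) integrable_on {0..1}"
      using k sq elliptic_integrable[of k] by (intro integrable_add) auto
    show "elliptic_integrand l integrable_on {0..1}" using k by (intro elliptic_integrable) auto
    fix t :: real assume t01: "t \<in> {0..1}"
    show "elliptic_integrand k t + d t \<le> elliptic_integrand l t"
    proof (cases "t = 1")
      case True
      then show ?thesis by (simp add: d_def elliptic_integrand_def)
    next
      case False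
      then have t: "0 \<le> t" "t \<le> 1" "t < 1" using t01 by auto
      have "t\<^sup>2 < 1" using t by (simp add: power_less_one_iff)
      then have s: "0 < sqrt (1 - t\<^sup>2)" "sqrt (1 - t\<^sup>2) \<le> 1" by auto
      have kl: "k\<^sup>2 * t\<^sup>2 \<le> l\<^sup>2 * t\<^sup>2" using k by (intro mult_right_mono power_mono) auto
      have "(l\<^sup>2 * t\<^sup>2 - k\<^sup>2 * t\<^sup>2) / 2 \<le> 1 / sqrt (1 - l\<^sup>2 * t\<^sup>2) - 1 / sqrt (1 - k\<^sup>2 * t\<^sup>2)" (is "?a \<le> ?d")
        using kl elliptic_bounds[of l t] k t by (intro inverse_sqrt_diff_ge) auto
      moreover have "?d \<le> ?d / sqrt (1 - t\<^sup>2)"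
      proof -
        have "0 \<le> ?a" using kl by simp
        then have "0 \<le> ?d" using calculation by linarith
        then have "?d * sqrt (1 - t\<^sup>2) \<le> ?d * 1" using s by (intro mult_left_mono) auto
        then show ?thesis using s by (simp add: pos_le_divide_eq)
      qed
      ultimately have "?a \<le> ?d / sqrt (1 - t\<^sup>2)" by linarith
      also have "\<dots> = elliptic_integrand l t - elliptic_integrand k t"
        by (simp add: elliptic_integrand_def real_sqrt_mult diff_divide_distrib mult.commute)
      finally show ?thesis using False by (simp add: d_def algebra_simps)
    qed
  qed
  moreover have "integral {0..1} (\<lambda>t. elliptic_integrand k t + d t) = elliptic_K k + (l\<^sup>2 - k\<^sup>2) / 6"
    using k sq elliptic_integrable[of k] unfolding K
    by (subst integral_add) (auto simp: integral_unique)
  ultimately show ?thesis unfolding K by simp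
qed

lemma elliptic_K_strict_mono:
  assumes "0 \<le> k" "k < l" "l < 1"
  shows "elliptic_K k < elliptic_K l"
proof -
  have "k\<^sup>2 < l\<^sup>2" using assms by (intro power_strict_mono) auto
  then have "0 < (l\<^sup>2 - k\<^sup>2) / 6" by simp
  moreover have "elliptic_K k + (l\<^sup>2 - k\<^sup>2) / 6 \<le> elliptic_K l" using assms by (intro elliptic_K_ge) auto
  ultimately show ?thesis by linarith
qed

lemma elliptic_K_pos:
  assumes "0 \<le> k" "k < 1"
  shows "elliptic_K k > 0"
proof -
  have "elliptic_K 0 = pi / 2"
    using has_integral_arcsin_deriv by (simp add: elliptic_K_def integral_unique)
  moreover have "elliptic_K 0 + k\<^sup>2 / 6 \<le> elliptic_K k"
    using elliptic_K_ge[of 0 k] assms by simp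
  moreover have "0 \<le> k\<^sup>2 / 6" by simp
  ultimately show ?thesis using pi_gt_zero by linarith
qed

lemma elliptic_ratio_less:
  assumes "0 < k" "k < l" "l < 1"
  shows "elliptic_K (sqrt (1 - l\<^sup>2)) / elliptic_K l < elliptic_K (sqrt (1 - k\<^sup>2)) / elliptic_K k"
proof -
  have sq: "k\<^sup>2 < l\<^sup>2" "l\<^sup>2 < 1" "0 < k\<^sup>2" using assms by (auto simp: power_strict_mono power_less_one_iff)
  have "elliptic_K (sqrt (1 - l\<^sup>2)) < elliptic_K (sqrt (1 - k\<^sup>2))"
    using sq by (intro elliptic_K_strict_mono) auto
  moreover have "elliptic_K k < elliptic_K l" using assms by (intro elliptic_K_strict_mono) auto
  moreover have "0 < elliptic_K k" "0 < elliptic_K (sqrt (1 - l\<^sup>2))"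
    using assms sq by (auto intro!: elliptic_K_pos)
  ultimately show ?thesis by (intro frac_less2) auto
qed

lemma elliptic_ratio_inj:
  assumes "0 < k" "k < 1" "0 < l" "l < 1"
    and "elliptic_K (sqrt (1 - l\<^sup>2)) / elliptic_K l = elliptic_K (sqrt (1 - k\<^sup>2)) / elliptic_K k"
  shows "k = l"
proof -
  have "\<not> k < l" using elliptic_ratio_less[OF assms(1) _ assms(4)] assms(5) by linarith
  moreover have "\<not> l < k" using elliptic_ratio_less[OF assms(3) _ assms(2)] assms(5) by linarith
  ultimately show ?thesis by linarith
qed

section \<open>Identification of the modulus\<close>

lemma lser_neg: "lser a (- w) = lser (\<lambda>j. a (- j)) w"
  unfolding lser_def
  using infsum_reindex_bij_betw[OF bij_int_uminus, of "\<lambda>j. a j * exp (\<i> * of_int j * - w)"] by simp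

lemma cnj_lser: "cnj (lser a w) = lser (\<lambda>j. cnj (a (- j))) (cnj w)"
proof -
  have "cnj (lser a w) = (\<Sum>\<^sub>\<infinity>j. cnj (a j) * exp (- (\<i> * of_int j * cnj w)))"
    unfolding lser_def infsum_cnj[symmetric] by (simp add: exp_cnj)
  also have "\<dots> = (\<Sum>\<^sub>\<infinity>j. cnj (a (- j)) * exp (\<i> * of_int j * cnj w))"
    using infsum_reindex_bij_betw[OF bij_int_uminus, of "\<lambda>j. cnj (a j) * exp (- (\<i> * of_int j * cnj w))"]
    by simp
  finally show ?thesis unfolding lser_def .
qed

lemma lser_shift: "lser a (w + v) = lser (\<lambda>j. a j * exp (\<i> * of_int j * v)) w"
  unfolding lser_def by (simp add: exp_add distrib_left mult_ac)

lemma exp_i_of_int_pi: "exp (\<i> * of_int j * of_real pi) = (if even j then 1 else - 1)"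
proof -
  have "exp (\<i> * of_int j * of_real pi) = exp (\<i> * of_real pi) powi j"
    unfolding exp_power_int by (simp add: mult_ac)
  also have "\<dots> = (- 1) powi j" by simp
  finally show ?thesis by (simp add: power_int_minus_left)
qed

lemma has_sum_int_pairs:
  fixes f :: "int \<Rightarrow> 'a :: {real_normed_field, banach}"
  assumes f: "(f has_sum s) UNIV" and even: "\<And>j. f (- j) = f j"
  shows "((\<lambda>n. 2 * f (int n)) has_sum (s - f 0)) {1..}"
proof -
  have "f summable_on {1..}" by (rule summable_on_subset_banach[OF has_sum_imp_summable[OF f]]) auto
  then obtain p where p: "(f has_sum p) {1..}" by (auto simp: summable_on_def)
  have "bij_betw uminus {1..} {..-1 :: int}" by (rule bij_betwI[where g = uminus]) auto
  from has_sum_reindex_bij_betw[OF this, of f p] have n: "(f has_sum p) {..-1}"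
    using p by (simp add: even)
  have "(f has_sum f 0) {0}" by (rule has_sum_finiteI) auto
  from has_sum_Un_disjoint[OF this p] have 1: "(f has_sum (f 0 + p)) ({0} \<union> {1..})" by simp
  have "(f has_sum (f 0 + p + p)) (({0} \<union> {1..}) \<union> {..-1})"
    by (rule has_sum_Un_disjoint[OF 1 n]) auto
  moreover have "({0} \<union> {1..}) \<union> {..-1} = (UNIV :: int set)" by auto
  ultimately have s: "s = f 0 + p + p" using has_sum_unique[OF f] by simp
  have "bij_betw int {1..} {1..}" by (rule bij_betwI[where g = nat]) auto
  from has_sum_reindex_bij_betw[OF this, of f p] have "((\<lambda>n. f (int n)) has_sum p) {1..}"
    using p by simp
  from has_sum_cmult_right[OF this, of 2] show ?thesis by (simp add: s)
qed

text \<open>Pairing j with -j brings a bilateral sum into the one-sided form used in the theorem, at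
  the price of a factor 2.\<close>

lemma has_sum_int_odd_pairs:
  fixes f :: "int \<Rightarrow> 'a :: {real_normed_field, banach}"
  assumes f: "(f has_sum s) UNIV" and sym: "\<And>j. f (- j) = f j" and odd: "\<And>j. even j \<Longrightarrow> f j = 0"
  shows "((\<lambda>r. 2 * f (2 * int r - 1)) has_sum s) {1..}"
proof -
  let ?g = "\<lambda>r :: nat. 2 * r - 1"
  have "((\<lambda>n. 2 * f (int n)) has_sum s) {1..}" using has_sum_int_pairs[OF f sym] odd[of 0] by simp
  moreover have "2 * f (int n) = 0" if n: "n \<in> {1..} - ?g ` {1..}" for n
  proof -
    have "even n"
    proof (rule ccontr)
      assume "odd n"
      then obtain k where "n = 2 * k + 1" by (rule oddE)
      then have "n = ?g (Suc k)" "Suc k \<in> {1..}" by simp_all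
      then have "n \<in> ?g ` {1..}" by (rule image_eqI)
      with n show False by simp
    qed
    then show ?thesis using odd by simp
  qed
  ultimately have "((\<lambda>n. 2 * f (int n)) has_sum s) (?g ` {1..})"
    using has_sum_cong_neutral[of "?g ` {1..}" "{1..}" "\<lambda>n. 2 * f (int n)" "\<lambda>n. 2 * f (int n)" s] by fastforce
  moreover have "inj_on ?g {1..}" by (rule inj_onI) auto
  ultimately have "((\<lambda>r. 2 * f (int (?g r))) has_sum s) {1..}"
    using has_sum_reindex[of ?g "{1..}" "\<lambda>n. 2 * f (int n)" s] by (simp add: o_def)
  \<comment> \<open>For r \<ge> 1 the truncated subtraction in \<open>?g\<close> agrees with the
    integer one; at r = 0 it would not.\<close>
  moreover have "2 * f (int (?g r)) = 2 * f (2 * int r - 1)" if "r \<in> {1..}" for r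
    using that by (simp add: of_nat_diff)
  ultimately show ?thesis using has_sum_cong[of "{1..}" "\<lambda>r. 2 * f (int (?g r))" "\<lambda>r. 2 * f (2 * int r - 1)" s] by blast
qed

lemma has_sum_int_even_pairs:
  fixes f :: "int \<Rightarrow> 'a :: {real_normed_field, banach}"
  assumes f: "(f has_sum s) UNIV" and sym: "\<And>j. f (- j) = f j" and even: "\<And>j. odd j \<Longrightarrow> f j = 0"
  shows "((\<lambda>r. 2 * f (2 * int r)) has_sum (s - f 0)) {1..}"
proof -
  let ?g = "\<lambda>r :: nat. 2 * r"
  have "((\<lambda>n. 2 * f (int n)) has_sum (s - f 0)) {1..}" using has_sum_int_pairs[OF f sym] .
  moreover have "2 * f (int n) = 0" if n: "n \<in> {1..} - ?g ` {1..}" for n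
  proof -
    have "odd n"
    proof (rule ccontr)
      assume "\<not> odd n"
      then obtain k where "n = 2 * k" by (auto elim: evenE)
      with n show False by auto
    qed
    then show ?thesis using even by simp
  qed
  ultimately have "((\<lambda>n. 2 * f (int n)) has_sum (s - f 0)) (?g ` {1..})"
    using has_sum_cong_neutral[of "?g ` {1..}" "{1..}" "\<lambda>n. 2 * f (int n)" "\<lambda>n. 2 * f (int n)" "s - f 0"] by fastforce
  moreover have "inj_on ?g {1..}" by (rule inj_onI) auto
  ultimately show ?thesis
    using has_sum_reindex[of ?g "{1..}" "\<lambda>n. 2 * f (int n)" "s - f 0"] by (simp add: o_def)
qed

text \<open>Summation by parts rewrites the sum with terms (a n - a (n+1)) u (n+1), which are
  nonnegative with a positive first one. The boundary term vanishes because
  \<open>u 0 = 0\<close>.\<close>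

lemma abel_sum_pos:
  fixes a u :: "nat \<Rightarrow> real"
  assumes a: "summable a" "\<And>n. a (Suc n) \<le> a n" "a 1 < a 0" "\<And>n. 0 \<le> a n"
    and u: "u 0 = 0" "\<And>n. 0 \<le> u n" "0 < u 1" "\<And>n. u n \<le> B"
  shows "0 < (\<Sum>n. a n * (u (Suc n) - u n))"
proof -
  have B: "0 \<le> B" using u by (meson order_trans)
  have S: "summable (\<lambda>n. a n * u (f n))" for f
    by (rule summable_comparison_test'[OF summable_mult2[OF a(1), of B], of 0])
      (use a u B in \<open>auto simp: abs_mult intro!: mult_left_mono\<close>)
  have S2: "summable (\<lambda>n. a (Suc n) * u (Suc n))"
    using S[of id] by (subst summable_Suc_iff[where f = "\<lambda>n. a n * u n"]) simp
  have "(\<Sum>n. a n * (u (Suc n) - u n)) = (\<Sum>n. a n * u (Suc n)) - (\<Sum>n. a n * u n)"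
    using S[of Suc] S[of id] by (simp add: right_diff_distrib suminf_diff)
  also have "(\<Sum>n. a n * u n) = (\<Sum>n. a (Suc n) * u (Suc n))"
    using suminf_split_head[of "\<lambda>n. a n * u n"] S[of id] u(1) by simp
  also have "(\<Sum>n. a n * u (Suc n)) - (\<Sum>n. a (Suc n) * u (Suc n)) = (\<Sum>n. (a n - a (Suc n)) * u (Suc n))"
    using suminf_diff[OF S[of Suc] S2] by (simp add: left_diff_distrib)
  also have "\<dots> > 0"
  proof (rule suminf_pos2[where i = 0])
    show "summable (\<lambda>n. (a n - a (Suc n)) * u (Suc n))"
      using summable_diff[OF S[of Suc] S2] by (simp add: left_diff_distrib)
  qed (use a u in auto)
  finally show ?thesis .
qed

text \<open>With c = 1 and c = i this restricts the complex differential system to the two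
  coordinate axes.\<close>

lemma has_field_derivative_Re_line:
  assumes "(f has_field_derivative d) (at (c * of_real x))"
  shows "((\<lambda>x. Re (f (c * of_real x))) has_real_derivative Re (c * d)) (at x)"
    and "((\<lambda>x. Im (f (c * of_real x))) has_real_derivative Im (c * d)) (at x)"
proof -
  have "((\<lambda>x :: real. c * of_real x) has_vector_derivative c * 1) (at x)"
    by (auto intro!: derivative_eq_intros)
  from field_vector_diff_chain_at[OF this, of f d] assms
  have 1: "((\<lambda>x. f (c * of_real x)) has_vector_derivative c * d) (at x)"
    by (simp add: o_def)
  from bounded_linear.has_vector_derivative[OF bounded_linear_Re 1]
    bounded_linear.has_vector_derivative[OF bounded_linear_Im 1]
  show "((\<lambda>x. Re (f (c * of_real x))) has_real_derivative Re (c * d)) (at x)"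
    "((\<lambda>x. Im (f (c * of_real x))) has_real_derivative Im (c * d)) (at x)"
    unfolding has_real_derivative_iff_has_vector_derivative .
qed

section \<open>Signs and growth on the real and imaginary axes\<close>

context half_period
begin

lemma coeff_neg [simp]: "cC (- j) = cC j" "cD (- j) = cD j" "cS (- j) = - cS j"
  and coeff_cnj [simp]: "cnj (cC j) = cC j" "cnj (cD j) = cD j" "cnj (cS j) = - cS j"
  by (auto simp: cC_def cD_def cS_def)

lemma CDS_neg: "C (- w) = C w" "D (- w) = D w" "S (- w) = - S w"
  by (simp_all add: lser_neg lser_uminus)

lemma CDS_cnj: "cnj (C w) = C (cnj w)" "cnj (D w) = D (cnj w)" "cnj (S w) = S (cnj w)"
  by (simp_all add: cnj_lser lser_uminus)

lemma CDS_shift: "C (w + of_real pi) = - C w" "D (w + of_real pi) = D w" "S (w + of_real pi) = - S w"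
proof -
  have "(\<lambda>j. cC j * exp (\<i> * of_int j * of_real pi)) = (\<lambda>j. - cC j)"
    "(\<lambda>j. cD j * exp (\<i> * of_int j * of_real pi)) = cD"
    "(\<lambda>j. cS j * exp (\<i> * of_int j * of_real pi)) = (\<lambda>j. - cS j)"
    unfolding exp_i_of_int_pi by (auto simp: cC_def cD_def cS_def)
  then show "C (w + of_real pi) = - C w" "D (w + of_real pi) = D w" "S (w + of_real pi) = - S w"
    unfolding lser_shift by (simp_all add: lser_uminus)
qed

lemma C_half_pi: "C (of_real (pi / 2)) = 0"
proof -
  have "C (of_real (pi / 2)) = C (- of_real (pi / 2) + of_real pi)"
    by (simp only: of_real_add[symmetric] of_real_minus[symmetric]) simp
  also have "\<dots> = - C (of_real (pi / 2))" unfolding CDS_shift CDS_neg ..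
  finally show ?thesis by simp
qed

definition rS :: "real \<Rightarrow> real" where "rS x = Re (S (of_real x))"
definition rC :: "real \<Rightarrow> real" where "rC x = Re (C (of_real x))"
definition rD :: "real \<Rightarrow> real" where "rD x = Re (D (of_real x))"

lemma real_line: "S (of_real x) = of_real (rS x)" "C (of_real x) = of_real (rC x)" "D (of_real x) = of_real (rD x)"
  using CDS_cnj[of "of_real x"] by (auto simp: rS_def rC_def rD_def complex_eq_iff)

lemma real_deriv:
  "(rS has_real_derivative rC x * rD x) (at x)"
  "(rC has_real_derivative - rS x * rD x) (at x)"
  "(rD has_real_derivative - rS x * rC x) (at x)"
proof -
  have w: "- h < Im (1 * of_real x)" "Im (1 * of_real x) < h" using h_pos by auto
  have fn: "rS = (\<lambda>x. Re (S (1 * of_real x)))" "rC = (\<lambda>x. Re (C (1 * of_real x)))" "rD = (\<lambda>x. Re (D (1 * of_real x)))"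
    by (auto simp: rS_def rC_def rD_def)
  have "(rS has_real_derivative Re (1 * (C (1 * of_real x) * D (1 * of_real x)))) (at x)"
    "(rC has_real_derivative Re (1 * (- S (1 * of_real x) * D (1 * of_real x)))) (at x)"
    "(rD has_real_derivative Re (1 * (- S (1 * of_real x) * C (1 * of_real x)))) (at x)"
    unfolding fn by (rule has_field_derivative_Re_line(1)[OF strip_deriv(1)[OF w]]
      has_field_derivative_Re_line(1)[OF strip_deriv(2)[OF w]]
      has_field_derivative_Re_line(1)[OF strip_deriv(3)[OF w]])+
  then show "(rS has_real_derivative rC x * rD x) (at x)"
    "(rC has_real_derivative - rS x * rD x) (at x)"
    "(rD has_real_derivative - rS x * rC x) (at x)"
    by (simp_all add: real_line)
qed

definition iS :: "real \<Rightarrow> real" where "iS y = Im (S (\<i> * of_real y))"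
definition iC :: "real \<Rightarrow> real" where "iC y = Re (C (\<i> * of_real y))"
definition iD :: "real \<Rightarrow> real" where "iD y = Re (D (\<i> * of_real y))"

lemma imag_line: "S (\<i> * of_real y) = \<i> * of_real (iS y)" "C (\<i> * of_real y) = of_real (iC y)" "D (\<i> * of_real y) = of_real (iD y)"
  using CDS_cnj[of "\<i> * of_real y"] CDS_neg[of "\<i> * of_real y"]
  by (auto simp: iS_def iC_def iD_def complex_eq_iff)

lemma imag_deriv:
  assumes "- h < y" "y < h"
  shows "(iS has_real_derivative iC y * iD y) (at y)"
  "(iC has_real_derivative iS y * iD y) (at y)"
  "(iD has_real_derivative iS y * iC y) (at y)"
proof -
  have w: "- h < Im (\<i> * of_real y)" "Im (\<i> * of_real y) < h" using assms by auto
  have fn: "iS = (\<lambda>y. Im (S (\<i> * of_real y)))" "iC = (\<lambda>y. Re (C (\<i> * of_real y)))" "iD = (\<lambda>y. Re (D (\<i> * of_real y)))"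
    by (auto simp: iS_def iC_def iD_def)
  have "(iS has_real_derivative Im (\<i> * (C (\<i> * of_real y) * D (\<i> * of_real y)))) (at y)"
    "(iC has_real_derivative Re (\<i> * (- S (\<i> * of_real y) * D (\<i> * of_real y)))) (at y)"
    "(iD has_real_derivative Re (\<i> * (- S (\<i> * of_real y) * C (\<i> * of_real y)))) (at y)"
    unfolding fn by (rule has_field_derivative_Re_line(2)[OF strip_deriv(1)[OF w]]
      has_field_derivative_Re_line(1)[OF strip_deriv(2)[OF w]]
      has_field_derivative_Re_line(1)[OF strip_deriv(3)[OF w]])+
  then show "(iS has_real_derivative iC y * iD y) (at y)"
    "(iC has_real_derivative iS y * iD y) (at y)"
    "(iD has_real_derivative iS y * iC y) (at y)"
    by (simp_all add: imag_line)
qed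

lemma imag_has_sum:
  assumes "- h < y" "y < h"
  shows "((\<lambda>j. if odd j then exp (- (of_int j * y)) / cosh (of_int j * h) else 0) has_sum iC y) UNIV"
    and "((\<lambda>j. if even j then exp (- (of_int j * y)) / cosh (of_int j * h) else 0) has_sum iD y) UNIV"
proof -
  have w: "- h < Im (\<i> * of_real y)" "Im (\<i> * of_real y) < h" using assms by auto
  have e: "exp (\<i> * of_int j * (\<i> * of_real y)) = of_real (exp (- (of_int j * y)))" for j
  proof -
    have "\<i> * of_int j * (\<i> * of_real y) = of_real (- (of_int j * y))" by (simp add: complex_eq_iff)
    then show ?thesis by (simp only: exp_of_real)
  qed
  have *: "(\<lambda>j. Re (cC j * of_real (exp (- (of_int j * y))))) = (\<lambda>j. if odd j then exp (- (of_int j * y)) / cosh (of_int j * h) else 0)"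
    "(\<lambda>j. Re (cD j * of_real (exp (- (of_int j * y))))) = (\<lambda>j. if even j then exp (- (of_int j * y)) / cosh (of_int j * h) else 0)"
    by (auto simp: cC_def cD_def)
  show "((\<lambda>j. if odd j then exp (- (of_int j * y)) / cosh (of_int j * h) else 0) has_sum iC y) UNIV"
    "((\<lambda>j. if even j then exp (- (of_int j * y)) / cosh (of_int j * h) else 0) has_sum iD y) UNIV"
    using has_sum_Re[OF lconv_has_sum[OF lconv_main(1) w]] has_sum_Re[OF lconv_has_sum[OF lconv_main(2) w]]
    unfolding e iC_def iD_def * by auto
qed

text \<open>All terms are positive, and cosh x \<le> exp x for x \<ge> 0. Each of the
  \<open>n\<close> retained lower bounds tends to 1 as y \<rightarrow> h, which forces
  \<open>iC\<close> to blow up at \<open>h\<close>.\<close>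

lemma imag_ge:
  assumes y: "- h < y" "y < h"
  shows "(\<Sum>i<n. exp (- (real (2 * i + 1) * (h - y)))) \<le> iC y"
    and "0 < iC y" "0 < iD y"
proof -
  let ?f = "\<lambda>j. if odd j then exp (- (of_int j * y)) / cosh (of_int j * h) else 0"
  have ge: "(\<Sum>i<n. exp (- (real (2 * i + 1) * (h - y)))) \<le> iC y" for n
  proof -
    \<comment> \<open>Negative indices: there exp (-jy) grows with y and offsets the decay of the
      coefficient.\<close>
    let ?g = "\<lambda>i :: nat. - (2 * int i + 1)"
    have "exp (- (real (2 * i + 1) * (h - y))) \<le> ?f (?g i)" for i
    proof -
      let ?x = "real (2 * i + 1) * h"
      have "cosh ?x \<le> exp ?x"
      proof -
        have "0 \<le> ?x" using h_pos by simp
        then have "exp (- ?x) \<le> exp ?x" by simp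
        then show ?thesis unfolding cosh_def by simp
      qed
      then have "exp (real (2 * i + 1) * y) / exp ?x \<le> exp (real (2 * i + 1) * y) / cosh ?x"
        by (intro divide_left_mono) (auto simp: cosh_real_pos)
      moreover have "?f (?g i) = exp (real (2 * i + 1) * y) / cosh ?x"
      proof -
        have "of_int (?g i) * h = - ?x" "- (of_int (?g i) * y) = real (2 * i + 1) * y" "odd (?g i)" by (simp_all add: algebra_simps)
        then show ?thesis by (simp only: cosh_minus if_True not_False_eq_True)
      qed
      moreover have "exp (- (real (2 * i + 1) * (h - y))) = exp (real (2 * i + 1) * y) / exp ?x"
        by (simp add: exp_diff[symmetric] algebra_simps)
      ultimately show ?thesis by (simp only:)
    qed
    then have "(\<Sum>i<n. exp (- (real (2 * i + 1) * (h - y)))) \<le> (\<Sum>i<n. ?f (?g i))" by (intro sum_mono)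
    also have "\<dots> = sum ?f (?g ` {..<n})" by (subst sum.reindex) (auto simp: inj_on_def)
    also have "\<dots> \<le> iC y" by (rule finite_sum_le_has_sum[OF imag_has_sum(1)[OF y]]) auto
    finally show ?thesis .
  qed
  show "(\<Sum>i<n. exp (- (real (2 * i + 1) * (h - y)))) \<le> iC y" by (rule ge)
  show "0 < iC y" using ge[of 1] by simp (smt (verit) exp_gt_zero)
  have "sum (\<lambda>j. if even j then exp (- (of_int j * y)) / cosh (of_int j * h) else 0) {0} \<le> iD y"
    by (rule finite_sum_le_has_sum[OF imag_has_sum(2)[OF y]]) auto
  then show "0 < iD y" by simp
qed

lemma rC_0_pos: "rC 0 > 0" and rD_0_pos: "rD 0 > 0"
  using imag_ge(2,3)[of 0] h_pos by (auto simp: rC_def rD_def iC_def iD_def)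

lemma al_real: "al = of_real ((rC 0)\<^sup>2)" and be_real: "be = of_real ((rD 0)\<^sup>2)"
  using real_line[of 0] by (simp_all add: al_def be_def)

lemma rS_0: "rS 0 = 0" by (simp add: rS_def S_0)

lemma real_squares: "(rC x)\<^sup>2 = (rC 0)\<^sup>2 - (rS x)\<^sup>2" "(rD x)\<^sup>2 = (rD 0)\<^sup>2 - (rS x)\<^sup>2"
proof -
  have "- h < Im (of_real x)" "Im (of_real x) < h" using h_pos by auto
  from strip_squares[OF this] have "of_real ((rC x)\<^sup>2) = complex_of_real ((rC 0)\<^sup>2 - (rS x)\<^sup>2)"
    "of_real ((rD x)\<^sup>2) = complex_of_real ((rD 0)\<^sup>2 - (rS x)\<^sup>2)"
    by (auto simp: real_line al_real be_real)
  then show "(rC x)\<^sup>2 = (rC 0)\<^sup>2 - (rS x)\<^sup>2" "(rD x)\<^sup>2 = (rD 0)\<^sup>2 - (rS x)\<^sup>2"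
    by (auto simp only: of_real_eq_iff)
qed

lemma imag_squares:
  assumes "- h < y" "y < h"
  shows "(iC y)\<^sup>2 = (rC 0)\<^sup>2 + (iS y)\<^sup>2" "(iD y)\<^sup>2 = (rD 0)\<^sup>2 + (iS y)\<^sup>2"
proof -
  have "- h < Im (\<i> * of_real y)" "Im (\<i> * of_real y) < h" using assms by auto
  from strip_squares[OF this] have "of_real ((iC y)\<^sup>2) = complex_of_real ((rC 0)\<^sup>2 + (iS y)\<^sup>2)"
    "of_real ((iD y)\<^sup>2) = complex_of_real ((rD 0)\<^sup>2 + (iS y)\<^sup>2)"
    by (auto simp: imag_line al_real be_real power_mult_distrib)
  then show "(iC y)\<^sup>2 = (rC 0)\<^sup>2 + (iS y)\<^sup>2" "(iD y)\<^sup>2 = (rD 0)\<^sup>2 + (iS y)\<^sup>2"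
    by (auto simp only: of_real_eq_iff)
qed

text \<open>Coefficients of a primitive of \<open>S\<close>. At j = 0 the division gives 0, which is
  consistent because \<open>S\<close> has no constant term.\<close>

definition cG :: "int \<Rightarrow> complex" where "cG j = cS j / (\<i> * of_int j)"

lemma lconv_cG: "lconv (- h) h cG"
proof (rule lconv_exp_decay[OF _ order_trans[OF _ norm_coeff_le(3)]])
  fix j
  show "norm (cG j) \<le> norm (cS j)"
  proof (cases "j = 0")
    case False
    then have "1 \<le> \<bar>of_int j :: real\<bar>" by linarith
    then have "norm (cS j) * 1 \<le> norm (cS j) * \<bar>of_int j\<bar>" by (intro mult_left_mono) auto
    then show ?thesis by (simp add: cG_def norm_divide norm_mult divide_le_eq)
  qed (simp add: cG_def)
qed (use h_pos in simp)

lemma lder_cG: "lder 1 cG = cS"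
  by (auto simp: lder_def cG_def cS_def)

text \<open>\<open>(C + D)' = -S (C + D)\<close>, so \<open>C + D\<close> is a constant times the exponential of \<open>-G\<close> with
  \<open>G' = S\<close> and has no zeros. Its translate by \<open>\<pi>\<close> is \<open>D - C\<close>.\<close>

lemma real_sum_pos: "rC x + rD x > 0"
proof -
  define G where "G = lser cG"
  have dG: "(G has_field_derivative S w) (at w)" if "- h < Im w" "Im w < h" for w
    using has_field_derivative_lser_lder[OF lconv_cG that, of 0] unfolding G_def One_nat_def[symmetric] lder_cG by simp
  have w: "- h < Im (of_real x)" "Im (of_real x) < h" using h_pos by auto
  have "(C (of_real x) + D (of_real x)) * exp (G (of_real x)) = (C 0 + D 0) * exp (G 0)"
    by (rule strip_const[OF _ w]) (auto intro!: derivative_eq_intros strip_deriv dG simp: algebra_simps)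
  have "cnj (G (of_real x)) = G (of_real x)" for x
  proof -
    have "cnj (cG (- j)) = cG j" for j by (simp add: cG_def)
    then show ?thesis unfolding G_def cnj_lser by simp
  qed
  then have "G (of_real x) \<in> \<real>" for x by (simp add: complex_is_Real_iff complex_eq_iff)
  then have G: "G (of_real x) = of_real (Re (G (of_real x)))" for x by (simp add: complex_is_Real_iff complex_eq_iff)
  have eG: "exp (G (of_real x)) = of_real (exp (Re (G (of_real x))))" for x
    by (subst G) (rule exp_of_real)
  from \<open>_ = (C 0 + D 0) * exp (G 0)\<close> have "of_real ((rC x + rD x) * exp (Re (G (of_real x)))) = complex_of_real ((rC 0 + rD 0) * exp (Re (G (of_real 0))))"
    using real_line[of x] real_line[of 0] eG[of x] eG[of 0] by simp
  then have "(rC x + rD x) * exp (Re (G (of_real x))) = (rC 0 + rD 0) * exp (Re (G (of_real 0)))"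
    by (simp only: of_real_eq_iff)
  also have "\<dots> > 0" using rC_0_pos rD_0_pos by simp
  finally show ?thesis by (simp add: zero_less_mult_iff)
qed

lemma real_shift: "rC (x + pi) = - rC x" "rD (x + pi) = rD x"
  using CDS_shift[of "of_real x"] by (auto simp: rC_def rD_def)

lemma rD_gt: "rD x > \<bar>rC x\<bar>"
  using real_sum_pos[of x] real_sum_pos[of "x + pi"] unfolding real_shift by linarith

text \<open>Multiplication by \<open>2 sin x\<close> makes the sine series a series of differences
  \<open>cos (2nx) - cos (2(n+1)x)\<close> with decreasing weights; Abel summation then gives positivity.\<close>

lemma rS_pos:
  assumes "0 < x" "x < pi"
  shows "rS x > 0"
proof -
  define a where "a n = 2 / sinh (real (2 * n + 1) * h)" for n :: nat
  have w: "- h < Im (of_real x)" "Im (of_real x) < h" using h_pos by auto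
  let ?f = "\<lambda>j. if odd j then sin (of_int j * x) / sinh (of_int j * h) else 0"
  have Re: "(\<lambda>j. Re (cS j * exp (\<i> * of_int j * of_real x))) = ?f"
  proof
    fix j
    have "exp (\<i> * of_int j * of_real x) = cis (of_int j * x)" by (simp add: cis_conv_exp mult_ac)
    then show "Re (cS j * exp (\<i> * of_int j * of_real x)) = ?f j"
      by (auto simp: cS_def)
  qed
  have "(?f has_sum rS x) UNIV"
    using has_sum_Re[OF lconv_has_sum[OF lconv_main(3) w]] unfolding Re rS_def .
  then have "((\<lambda>r. 2 * ?f (2 * int r - 1)) has_sum rS x) {1..}"
    by (rule has_sum_int_odd_pairs) auto
  moreover have "bij_betw Suc UNIV {1..}" by (rule bij_betwI[where g = "\<lambda>n. n - 1"]) auto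
  ultimately have "((\<lambda>n. 2 * ?f (2 * int (Suc n) - 1)) has_sum rS x) UNIV"
    using has_sum_reindex_bij_betw[of Suc UNIV "{1..}" "\<lambda>r. 2 * ?f (2 * int r - 1)" "rS x"] by blast
  moreover have "2 * ?f (2 * int (Suc n) - 1) = a n * sin (real (2 * n + 1) * x)" for n
    by (simp add: a_def algebra_simps)
  ultimately have sums: "(\<lambda>n. a n * sin (real (2 * n + 1) * x)) sums rS x"
    by (simp add: has_sum_imp_sums)
  \<comment> \<open>The constant 1 leaves the differences unchanged and gives u 0 = 0, 0 \<le> u n
    \<le> 2 and u 1 = 2 (sin x)^2.\<close>
  define u where "u n = 1 - cos (real (2 * n) * x)" for n :: nat
  have *: "a n * sin (real (2 * n + 1) * x) * (2 * sin x) = a n * (u (Suc n) - u n)" for n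
  proof -
    have "cos (real (2 * n + 1) * x + x) = cos (real (2 * n + 1) * x) * cos x - sin (real (2 * n + 1) * x) * sin x"
      "cos (real (2 * n + 1) * x - x) = cos (real (2 * n + 1) * x) * cos x + sin (real (2 * n + 1) * x) * sin x"
      by (rule cos_add, rule cos_diff)
    moreover have "real (2 * n + 1) * x + x = real (2 * Suc n) * x" "real (2 * n + 1) * x - x = real (2 * n) * x"
      by (simp_all add: algebra_simps)
    ultimately have "u (Suc n) - u n = sin (real (2 * n + 1) * x) * (2 * sin x)" unfolding u_def by simp
    then show ?thesis by simp
  qed
  have "(\<lambda>n. a n * (u (Suc n) - u n)) sums (rS x * (2 * sin x))"
    using sums_mult2[OF sums, of "2 * sin x"] unfolding * .
  then have "rS x * (2 * sin x) = (\<Sum>n. a n * (u (Suc n) - u n))" by (rule sums_unique)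
  also have "\<dots> > 0"
  proof (rule abel_sum_pos)
    have mono: "sinh (real (2 * m + 1) * h) < sinh (real (2 * n + 1) * h)" if "m < n" for m n :: nat
    proof -
      have "real (2 * m + 1) * h < real (2 * n + 1) * h" using that h_pos by (intro mult_strict_right_mono) auto
      then show ?thesis by simp
    qed
    have pos: "0 < sinh (real (2 * n + 1) * h)" for n :: nat using h_pos by simp
    show "0 \<le> a n" for n unfolding a_def using pos[of n] by simp
    show "a (Suc n) \<le> a n" for n unfolding a_def
      using mono[of n "Suc n"] pos[of n] by (intro divide_left_mono mult_pos_pos) auto
    show "a 1 < a 0" unfolding a_def
      using mono[of 0 1] pos[of 0] by (intro divide_strict_left_mono mult_pos_pos) auto
    \<comment> \<open>These are twice the moduli of the coefficients of \<open>S\<close> at positive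
      odd indices, summable because 0 lies in the strip.\<close>
    show "summable a"
    proof -
      have "(\<lambda>j. norm (cS j)) summable_on UNIV"
        using lconv_abs_summable[OF lconv_main(3), of 0] h_pos by simp
      then have "((\<lambda>j. norm (cS j)) has_sum (\<Sum>\<^sub>\<infinity>j. norm (cS j))) UNIV" by (rule has_sum_infsum)
      from has_sum_int_odd_pairs[OF this]
      have "((\<lambda>r. 2 * norm (cS (2 * int r - 1))) has_sum (\<Sum>\<^sub>\<infinity>j. norm (cS j))) {1..}"
        by (auto simp: cS_def)
      then have "((\<lambda>n. 2 * norm (cS (2 * int (Suc n) - 1))) has_sum (\<Sum>\<^sub>\<infinity>j. norm (cS j))) UNIV"
        using has_sum_reindex_bij_betw[OF \<open>bij_betw Suc UNIV {1..}\<close>, of "\<lambda>r. 2 * norm (cS (2 * int r - 1))" "\<Sum>\<^sub>\<infinity>j. norm (cS j)"] by blast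
      moreover have "2 * norm (cS (2 * int (Suc n) - 1)) = a n" for n
      proof -
        have "cS (2 * int (Suc n) - 1) = - \<i> * of_real (1 / sinh (real (2 * n + 1) * h))"
          by (simp add: cS_def algebra_simps)
        then have "norm (cS (2 * int (Suc n) - 1)) = \<bar>1 / sinh (real (2 * n + 1) * h)\<bar>"
          by (simp add: norm_mult norm_divide del: of_real_divide)
        then show ?thesis unfolding a_def using pos[of n] by simp
      qed
      ultimately have "(a has_sum (\<Sum>\<^sub>\<infinity>j. norm (cS j))) UNIV" by simp
      from has_sum_imp_sums[OF this] show ?thesis by (rule sums_summable)
    qed
    show "u 0 = 0" "0 \<le> u n" "u n \<le> 2" for n
      using cos_le_one[of "real (2 * n) * x"] cos_ge_minus_one[of "real (2 * n) * x"] by (auto simp: u_def)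
    have "sin x \<noteq> 0" using sin_gt_zero[of x] assms by auto
    then show "0 < u 1" using cos_double_sin[of x] by (simp add: u_def)
  qed
  finally show ?thesis using sin_gt_zero[of x] assms by (simp add: zero_less_mult_iff)
qed

text \<open>C' = -S D is negative inside the interval, so C decreases to its zero at pi/2.\<close>

lemma rC_pos:
  assumes "0 \<le> x" "x < pi / 2"
  shows "rC x > 0"
proof -
  have "rC (pi / 2) < rC x"
  proof (rule DERIV_neg_imp_decreasing_open[OF assms(2)])
    fix u assume u: "x < u" "u < pi / 2"
    have "rD u > 0" using rD_gt[of u] by simp
    then have "- rS u * rD u < 0" using rS_pos[of u] u assms by simp
    then show "\<exists>y. (rC has_real_derivative y) (at u) \<and> y < 0" using real_deriv(2) by blast
  qed (use real_deriv in \<open>auto intro!: continuous_at_imp_continuous_on DERIV_isCont\<close>)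
  then show ?thesis using C_half_pi by (simp add: rC_def)
qed

text \<open>C = kz cn and D = z dn, and both cn and dn equal 1 at 0.\<close>

definition modulus :: real where "modulus = rC 0 / rD 0"

lemma modulus: "0 < modulus" "modulus < 1" "rC 0 = modulus * rD 0"
  using rC_0_pos rD_0_pos rD_gt[of 0] by (auto simp: modulus_def field_simps)

text \<open>For s = \<open>rS x / rC 0\<close> the conserved quantities make 1 - s^2 and 1 - k^2 s^2
  the squares of \<open>rC x / rC 0\<close> and \<open>rD x / rD 0\<close>. Positivity of
  \<open>rC\<close> and \<open>rD\<close> selects the right square root in the equation for
  s'.\<close>

lemma elliptic_K_modulus: "elliptic_K modulus = rD 0 * (pi / 2)"
proof (rule elliptic_K_parametrized[where t = "\<lambda>x. rS x / rC 0"])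
  let ?k = modulus and ?z = "rD 0"
  show "0 < pi / 2" "0 < ?z" using rD_0_pos by auto
  have "isCont rS x" for x using real_deriv(1) by (rule DERIV_isCont)
  then show "continuous_on {0..pi/2} (\<lambda>x. rS x / rC 0)"
    using rC_0_pos by (intro continuous_intros continuous_at_imp_continuous_on) auto
  show "rS 0 / rC 0 = 0" by (simp add: rS_0)
  have "(rS (pi / 2))\<^sup>2 = (rC 0)\<^sup>2" using real_squares(1)[of "pi / 2"] C_half_pi by (simp add: rC_def)
  then have "rS (pi / 2) = rC 0" using rS_pos[of "pi / 2"] rC_0_pos by (simp add: power2_eq_iff_nonneg)
  then show "rS (pi / 2) / rC 0 = 1" using rC_0_pos by simp
  fix x assume x: "0 < x" "x < pi / 2"
  have 1: "1 - (rS x / rC 0)\<^sup>2 = (rC x / rC 0)\<^sup>2"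
    using real_squares(1)[of x] rC_0_pos by (simp add: field_simps)
  have 2: "1 - ?k\<^sup>2 * (rS x / rC 0)\<^sup>2 = (rD x / ?z)\<^sup>2"
    using real_squares(2)[of x] rC_0_pos rD_0_pos by (simp add: modulus_def field_simps)
  have pos: "rC x > 0" "rD x > 0" using rC_pos[of x] rD_gt[of x] x by auto
  show "0 < (1 - (rS x / rC 0)\<^sup>2) * (1 - ?k\<^sup>2 * (rS x / rC 0)\<^sup>2)"
    unfolding 1 2 using pos rC_0_pos rD_0_pos by simp
  have "sqrt ((1 - (rS x / rC 0)\<^sup>2) * (1 - ?k\<^sup>2 * (rS x / rC 0)\<^sup>2)) = (rC x / rC 0) * (rD x / ?z)"
    unfolding 1 2 using pos rC_0_pos rD_0_pos by (simp add: real_sqrt_mult)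
  then have "?z * sqrt ((1 - (rS x / rC 0)\<^sup>2) * (1 - ?k\<^sup>2 * (rS x / rC 0)\<^sup>2)) = rC x * rD x / rC 0"
    using rD_0_pos by simp
  then show "((\<lambda>x. rS x / rC 0) has_real_derivative ?z * sqrt ((1 - (rS x / rC 0)\<^sup>2) * (1 - ?k\<^sup>2 * (rS x / rC 0)\<^sup>2))) (at x)"
    using DERIV_cdivide[OF real_deriv(1)[of x], of "rC 0"] by (simp only:)
qed

text \<open>A lower bound with \<open>n\<close> terms tends to \<open>n\<close>, and
  \<open>n\<close> is arbitrary.\<close>

lemma iC_at_top: "filterlim iC at_top (at_left h)"
  unfolding filterlim_at_top
proof
  fix Z :: real
  obtain n :: nat where n: "Z < real n" using reals_Archimedean2 by blast
  have "((\<lambda>y. \<Sum>i<n. exp (- (real (2 * i + 1) * (h - y)))) \<longlongrightarrow> (\<Sum>i<n. exp (- (real (2 * i + 1) * (h - h))))) (at_left h)"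
    by (intro tendsto_intros)
  then have "((\<lambda>y. \<Sum>i<n. exp (- (real (2 * i + 1) * (h - y)))) \<longlongrightarrow> real n) (at_left h)" by simp
  from order_tendstoD(1)[OF this n]
  have "\<forall>\<^sub>F y in at_left h. Z < (\<Sum>i<n. exp (- (real (2 * i + 1) * (h - y))))" .
  moreover have "\<forall>\<^sub>F y in at_left h. y \<in> {0<..<h}" using h_pos by (intro eventually_at_leftI[of 0]) auto
  ultimately show "\<forall>\<^sub>F y in at_left h. Z \<le> iC y"
  proof eventually_elim
    case (elim y)
    then have y: "- h < y" "y < h" using h_pos by auto
    from imag_ge(1)[OF y, of n] elim(1) show ?case by linarith
  qed
qed

text \<open>Jacobi's imaginary transformation: \<open>iS y / iC y\<close> is sn for the
  complementary modulus. At y = h the series diverge, so the value 1 is put in by hand; it is the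
  limit, because 1 - t^2 = (\<open>rC 0 / iC y\<close>)^2 and \<open>iC\<close> tends to
  infinity.\<close>

lemma elliptic_K_comodulus: "elliptic_K (sqrt (1 - modulus\<^sup>2)) = rD 0 * h"
proof (rule elliptic_K_parametrized[where t = "\<lambda>y. if y < h then iS y / iC y else 1"])
  let ?z = "rD 0" and ?t = "\<lambda>y. iS y / iC y"
  show "0 < h" "0 < ?z" using h_pos rD_0_pos by auto
  have lt: "modulus\<^sup>2 < 1" using modulus by (simp add: power_less_one_iff)
  have 1: "1 - (?t y)\<^sup>2 = (rC 0 / iC y)\<^sup>2"
    and 2: "1 - (sqrt (1 - modulus\<^sup>2))\<^sup>2 * (?t y)\<^sup>2 = (modulus * iD y / iC y)\<^sup>2"
    and pos: "iC y > 0" "iD y > 0" if y: "- h < y" "y < h" for y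
  proof -
    show pos: "iC y > 0" "iD y > 0" using imag_ge(2,3)[OF y] .
    have "1 - (?t y)\<^sup>2 = ((iC y)\<^sup>2 - (iS y)\<^sup>2) / (iC y)\<^sup>2"
      using pos by (simp add: power_divide diff_divide_distrib)
    then show "1 - (?t y)\<^sup>2 = (rC 0 / iC y)\<^sup>2"
      using imag_squares(1)[OF y] by (simp add: power_divide)
    have "(iC y)\<^sup>2 - (1 - modulus\<^sup>2) * (iS y)\<^sup>2 = modulus\<^sup>2 * (iD y)\<^sup>2"
      using imag_squares[OF y] modulus(3) by (simp add: algebra_simps power_mult_distrib)
    moreover have "1 - (sqrt (1 - modulus\<^sup>2))\<^sup>2 * (?t y)\<^sup>2 = ((iC y)\<^sup>2 - (1 - modulus\<^sup>2) * (iS y)\<^sup>2) / (iC y)\<^sup>2"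
      using pos lt by (simp add: power_divide diff_divide_distrib)
    ultimately show "1 - (sqrt (1 - modulus\<^sup>2))\<^sup>2 * (?t y)\<^sup>2 = (modulus * iD y / iC y)\<^sup>2"
      by (simp add: power_divide power_mult_distrib)
  qed
  have d: "(?t has_real_derivative (rC 0)\<^sup>2 * iD y / (iC y)\<^sup>2) (at y)" if y: "- h < y" "y < h" for y
  proof -
    have "(?t has_real_derivative (iC y * iD y * iC y - iS y * (iS y * iD y)) / (iC y * iC y)) (at y)"
      by (rule DERIV_divide[OF imag_deriv(1,2)[OF y]]) (use pos[OF y] in auto)
    moreover have "iC y * iD y * iC y - iS y * (iS y * iD y) = ((iC y)\<^sup>2 - (iS y)\<^sup>2) * iD y"
      by (simp add: power2_eq_square algebra_simps)
    ultimately show ?thesis using imag_squares(1)[OF y] by (simp add: power2_eq_square)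
  qed
  have "iS 0 = 0" by (simp add: iS_def S_0)
  then show "(if 0 < h then ?t 0 else 1) = 0" "(if h < h then ?t h else 1) = 1" using h_pos by auto
  have dt: "((\<lambda>y. if y < h then ?t y else 1) has_real_derivative (rC 0)\<^sup>2 * iD y / (iC y)\<^sup>2) (at y)"
    if y: "0 \<le> y" "y < h" for y
  proof (rule has_field_derivative_transform_within_open[of ?t _ _ "{- h<..<h}"])
    show "(?t has_real_derivative (rC 0)\<^sup>2 * iD y / (iC y)\<^sup>2) (at y)" using d y h_pos by auto
  qed (use y h_pos in auto)
  have nonneg: "0 \<le> ?t y" if y: "0 \<le> y" "y < h" for y
  proof -
    have "?t 0 \<le> ?t y"
    proof (rule DERIV_nonneg_imp_nondecreasing[OF y(1)])
      fix u assume "0 \<le> u" "u \<le> y"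
      then have u: "- h < u" "u < h" using y h_pos by auto
      have "0 \<le> (rC 0)\<^sup>2 * iD u / (iC u)\<^sup>2" using pos[OF u] by simp
      then show "\<exists>y. (?t has_real_derivative y) (at u) \<and> 0 \<le> y" using d[OF u] by blast
    qed
    then show ?thesis using \<open>iS 0 = 0\<close> by simp
  qed
  have lim: "(?t \<longlongrightarrow> 1) (at_left h)"
  proof -
    have "((\<lambda>y. sqrt (1 - (rC 0 / iC y)\<^sup>2)) \<longlongrightarrow> sqrt (1 - 0\<^sup>2)) (at_left h)"
      by (intro tendsto_intros real_tendsto_divide_at_top[OF tendsto_const iC_at_top])
    moreover have "\<forall>\<^sub>F y in at_left h. y \<in> {0<..<h}" using h_pos by (intro eventually_at_leftI[of 0]) auto
    then have "\<forall>\<^sub>F y in at_left h. sqrt (1 - (rC 0 / iC y)\<^sup>2) = ?t y"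
    proof eventually_elim
      case (elim y)
      then have y: "- h < y" "y < h" using h_pos by auto
      have "1 - (rC 0 / iC y)\<^sup>2 = (?t y)\<^sup>2" using 1[OF y] by simp
      moreover have "0 \<le> ?t y" using nonneg[of y] elim by simp
      ultimately show ?case by (simp only: real_sqrt_abs abs_of_nonneg)
    qed
    ultimately show ?thesis by (simp add: tendsto_cong)
  qed
  show "continuous_on {0..h} (\<lambda>y. if y < h then ?t y else 1)"
    unfolding continuous_on_eq_continuous_within
  proof
    fix x assume x: "x \<in> {0..h}"
    show "continuous (at x within {0..h}) (\<lambda>y. if y < h then ?t y else 1)"
    proof (cases "x = h")
      case False
      then have "isCont (\<lambda>y. if y < h then ?t y else 1) x"
        using dt[of x] x by (intro DERIV_isCont) auto
      then show ?thesis by (rule continuous_at_imp_continuous_within)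
    next
      case True
      have "((\<lambda>y. if y < h then ?t y else 1) \<longlongrightarrow> 1) (at_left h)"
        by (rule tendsto_cong[THEN iffD1, OF _ lim]) (auto simp: eventually_at_filter)
      then have "((\<lambda>y. if y < h then ?t y else 1) \<longlongrightarrow> 1) (at h within {0..h})"
        using h_pos by (simp add: at_within_Icc_at_left)
      then show ?thesis unfolding continuous_within True by simp
    qed
  qed
  fix y assume y: "0 < y" "y < h"
  then have y': "- h < y" "y < h" using h_pos by auto
  let ?P = "(1 - (?t y)\<^sup>2) * (1 - (sqrt (1 - modulus\<^sup>2))\<^sup>2 * (?t y)\<^sup>2)"
  have "?P > 0" unfolding 1[OF y'] 2[OF y'] using pos[OF y'] rC_0_pos modulus(1) by simp
  then show "0 < (1 - (if y < h then ?t y else 1)\<^sup>2) * (1 - (sqrt (1 - modulus\<^sup>2))\<^sup>2 * (if y < h then ?t y else 1)\<^sup>2)"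
    using y by simp
  have "sqrt ?P = (rC 0 / iC y) * (modulus * iD y / iC y)"
    unfolding 1[OF y'] 2[OF y'] using pos[OF y'] rC_0_pos modulus(1) by (simp add: real_sqrt_mult)
  then have "?z * sqrt ?P = ?z * ((rC 0 / iC y) * (modulus * iD y / iC y))" by (rule arg_cong)
  also have "\<dots> = (rC 0)\<^sup>2 * iD y / (iC y)\<^sup>2"
    unfolding modulus(3) by (simp add: power2_eq_square)
  finally have P: "?z * sqrt ?P = (rC 0)\<^sup>2 * iD y / (iC y)\<^sup>2" .
  have eq: "(if y < h then ?t y else 1) = ?t y" using y by simp
  show "((\<lambda>y. if y < h then ?t y else 1) has_real_derivative
    ?z * sqrt ((1 - (if y < h then ?t y else 1)\<^sup>2) * (1 - (sqrt (1 - modulus\<^sup>2))\<^sup>2 * (if y < h then ?t y else 1)\<^sup>2))) (at y)"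
    unfolding eq P by (rule dt) (use y in auto)
qed

end

section \<open>Hankel determinants of solutions of the quartic equation\<close>

text \<open>Even derivatives are X times a polynomial in X^2, odd ones X' times such a polynomial.
  The formula for X'' is a separate hypothesis because deriving it from the one for X'^2 would mean
  dividing by X'.\<close>

lemma cubic_ode_derivatives:
  fixes X0 X1 X2 X3 X4 X5 X6 :: "complex \<Rightarrow> complex"
  assumes U: "open U" and w: "w \<in> U"
    and d0: "\<And>v. v \<in> U \<Longrightarrow> (X0 has_field_derivative X1 v) (at v)"
    and d1: "\<And>v. v \<in> U \<Longrightarrow> (X1 has_field_derivative X2 v) (at v)"
    and d2: "\<And>v. v \<in> U \<Longrightarrow> (X2 has_field_derivative X3 v) (at v)"
    and d3: "\<And>v. v \<in> U \<Longrightarrow> (X3 has_field_derivative X4 v) (at v)"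
    and d4: "\<And>v. v \<in> U \<Longrightarrow> (X4 has_field_derivative X5 v) (at v)"
    and d5: "\<And>v. v \<in> U \<Longrightarrow> (X5 has_field_derivative X6 v) (at v)"
    and X1: "\<And>v. v \<in> U \<Longrightarrow> (X1 v)\<^sup>2 = e * X0 v ^ 4 + b * X0 v ^ 2 + c"
    and X2: "\<And>v. v \<in> U \<Longrightarrow> X2 v = X0 v * (2 * e * X0 v ^ 2 + b)"
  shows "X4 w = X0 w * (24 * e\<^sup>2 * X0 w ^ 4 + 20 * e * b * X0 w ^ 2 + b\<^sup>2 + 12 * e * c)"
    and "X6 w = X0 w * (720 * e ^ 3 * X0 w ^ 6 + 840 * e\<^sup>2 * b * X0 w ^ 4
      + (182 * e * b\<^sup>2 + 504 * e\<^sup>2 * c) * X0 w ^ 2 + b ^ 3 + 132 * e * b * c)"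
proof -
  \<comment> \<open>Two expressions that agree on an open set have the same derivative; each use
    lifts a formula for one derivative to the next.\<close>
  have step: "d = d'"
    if "v \<in> U" "(F has_field_derivative d) (at v)" "\<And>v. v \<in> U \<Longrightarrow> F v = G v"
      "(G has_field_derivative d') (at v)" for v F G d d'
    by (rule DERIV_unique[OF has_field_derivative_transform_within_open[OF that(2) U that(1,3)] that(4)])
  have X3: "X3 v = X1 v * (6 * e * X0 v ^ 2 + b)" if v: "v \<in> U" for v
    by (rule step[OF v d2[OF v] X2]) (auto intro!: derivative_eq_intros d0 d1 v simp: algebra_simps power2_eq_square power3_eq_cube power4_eq_xxxx)
  have X4: "X4 v = X0 v * (24 * e\<^sup>2 * X0 v ^ 4 + 20 * e * b * X0 v ^ 2 + b\<^sup>2 + 12 * e * c)" if v: "v \<in> U" for v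
  proof -
    have "X4 v = X2 v * (6 * e * X0 v ^ 2 + b) + 12 * e * X0 v * (X1 v)\<^sup>2"
      by (rule step[OF v d3[OF v] X3]) (auto intro!: derivative_eq_intros d0 d1 v simp: algebra_simps power2_eq_square power3_eq_cube power4_eq_xxxx)
    then show ?thesis unfolding X1[OF v] X2[OF v] by algebra
  qed
  have X5: "X5 v = X1 v * (120 * e\<^sup>2 * X0 v ^ 4 + 60 * e * b * X0 v ^ 2 + b\<^sup>2 + 12 * e * c)" if v: "v \<in> U" for v
    by (rule step[OF v d4[OF v] X4]) (auto intro!: derivative_eq_intros d0 d1 v simp: algebra_simps power2_eq_square power3_eq_cube power4_eq_xxxx)
  show "X4 w = X0 w * (24 * e\<^sup>2 * X0 w ^ 4 + 20 * e * b * X0 w ^ 2 + b\<^sup>2 + 12 * e * c)" by (rule X4[OF w])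
  have "X6 w = X2 w * (120 * e\<^sup>2 * X0 w ^ 4 + 60 * e * b * X0 w ^ 2 + b\<^sup>2 + 12 * e * c)
      + (X1 w)\<^sup>2 * (480 * e\<^sup>2 * X0 w ^ 3 + 120 * e * b * X0 w)"
    by (rule step[OF w d5[OF w] X5]) (auto intro!: derivative_eq_intros d0 d1 w simp: algebra_simps power2_eq_square power3_eq_cube power4_eq_xxxx)
  then show "X6 w = X0 w * (720 * e ^ 3 * X0 w ^ 6 + 840 * e\<^sup>2 * b * X0 w ^ 4
      + (182 * e * b\<^sup>2 + 504 * e\<^sup>2 * c) * X0 w ^ 2 + b ^ 3 + 132 * e * b * c)"
    unfolding X1[OF w] X2[OF w] by algebra
qed

text \<open>The value of \<open>X'' X\<^sup>(\<^sup>6\<^sup>) - (X\<^sup>(\<^sup>4\<^sup>))\<^sup>2\<close> in terms of \<open>Y = X\<^sup>2\<close>.\<close>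

definition hankel :: "complex \<Rightarrow> complex \<Rightarrow> complex \<Rightarrow> complex \<Rightarrow> complex" where
  "hankel e b c Y = Y * ((2 * e * Y + b) * (720 * e ^ 3 * Y ^ 3 + 840 * e\<^sup>2 * b * Y\<^sup>2
      + (182 * e * b\<^sup>2 + 504 * e\<^sup>2 * c) * Y + b ^ 3 + 132 * e * b * c)
    - (24 * e\<^sup>2 * Y\<^sup>2 + 20 * e * b * Y + b\<^sup>2 + 12 * e * c)\<^sup>2)"

lemma cubic_ode_hankel:
  fixes X0 X1 X2 X3 X4 X5 X6 :: "complex \<Rightarrow> complex"
  assumes U: "open U" and w: "w \<in> U"
    and d0: "\<And>v. v \<in> U \<Longrightarrow> (X0 has_field_derivative X1 v) (at v)"
    and d1: "\<And>v. v \<in> U \<Longrightarrow> (X1 has_field_derivative X2 v) (at v)"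
    and d2: "\<And>v. v \<in> U \<Longrightarrow> (X2 has_field_derivative X3 v) (at v)"
    and d3: "\<And>v. v \<in> U \<Longrightarrow> (X3 has_field_derivative X4 v) (at v)"
    and d4: "\<And>v. v \<in> U \<Longrightarrow> (X4 has_field_derivative X5 v) (at v)"
    and d5: "\<And>v. v \<in> U \<Longrightarrow> (X5 has_field_derivative X6 v) (at v)"
    and X1: "\<And>v. v \<in> U \<Longrightarrow> (X1 v)\<^sup>2 = e * X0 v ^ 4 + b * X0 v ^ 2 + c"
    and X2: "\<And>v. v \<in> U \<Longrightarrow> X2 v = X0 v * (2 * e * X0 v ^ 2 + b)"
  shows "X2 w * X6 w - (X4 w)\<^sup>2 = hankel e b c ((X0 w)\<^sup>2)"
proof -
  have 4: "X4 w = X0 w * (24 * e\<^sup>2 * X0 w ^ 4 + 20 * e * b * X0 w ^ 2 + b\<^sup>2 + 12 * e * c)"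
    by (rule cubic_ode_derivatives(1)[OF assms])
  have 6: "X6 w = X0 w * (720 * e ^ 3 * X0 w ^ 6 + 840 * e\<^sup>2 * b * X0 w ^ 4
      + (182 * e * b\<^sup>2 + 504 * e\<^sup>2 * c) * X0 w ^ 2 + b ^ 3 + 132 * e * b * c)"
    by (rule cubic_ode_derivatives(2)[OF assms])
  show ?thesis unfolding hankel_def 4 6 X2[OF w] by algebra
qed

section \<open>Geometric series and the derivatives of the secant\<close>

lemma has_field_derivative_lser_lder':
  assumes "lconv lo hi a" "lo < Im w" "Im w < hi" "n' = Suc n"
  shows "(lser (lder n a) has_field_derivative lser (lder n' a) w) (at w)"
  using has_field_derivative_lser_lder[OF assms(1-3)] assms(4) by simp

text \<open>The model for the leading part of the coefficients, which on the side j < 0 behave like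
  a constant times exp (jh). Its closed form has a limit where the series itself diverges.\<close>

definition geo :: "bool \<Rightarrow> int \<Rightarrow> complex" where
  "geo p j = (if 0 < j \<and> odd j = p then 1 else 0)"

lemma lconv_geo: "lconv 0 hi (geo p)"
  by (rule lconv_bounded[of 1]) (auto simp: geo_def)

lemma lser_geo:
  assumes "Im u > 0"
  shows "lser (geo True) u = exp (\<i> * u) / (1 - exp (\<i> * u) ^ 2)"
    and "lser (geo False) u = exp (\<i> * u) ^ 2 / (1 - exp (\<i> * u) ^ 2)"
proof -
  define x where "x = exp (\<i> * u)"
  have x: "norm (x ^ 2) < 1" unfolding x_def using assms by (simp add: norm_power power_less_one_iff)
  have e: "exp (\<i> * of_int (int n) * u) = x ^ n" for n
    unfolding x_def exp_of_nat_mult[symmetric] by (simp add: mult_ac)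
  have main: "lser (geo p) u = x ^ k / (1 - x ^ 2)"
    if "p = odd k" "k > 0" "k \<le> 2" for p and k :: nat
  proof -
    let ?f = "\<lambda>j. geo p j * exp (\<i> * of_int j * u)" and ?g = "\<lambda>n :: nat. int (2 * n + k)"
    have "(?f has_sum lser (geo p) u) UNIV"
      by (rule lconv_has_sum[OF lconv_geo[of "Im u + 1"]]) (use assms in auto)
    moreover have "?f j = 0" if "j \<in> UNIV - range ?g" for j
    proof (rule ccontr)
      assume "?f j \<noteq> 0"
      then have "0 < j" "odd j = p" by (auto simp: geo_def split: if_splits)
      moreover have "k = 1 \<or> k = 2" using \<open>k > 0\<close> \<open>k \<le> 2\<close> by auto
      ultimately have "0 \<le> (j - int k) div 2 \<and> 2 * ((j - int k) div 2) + int k = j"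
        using \<open>p = odd k\<close> by (elim disjE; simp; presburger)
      then have "j = ?g (nat ((j - int k) div 2))" by simp
      then have "j \<in> range ?g" by (rule range_eqI)
      with that show False by simp
    qed
    ultimately have "(?f has_sum lser (geo p) u) (range ?g)"
      using has_sum_cong_neutral[of "range ?g" UNIV ?f ?f "lser (geo p) u"] by fastforce
    moreover have "inj ?g" by (rule injI) simp
    ultimately have "((\<lambda>n. ?f (?g n)) has_sum lser (geo p) u) UNIV"
      using has_sum_reindex[of ?g UNIV ?f "lser (geo p) u"] by (simp add: o_def)
    moreover have "?f (?g n) = x ^ k * (x ^ 2) ^ n" for n
    proof -
      have "geo p (?g n) = 1" using that by (simp add: geo_def)
      then show ?thesis unfolding e power_add power_mult by simp
    qed
    ultimately have "(\<lambda>n. x ^ k * (x ^ 2) ^ n) sums lser (geo p) u" by (simp only: has_sum_imp_sums)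
    moreover have "(\<lambda>n. x ^ k * (x ^ 2) ^ n) sums (x ^ k * (1 / (1 - x ^ 2)))"
      by (intro sums_mult geometric_sums x)
    ultimately show ?thesis using sums_unique2 by fastforce
  qed
  show "lser (geo True) u = exp (\<i> * u) / (1 - exp (\<i> * u) ^ 2)"
    using main[of True 1] by (simp add: x_def)
  show "lser (geo False) u = exp (\<i> * u) ^ 2 / (1 - exp (\<i> * u) ^ 2)"
    using main[of False 2] by (simp add: x_def)
qed

lemma exp_minus_half_pi: "exp (\<i> * (v - of_real (pi / 2))) = - \<i> * exp (\<i> * v)"
proof -
  have "exp (\<i> * (v - of_real (pi / 2))) = exp (\<i> * v) * cis (- (pi / 2))"
    by (simp add: cis_conv_exp exp_add[symmetric] algebra_simps)
  then show ?thesis by (simp add: cis.ctr complex_eq_iff)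
qed

text \<open>The shift by pi/2 is the real part of the point to be reached; approaching that point
  corresponds to v \<rightarrow> 0, where the secant is regular.\<close>

lemma geo_shifted:
  assumes "Im v > 0"
  shows "lser (geo True) (v - of_real (pi / 2)) = - \<i> / (2 * cos v)" "cos v \<noteq> 0"
    and "lser (geo False) (v - of_real (pi / 2)) = - (exp (\<i> * v))\<^sup>2 / (1 + (exp (\<i> * v))\<^sup>2)"
proof -
  define x where "x = exp (\<i> * v)"
  have "norm x < 1" unfolding x_def using assms by simp
  then have "norm (x\<^sup>2) < 1" by (simp add: norm_power power_less_one_iff)
  then have x: "1 + x\<^sup>2 \<noteq> 0" "x \<noteq> 0" unfolding x_def[symmetric]
    by (metis add_eq_0_iff norm_minus_cancel norm_one order_less_irrefl) (simp add: x_def)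
  have c: "2 * cos v = (1 + x\<^sup>2) / x"
    using x by (simp add: cos_exp_eq x_def exp_minus power2_eq_square field_simps)
  then show "cos v \<noteq> 0" using x by auto
  have u: "Im (v - of_real (pi / 2)) > 0" using assms by simp
  show "lser (geo True) (v - of_real (pi / 2)) = - \<i> / (2 * cos v)"
    unfolding lser_geo[OF u] exp_minus_half_pi x_def[symmetric] c
    using x by (simp add: power_mult_distrib)
  show "lser (geo False) (v - of_real (pi / 2)) = - (exp (\<i> * v))\<^sup>2 / (1 + (exp (\<i> * v))\<^sup>2)"
    unfolding lser_geo[OF u] exp_minus_half_pi x_def[symmetric]
    using x by (simp add: power_mult_distrib)
qed

text \<open>X = -(i/2) sec v satisfies X'^2 = -4 X^4 - X^2, so the general formulas apply with e =
  -4, b = -1, c = 0.\<close>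

lemma geo_lder:
  assumes "Im v > 0"
  defines "X \<equiv> - \<i> / (2 * cos v)"
  shows "lser (lder 2 (geo True)) (v - of_real (pi / 2)) = X * (- 8 * X ^ 2 - 1)"
    and "lser (lder 4 (geo True)) (v - of_real (pi / 2)) = X * (384 * X ^ 4 + 80 * X ^ 2 + 1)"
    and "lser (lder 6 (geo True)) (v - of_real (pi / 2)) = X * (- 46080 * X ^ 6 - 13440 * X ^ 4 - 728 * X ^ 2 - 1)"
proof -
  let ?U = "{v. Im v > 0}"
  define f where "f n v = lser (lder n (geo True)) (v - of_real (pi / 2))" for n v
  have U: "open ?U" by (rule open_halfspace_Im_gt)
  have d: "(f n has_field_derivative f n' v) (at v)" if "v \<in> ?U" "n' = Suc n" for n n' v
  proof -
    have "(lser (lder n (geo True)) has_field_derivative lser (lder n' (geo True)) (v - of_real (pi / 2))) (at (v - of_real (pi / 2)))"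
      by (rule has_field_derivative_lser_lder'[OF lconv_geo[of "Im v + 1"]]) (use that in auto)
    moreover have "((\<lambda>v. v - of_real (pi / 2)) has_field_derivative 1) (at v)"
      by (auto intro!: derivative_eq_intros)
    ultimately show ?thesis unfolding f_def using DERIV_chain2 by fastforce
  qed
  have f0: "f 0 v = - \<i> / (2 * cos v)" "cos v \<noteq> 0" if "v \<in> ?U" for v
    using geo_shifted[of v] that by (auto simp: f_def)
  have f1: "f 1 v = - \<i> * sin v / (2 * (cos v)\<^sup>2)" if v: "v \<in> ?U" for v
  proof -
    have "((\<lambda>v. - \<i> / (2 * cos v)) has_field_derivative f 1 v) (at v)"
      by (rule has_field_derivative_transform_within_open[OF d[OF v, of 1 0] U v]) (use f0 in auto)
    moreover have "((\<lambda>v. - \<i> / (2 * cos v)) has_field_derivative - \<i> * sin v / (2 * (cos v)\<^sup>2)) (at v)"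
      using f0(2)[OF v] by (auto intro!: derivative_eq_intros simp: field_simps power2_eq_square)
    ultimately show ?thesis using DERIV_unique by fastforce
  qed
  have s2: "(sin v)\<^sup>2 = 1 - (cos v)\<^sup>2" for v :: complex by (simp add: sin_squared_eq)
  have f2: "f 2 v = - \<i> * (2 - (cos v)\<^sup>2) / (2 * (cos v) ^ 3)" if v: "v \<in> ?U" for v
  proof -
    have "((\<lambda>v. - \<i> * sin v / (2 * (cos v)\<^sup>2)) has_field_derivative f 2 v) (at v)"
      by (rule has_field_derivative_transform_within_open[OF d[OF v, of 2 1] U v]) (use f1 in auto)
    moreover have "((\<lambda>v. - \<i> * sin v / (2 * (cos v)\<^sup>2)) has_field_derivative - \<i> * (2 * (sin v)\<^sup>2 + (cos v)\<^sup>2) / (2 * (cos v) ^ 3)) (at v)"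
      using f0(2)[OF v] by (auto intro!: derivative_eq_intros simp: field_simps power2_eq_square power3_eq_cube)
    moreover have "2 * (sin v)\<^sup>2 + (cos v)\<^sup>2 = 2 - (cos v)\<^sup>2" by (simp add: s2)
    ultimately show ?thesis using DERIV_unique by fastforce
  qed
  have o1: "(f 1 v)\<^sup>2 = - 4 * f 0 v ^ 4 + - 1 * f 0 v ^ 2 + 0" if v: "v \<in> ?U" for v
    unfolding f1[OF v] f0(1)[OF v] using f0(2)[OF v]
    by (simp add: power_divide power_mult_distrib s2) (simp add: field_simps)
  have o2: "f 2 v = f 0 v * (2 * - 4 * f 0 v ^ 2 + - 1)" if v: "v \<in> ?U" for v
    unfolding f2[OF v] f0(1)[OF v] using f0(2)[OF v]
    by (simp add: power_divide power_mult_distrib) (simp add: field_simps power2_eq_square power3_eq_cube)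
  have v: "v \<in> ?U" using assms by simp
  have X: "f 0 v = X" using f0(1)[OF v] by (simp add: X_def)
  show "lser (lder 2 (geo True)) (v - of_real (pi / 2)) = X * (- 8 * X ^ 2 - 1)"
    using o2[OF v] unfolding X by (simp add: f_def)
  show "lser (lder 4 (geo True)) (v - of_real (pi / 2)) = X * (384 * X ^ 4 + 80 * X ^ 2 + 1)"
    using cubic_ode_derivatives(1)[of ?U v "f 0" "f 1" "f 2" "f 3" "f 4" "f 5" "f 6" "- 4" "- 1" 0, OF U v d d d d d d o1 o2]
    unfolding X by (simp add: f_def)
  show "lser (lder 6 (geo True)) (v - of_real (pi / 2)) = X * (- 46080 * X ^ 6 - 13440 * X ^ 4 - 728 * X ^ 2 - 1)"
    using cubic_ode_derivatives(2)[of ?U v "f 0" "f 1" "f 2" "f 3" "f 4" "f 5" "f 6" "- 4" "- 1" 0, OF U v d d d d d d o1 o2]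
    unfolding X by (simp add: f_def)
qed

text \<open>The second, fourth and sixth derivatives of sec at 0 are 1, 5 and 61. The last limit is
  the regularised value -1/2 of the alternating geometric series, used to locate the zero of
  D.\<close>

lemma geo_limits:
  assumes "h > 0"
  shows "((\<lambda>y. lser (lder 2 (geo True)) (\<i> * of_real (h - y) - of_real (pi / 2))) \<longlongrightarrow> - \<i> / 2) (at_left h)"
    and "((\<lambda>y. lser (lder 4 (geo True)) (\<i> * of_real (h - y) - of_real (pi / 2))) \<longlongrightarrow> - 5 * \<i> / 2) (at_left h)"
    and "((\<lambda>y. lser (lder 6 (geo True)) (\<i> * of_real (h - y) - of_real (pi / 2))) \<longlongrightarrow> - 61 * \<i> / 2) (at_left h)"
    and "((\<lambda>y. lser (geo False) (\<i> * of_real (h - y) - of_real (pi / 2))) \<longlongrightarrow> - 1 / 2) (at_left h)"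
proof -
  define X where "X y = - \<i> / (2 * cos (\<i> * of_real (h - y)))" for y
  have "(X \<longlongrightarrow> - \<i> / (2 * cos (\<i> * of_real (h - h)))) (at_left h)"
    unfolding X_def by (intro tendsto_intros) auto
  then have X: "(X \<longlongrightarrow> - \<i> / 2) (at_left h)" by simp
  have ev: "\<forall>\<^sub>F y in at_left h. Im (\<i> * of_real (h - y)) > 0"
    by (auto simp: eventually_at_filter)
  have i: "(\<i> / 2)\<^sup>2 = - 1 / 4" "(\<i> / 2) ^ 4 = 1 / 16" "(\<i> / 2) ^ 6 = - 1 / 64"
    by (simp_all add: power_divide power2_eq_square power4_eq_xxxx numeral_eq_Suc)
  have "((\<lambda>y. X y * (- 8 * X y ^ 2 - 1)) \<longlongrightarrow> - \<i> / 2 * (- 8 * (- \<i> / 2) ^ 2 - 1)) (at_left h)"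
    by (intro tendsto_intros X)
  then show "((\<lambda>y. lser (lder 2 (geo True)) (\<i> * of_real (h - y) - of_real (pi / 2))) \<longlongrightarrow> - \<i> / 2) (at_left h)"
    by (rule Lim_transform_eventually[THEN tendsto_eq_rhs])
      (use ev in \<open>eventually_elim, use geo_lder(1) in \<open>simp add: X_def\<close>\<close>, simp add: i)
  have "((\<lambda>y. X y * (384 * X y ^ 4 + 80 * X y ^ 2 + 1)) \<longlongrightarrow> - \<i> / 2 * (384 * (- \<i> / 2) ^ 4 + 80 * (- \<i> / 2) ^ 2 + 1)) (at_left h)"
    by (intro tendsto_intros X)
  then show "((\<lambda>y. lser (lder 4 (geo True)) (\<i> * of_real (h - y) - of_real (pi / 2))) \<longlongrightarrow> - 5 * \<i> / 2) (at_left h)"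
    by (rule Lim_transform_eventually[THEN tendsto_eq_rhs])
      (use ev in \<open>eventually_elim, use geo_lder(2) in \<open>simp add: X_def\<close>\<close>, simp add: i)
  have "((\<lambda>y. X y * (- 46080 * X y ^ 6 - 13440 * X y ^ 4 - 728 * X y ^ 2 - 1)) \<longlongrightarrow> - \<i> / 2 * (- 46080 * (- \<i> / 2) ^ 6 - 13440 * (- \<i> / 2) ^ 4 - 728 * (- \<i> / 2) ^ 2 - 1)) (at_left h)"
    by (intro tendsto_intros X)
  then show "((\<lambda>y. lser (lder 6 (geo True)) (\<i> * of_real (h - y) - of_real (pi / 2))) \<longlongrightarrow> - 61 * \<i> / 2) (at_left h)"
    by (rule Lim_transform_eventually[THEN tendsto_eq_rhs])
      (use ev in \<open>eventually_elim, use geo_lder(3) in \<open>simp add: X_def\<close>\<close>, simp add: i)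
  have "((\<lambda>y. - (exp (\<i> * (\<i> * of_real (h - y))))\<^sup>2 / (1 + (exp (\<i> * (\<i> * of_real (h - y))))\<^sup>2))
     \<longlongrightarrow> - (exp (\<i> * (\<i> * of_real (h - h))))\<^sup>2 / (1 + (exp (\<i> * (\<i> * of_real (h - h))))\<^sup>2)) (at_left h)"
    by (intro tendsto_intros) auto
  then show "((\<lambda>y. lser (geo False) (\<i> * of_real (h - y) - of_real (pi / 2))) \<longlongrightarrow> - 1 / 2) (at_left h)"
    by (rule Lim_transform_eventually[THEN tendsto_eq_rhs])
      (use ev in \<open>eventually_elim, use geo_shifted(3) in simp\<close>, simp)
qed

section \<open>Evaluation at the half and quarter periods\<close>

text \<open>At every point of evaluation the first derivative vanishes.\<close>

lemma hankel_root:
  assumes "e * Y\<^sup>2 + b * Y + c = 0"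
  shows "hankel e b c Y = 36 * e * Y\<^sup>2 * (2 * e * Y + b) ^ 3"
proof -
  have c: "c = - (e * Y\<^sup>2) - b * Y" using assms by algebra
  show ?thesis unfolding hankel_def c by algebra
qed

section \<open>Phases at pi/2 and evaluation of symmetric series\<close>

lemma exp_half_pi_neg:
  "exp (\<i> * of_int (- j) * of_real (pi / 2)) = (if even j then 1 else - 1) * exp (\<i> * of_int j * of_real (pi / 2))"
proof -
  have "exp (\<i> * of_int (- j) * of_real (pi / 2)) * exp (\<i> * of_int j * of_real pi) = exp (\<i> * of_int j * of_real (pi / 2))"
    by (simp add: exp_add[symmetric] field_simps)
  then have "exp (\<i> * of_int (- j) * of_real (pi / 2)) * (if even j then 1 else - 1) = exp (\<i> * of_int j * of_real (pi / 2))"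
    unfolding exp_i_of_int_pi .
  from this[symmetric] show ?thesis by (simp only:) simp
qed

lemma exp_half_pi_even: "exp (\<i> * of_int (2 * int r) * of_real (pi / 2)) = (- 1) ^ r"
proof -
  have "exp (\<i> * of_int (2 * int r) * of_real (pi / 2)) = exp (of_nat r * (\<i> * of_real pi))"
    by (simp add: mult_ac)
  then show ?thesis unfolding exp_of_nat_mult by simp
qed

lemma exp_half_pi_odd: "exp (\<i> * of_int (2 * int r - 1) * of_real (pi / 2)) = - \<i> * (- 1) ^ r"
proof -
  have "exp (\<i> * of_int (2 * int r - 1) * of_real (pi / 2)) = exp (\<i> * (\<i> * 0 + of_int (2 * int r) * of_real (pi / 2) - of_real (pi / 2)))"
    by (simp add: algebra_simps)
  also have "\<dots> = - \<i> * exp (\<i> * of_int (2 * int r) * of_real (pi / 2))"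
    unfolding exp_minus_half_pi by (simp add: mult.assoc)
  finally show ?thesis unfolding exp_half_pi_even .
qed

text \<open>The terms lie on the real line through \<open>c\<close>, so real and imaginary parts of
  V / c reduce the complex sum to the real infinite sums of the definitions.\<close>

lemma has_sum_complex_multiple:
  fixes t :: "'a \<Rightarrow> real" and c V :: complex
  assumes "((\<lambda>r. c * of_real (t r)) has_sum V) A" "c \<noteq> 0"
  shows "V = c * of_real (\<Sum>\<^sub>\<infinity>r\<in>A. t r)"
proof -
  from has_sum_cmult_right[OF assms(1), of "1 / c"] assms(2)
  have *: "((\<lambda>r. complex_of_real (t r)) has_sum V / c) A" by simp
  have "Im (V / c) = 0" using has_sum_unique[OF has_sum_Im[OF *], of 0] by simp
  moreover have "Re (V / c) = (\<Sum>\<^sub>\<infinity>r\<in>A. t r)" using infsumI[OF has_sum_Re[OF *]] by simp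
  ultimately have "V / c = of_real (\<Sum>\<^sub>\<infinity>r\<in>A. t r)" by (simp add: complex_eq_iff)
  then show ?thesis using assms(2) by (simp add: field_simps)
qed

lemma lder_even: "lder (2 * m) a j = (- 1) ^ m * of_int j ^ (2 * m) * a j"
  by (simp add: lder_def power_mult_distrib power_mult power_minus[of "(of_int j)\<^sup>2"])

text \<open>\<open>c\<close> collects the phase and the constants, \<open>t\<close> the real term.
  The 2 comes from pairing j with -j, the sign from i^(2m).\<close>

lemma lser_odd_eval:
  assumes a: "lconv lo hi a" and w: "lo < Im w" "Im w < hi"
    and odd: "\<And>j. even j \<Longrightarrow> a j = 0"
    and sym: "\<And>j. odd j \<Longrightarrow> a (- j) * exp (\<i> * of_int (- j) * w) = a j * exp (\<i> * of_int j * w)"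
    and t: "\<And>r. 1 \<le> r \<Longrightarrow> a (2 * int r - 1) * exp (\<i> * of_int (2 * int r - 1) * w) = c * of_real (t r)"
    and c: "c \<noteq> 0"
  shows "lser (lder (2 * m) a) w = (- 1) ^ m * 2 * c * of_real (\<Sum>\<^sub>\<infinity>r\<in>{1..}. (2 * real r - 1) ^ (2 * m) * t r)"
proof (rule has_sum_complex_multiple)
  let ?f = "\<lambda>j. lder (2 * m) a j * exp (\<i> * of_int j * w)"
  have "((\<lambda>r. 2 * ?f (2 * int r - 1)) has_sum lser (lder (2 * m) a) w) {1..}"
  proof (rule has_sum_int_odd_pairs[OF lconv_has_sum[OF lconv_lder[OF a] w]])
    fix j :: int
    show "?f j = 0" if "even j" using odd[OF that] by (simp add: lder_even)
    show "?f (- j) = ?f j"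
    proof (cases "odd j")
      case True
      have "of_int (- j) ^ (2 * m) = (of_int j ^ (2 * m) :: complex)" by simp
      then show ?thesis using sym[OF True] unfolding lder_even mult.assoc by simp
    qed (use odd[of j] odd[of "- j"] in \<open>simp add: lder_even\<close>)
  qed
  moreover let ?g = "\<lambda>r. (- 1) ^ m * 2 * c * of_real ((2 * real r - 1) ^ (2 * m) * t r)"
  have "2 * ?f (2 * int r - 1) = ?g r" if "r \<in> {1..}" for r
    using t[of r] that unfolding lder_even mult.assoc by simp
  ultimately show "((\<lambda>r. (- 1) ^ m * 2 * c * of_real ((2 * real r - 1) ^ (2 * m) * t r)) has_sum lser (lder (2 * m) a) w) {1..}"
    using has_sum_cong[of "{1..}" "\<lambda>r. 2 * ?f (2 * int r - 1)" ?g] by blast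
qed (use c in simp)

text \<open>Here the index is 2r, whence the power of 4; m > 0 removes the unpaired term j =
  0.\<close>

lemma lser_even_eval:
  assumes a: "lconv lo hi a" and w: "lo < Im w" "Im w < hi"
    and odd: "\<And>j. odd j \<Longrightarrow> a j = 0"
    and sym: "\<And>j. even j \<Longrightarrow> a (- j) * exp (\<i> * of_int (- j) * w) = a j * exp (\<i> * of_int j * w)"
    and t: "\<And>r. 1 \<le> r \<Longrightarrow> a (2 * int r) * exp (\<i> * of_int (2 * int r) * w) = c * of_real (t r)"
    and c: "c \<noteq> 0" and m: "m > 0"
  shows "lser (lder (2 * m) a) w = (- 1) ^ m * 2 * 4 ^ m * c * of_real (\<Sum>\<^sub>\<infinity>r\<in>{1..}. real r ^ (2 * m) * t r)"
proof (rule has_sum_complex_multiple)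
  let ?f = "\<lambda>j. lder (2 * m) a j * exp (\<i> * of_int j * w)"
  have "((\<lambda>r. 2 * ?f (2 * int r)) has_sum lser (lder (2 * m) a) w - ?f 0) {1..}"
  proof (rule has_sum_int_even_pairs[OF lconv_has_sum[OF lconv_lder[OF a] w]])
    fix j :: int
    show "?f j = 0" if "odd j" using odd[OF that] by (simp add: lder_even)
    show "?f (- j) = ?f j"
    proof (cases "even j")
      case True
      have "of_int (- j) ^ (2 * m) = (of_int j ^ (2 * m) :: complex)" by simp
      then show ?thesis using sym[OF True] unfolding lder_even mult.assoc by simp
    qed (use odd[of j] odd[of "- j"] in \<open>simp add: lder_even\<close>)
  qed
  moreover have "?f 0 = 0" using m by (simp add: lder_even)
  ultimately have "((\<lambda>r. 2 * ?f (2 * int r)) has_sum lser (lder (2 * m) a) w) {1..}" by simp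
  moreover let ?g = "\<lambda>r. (- 1) ^ m * 2 * 4 ^ m * c * of_real (real r ^ (2 * m) * t r)"
  have "2 * ?f (2 * int r) = ?g r" if "r \<in> {1..}" for r
    using t[of r] that unfolding lder_even mult.assoc by (simp add: power_mult_distrib power_mult)
  ultimately show "((\<lambda>r. (- 1) ^ m * 2 * 4 ^ m * c * of_real (real r ^ (2 * m) * t r)) has_sum lser (lder (2 * m) a) w) {1..}"
    using has_sum_cong[of "{1..}" "\<lambda>r. 2 * ?f (2 * int r)" ?g] by blast
qed (use c in simp)

section \<open>Hankel identities in the strip and the series at 0 and pi/2\<close>

context half_period
begin

lemma strip_second_derivs:
  assumes w: "- h < Im w" "Im w < h"
  shows "lser (lder 2 cS) w = - S w * ((C w)\<^sup>2 + (D w)\<^sup>2)"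
    and "lser (lder 2 cC) w = C w * ((S w)\<^sup>2 - (D w)\<^sup>2)"
    and "lser (lder 2 cD) w = D w * ((S w)\<^sup>2 - (C w)\<^sup>2)"
proof -
  let ?U = "{w. - h < Im w \<and> Im w < h}"
  have wU: "w \<in> ?U" using w by simp
  have d: "(lser (lder 1 a) has_field_derivative lser (lder 2 a) w) (at w)" if "lconv (- h) h a" for a
    by (rule has_field_derivative_lser_lder'[OF that w]) simp
  note tr = has_field_derivative_transform_within_open[OF d strip_convex(2) wU]
  have "((\<lambda>w. C w * D w) has_field_derivative lser (lder 2 cS) w) (at w)"
    by (rule tr[OF lconv_main(3)]) (use strip_ode in auto)
  moreover have "((\<lambda>w. C w * D w) has_field_derivative - S w * ((C w)\<^sup>2 + (D w)\<^sup>2)) (at w)"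
    by (auto intro!: derivative_eq_intros strip_deriv w simp: algebra_simps power2_eq_square)
  ultimately show "lser (lder 2 cS) w = - S w * ((C w)\<^sup>2 + (D w)\<^sup>2)" by (rule DERIV_unique)
  have "((\<lambda>w. - S w * D w) has_field_derivative lser (lder 2 cC) w) (at w)"
    by (rule tr[OF lconv_main(1)]) (use strip_ode in auto)
  moreover have "((\<lambda>w. - S w * D w) has_field_derivative C w * ((S w)\<^sup>2 - (D w)\<^sup>2)) (at w)"
    by (auto intro!: derivative_eq_intros strip_deriv w simp: algebra_simps power2_eq_square)
  ultimately show "lser (lder 2 cC) w = C w * ((S w)\<^sup>2 - (D w)\<^sup>2)" by (rule DERIV_unique)
  have "((\<lambda>w. - S w * C w) has_field_derivative lser (lder 2 cD) w) (at w)"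
    by (rule tr[OF lconv_main(2)]) (use strip_ode in auto)
  moreover have "((\<lambda>w. - S w * C w) has_field_derivative D w * ((S w)\<^sup>2 - (C w)\<^sup>2)) (at w)"
    by (auto intro!: derivative_eq_intros strip_deriv w simp: algebra_simps power2_eq_square)
  ultimately show "lser (lder 2 cD) w = D w * ((S w)\<^sup>2 - (C w)\<^sup>2)" by (rule DERIV_unique)
qed

lemma strip_hankel_aux:
  assumes a: "lconv (- h) h a" and w: "- h < Im w" "Im w < h"
    and 1: "\<And>v. - h < Im v \<Longrightarrow> Im v < h \<Longrightarrow> (lser (lder 1 a) v)\<^sup>2 = e * lser a v ^ 4 + b * lser a v ^ 2 + c"
    and 2: "\<And>v. - h < Im v \<Longrightarrow> Im v < h \<Longrightarrow> lser (lder 2 a) v = lser a v * (2 * e * lser a v ^ 2 + b)"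
  shows "lser (lder 2 a) w * lser (lder 6 a) w - (lser (lder 4 a) w)\<^sup>2 = hankel e b c ((lser a w)\<^sup>2)"
proof (rule cubic_ode_hankel[OF strip_convex(2), where ?X0.0 = "lser a" and ?X1.0 = "lser (lder 1 a)"
      and ?X2.0 = "lser (lder 2 a)" and ?X3.0 = "lser (lder 3 a)" and ?X4.0 = "lser (lder 4 a)"
      and ?X5.0 = "lser (lder 5 a)" and ?X6.0 = "lser (lder 6 a)"])
  have d: "(lser (lder n a) has_field_derivative lser (lder n' a) v) (at v)"
    if "v \<in> {w. - h < Im w \<and> Im w < h}" "n' = Suc n" for n n' v
    by (rule has_field_derivative_lser_lder'[OF a]) (use that in auto)
  fix v assume v: "v \<in> {w. - h < Im w \<and> Im w < h}"
  show "(lser a has_field_derivative lser (lder 1 a) v) (at v)" using d[OF v, of 1 0] by simp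
  show "(lser (lder 1 a) has_field_derivative lser (lder 2 a) v) (at v)"
    "(lser (lder 2 a) has_field_derivative lser (lder 3 a) v) (at v)"
    "(lser (lder 3 a) has_field_derivative lser (lder 4 a) v) (at v)"
    "(lser (lder 4 a) has_field_derivative lser (lder 5 a) v) (at v)"
    "(lser (lder 5 a) has_field_derivative lser (lder 6 a) v) (at v)"
    by (rule d[OF v], simp)+
qed (use 1 2 w in auto)

text \<open>The triples (e, b, c) come from eliminating the other two functions from S'^2 = C^2 D^2,
  C'^2 = S^2 D^2 and D'^2 = S^2 C^2 by means of the conserved quantities.\<close>

lemma strip_hankel:
  assumes w: "- h < Im w" "Im w < h"
  shows "lser (lder 2 cS) w * lser (lder 6 cS) w - (lser (lder 4 cS) w)\<^sup>2 = hankel 1 (- (al + be)) (al * be) ((S w)\<^sup>2)"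
    and "lser (lder 2 cC) w * lser (lder 6 cC) w - (lser (lder 4 cC) w)\<^sup>2 = hankel (- 1) (2 * al - be) (al * (be - al)) ((C w)\<^sup>2)"
    and "lser (lder 2 cD) w * lser (lder 6 cD) w - (lser (lder 4 cD) w)\<^sup>2 = hankel (- 1) (2 * be - al) (be * (al - be)) ((D w)\<^sup>2)"
proof -
  show "lser (lder 2 cS) w * lser (lder 6 cS) w - (lser (lder 4 cS) w)\<^sup>2 = hankel 1 (- (al + be)) (al * be) ((S w)\<^sup>2)"
  proof (rule strip_hankel_aux[OF lconv_main(3) w])
    fix v assume v: "- h < Im v" "Im v < h"
    have C: "(C v)\<^sup>2 = al - (S v)\<^sup>2" and D: "(D v)\<^sup>2 = be - (S v)\<^sup>2" using strip_squares[OF v] .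
    show "(lser (lder 1 cS) v)\<^sup>2 = 1 * S v ^ 4 + - (al + be) * (S v)\<^sup>2 + al * be"
      unfolding strip_ode[OF v] power_mult_distrib C D by algebra
    show "lser (lder 2 cS) v = S v * (2 * 1 * (S v)\<^sup>2 + - (al + be))"
      unfolding strip_second_derivs[OF v] C D by algebra
  qed
  show "lser (lder 2 cC) w * lser (lder 6 cC) w - (lser (lder 4 cC) w)\<^sup>2 = hankel (- 1) (2 * al - be) (al * (be - al)) ((C w)\<^sup>2)"
  proof (rule strip_hankel_aux[OF lconv_main(1) w])
    fix v assume v: "- h < Im v" "Im v < h"
    have S: "(S v)\<^sup>2 = al - (C v)\<^sup>2" and D: "(D v)\<^sup>2 = be - al + (C v)\<^sup>2" using strip_squares[OF v] by auto
    show "(lser (lder 1 cC) v)\<^sup>2 = - 1 * C v ^ 4 + (2 * al - be) * (C v)\<^sup>2 + al * (be - al)"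
      unfolding strip_ode[OF v] power_mult_distrib power2_minus S D by algebra
    show "lser (lder 2 cC) v = C v * (2 * - 1 * (C v)\<^sup>2 + (2 * al - be))"
      unfolding strip_second_derivs[OF v] S D by algebra
  qed
  show "lser (lder 2 cD) w * lser (lder 6 cD) w - (lser (lder 4 cD) w)\<^sup>2 = hankel (- 1) (2 * be - al) (be * (al - be)) ((D w)\<^sup>2)"
  proof (rule strip_hankel_aux[OF lconv_main(2) w])
    fix v assume v: "- h < Im v" "Im v < h"
    have S: "(S v)\<^sup>2 = be - (D v)\<^sup>2" and C: "(C v)\<^sup>2 = al - be + (D v)\<^sup>2" using strip_squares[OF v] by auto
    show "(lser (lder 1 cD) v)\<^sup>2 = - 1 * D v ^ 4 + (2 * be - al) * (D v)\<^sup>2 + be * (al - be)"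
      unfolding strip_ode[OF v] power_mult_distrib power2_minus S C by algebra
    show "lser (lder 2 cD) v = D v * (2 * - 1 * (D v)\<^sup>2 + (2 * be - al))"
      unfolding strip_second_derivs[OF v] S C by algebra
  qed
qed

text \<open>exp (-h) is the positive square root of the nome, which accounts for the half-integer
  powers.\<close>

definition nome :: real where "nome = exp (- 2 * h)"

lemma nome_powers:
  assumes "1 \<le> r"
  shows "nome powr (real r - 1 / 2) = exp (- (of_int (2 * int r - 1) * h))"
    and "nome ^ (2 * r - 1) = exp (- (of_int (2 * int r - 1) * h)) ^ 2"
    and "nome ^ r = exp (- (of_int (2 * int r) * h))"
proof -
  have "nome powr (real r - 1 / 2) = exp ((real r - 1 / 2) * (- 2 * h))" by (simp add: nome_def powr_def)
  also have "(real r - 1 / 2) * (- 2 * h) = - (of_int (2 * int r - 1) * h)" by (simp add: algebra_simps)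
  finally show "nome powr (real r - 1 / 2) = exp (- (of_int (2 * int r - 1) * h))" .
  have "nome ^ (2 * r - 1) = exp (of_nat (2 * r - 1) * (- 2 * h))"
    unfolding nome_def by (rule exp_of_nat_mult[symmetric])
  also have "of_nat (2 * r - 1) * (- 2 * h) = of_nat 2 * - (of_int (2 * int r - 1) * h)"
    using assms by (simp add: of_nat_diff)
  also have "exp \<dots> = exp (- (of_int (2 * int r - 1) * h)) ^ 2" by (rule exp_of_nat_mult)
  finally show "nome ^ (2 * r - 1) = exp (- (of_int (2 * int r - 1) * h)) ^ 2" .
  have "nome ^ r = exp (of_nat r * (- 2 * h))"
    unfolding nome_def by (rule exp_of_nat_mult[symmetric])
  also have "of_nat r * (- 2 * h) = - (of_int (2 * int r) * h)" by simp
  finally show "nome ^ r = exp (- (of_int (2 * int r) * h))" .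
qed

lemma zero_in_strip: "- h < Im 0" "Im 0 < h" "- h < Im (of_real (pi / 2))" "Im (of_real (pi / 2)) < h"
  using h_pos by auto

lemma odd_coeff:
  "cC (2 * int r - 1) = of_real (1 / cosh (of_int (2 * int r - 1) * h))"
  "cS (2 * int r - 1) = - \<i> * of_real (1 / sinh (of_int (2 * int r - 1) * h))"
  "cD (2 * int r) = of_real (1 / cosh (of_int (2 * int r) * h))"
  by (simp_all add: cC_def cS_def cD_def)

lemma odd_nonzero: "1 \<le> r \<Longrightarrow> of_int (2 * int r - 1) * h \<noteq> 0"
  using h_pos by simp

lemma C_series_0: "lser (lder (2 * m) cC) 0 = (- 1) ^ m * 4 * of_real (T_series m nome)"
proof -
  have "lser (lder (2 * m) cC) 0 = (- 1) ^ m * 2 * 2 * of_real (\<Sum>\<^sub>\<infinity>r\<in>{1::nat..}. (2 * real r - 1) ^ (2 * m) * (nome powr (real r - 1 / 2) / (1 + nome ^ (2 * r - 1))))"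
  proof (rule lser_odd_eval[OF lconv_main(1) zero_in_strip(1,2)])
    fix r :: nat assume r: "1 \<le> r"
    show "cC (2 * int r - 1) * exp (\<i> * of_int (2 * int r - 1) * 0) = 2 * of_real (nome powr (real r - 1 / 2) / (1 + nome ^ (2 * r - 1)))"
      unfolding odd_coeff sech_eq nome_powers[OF r] by simp
  qed (auto simp: cC_def)
  then show ?thesis by (simp add: T_series_def)
qed

text \<open>The factor -i of the coefficient and the phase -i (-1)^r at pi/2 multiply to -(-1)^r;
  this is the alternating sign of \<open>That_series\<close>.\<close>

lemma S_series_half_pi: "lser (lder (2 * m) cS) (of_real (pi / 2)) = (- 1) ^ m * - 4 * of_real (That_series m nome)"
proof -
  have "lser (lder (2 * m) cS) (of_real (pi / 2)) = (- 1) ^ m * 2 * - 2 * of_real (\<Sum>\<^sub>\<infinity>r\<in>{1::nat..}. (2 * real r - 1) ^ (2 * m) * ((- 1) ^ r * nome powr (real r - 1 / 2) / (1 - nome ^ (2 * r - 1))))"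
  proof (rule lser_odd_eval[OF lconv_main(3) zero_in_strip(3,4)])
    fix r :: nat assume r: "1 \<le> r"
    show "cS (2 * int r - 1) * exp (\<i> * of_int (2 * int r - 1) * of_real (pi / 2)) =
         - 2 * of_real ((- 1) ^ r * nome powr (real r - 1 / 2) / (1 - nome ^ (2 * r - 1)))"
      unfolding odd_coeff exp_half_pi_odd csch_eq[OF odd_nonzero[OF r]] nome_powers[OF r] by (simp add: mult_ac)
  next
    fix j :: int assume "odd j"
    then show "cS (- j) * exp (\<i> * of_int (- j) * of_real (pi / 2)) = cS j * exp (\<i> * of_int j * of_real (pi / 2))"
      unfolding exp_half_pi_neg by simp
  qed (auto simp: cS_def)
  then show ?thesis by (simp add: That_series_def mult.assoc)
qed

lemma D_series_0:
  assumes "m > 0"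
  shows "lser (lder (2 * m) cD) 0 = (- 1) ^ m * 4 * 4 ^ m * of_real (N_series m nome)"
proof -
  have "lser (lder (2 * m) cD) 0 = (- 1) ^ m * 2 * 4 ^ m * 2 * of_real (\<Sum>\<^sub>\<infinity>r\<in>{1::nat..}. real r ^ (2 * m) * (nome ^ r / (1 + nome ^ (2 * r))))"
  proof (rule lser_even_eval[OF lconv_main(2) zero_in_strip(1,2) _ _ _ _ assms])
    fix r :: nat assume r: "1 \<le> r"
    show "cD (2 * int r) * exp (\<i> * of_int (2 * int r) * 0) = 2 * of_real (nome ^ r / (1 + nome ^ (2 * r)))"
      unfolding odd_coeff sech_eq power_even_eq[of nome r] nome_powers(3)[OF r] by simp
  qed (auto simp: cD_def)
  then show ?thesis by (simp add: N_series_def)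
qed

text \<open>The phase (-1)^r turns the r-th power of the nome into that of its negative, while the
  even power in the denominator is unchanged.\<close>

lemma D_series_half_pi:
  assumes "m > 0"
  shows "lser (lder (2 * m) cD) (of_real (pi / 2)) = (- 1) ^ m * 4 * 4 ^ m * of_real (N_series m (- nome))"
proof -
  have "lser (lder (2 * m) cD) (of_real (pi / 2)) = (- 1) ^ m * 2 * 4 ^ m * 2 * of_real (\<Sum>\<^sub>\<infinity>r\<in>{1::nat..}. real r ^ (2 * m) * ((- nome) ^ r / (1 + (- nome) ^ (2 * r))))"
  proof (rule lser_even_eval[OF lconv_main(2) zero_in_strip(3,4) _ _ _ _ assms])
    fix r :: nat assume r: "1 \<le> r"
    have n: "(- nome) ^ r = (- 1) ^ r * nome ^ r" by (rule power_minus)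
    have "(- nome) ^ (2 * r) = nome ^ (2 * r)" by simp
    then have n2: "(- nome) ^ (2 * r) = (nome ^ r) ^ 2" unfolding power_even_eq[of nome] .
    show "cD (2 * int r) * exp (\<i> * of_int (2 * int r) * of_real (pi / 2)) = 2 * of_real ((- nome) ^ r / (1 + (- nome) ^ (2 * r)))"
      unfolding odd_coeff exp_half_pi_even sech_eq n n2 nome_powers(3)[OF r] by simp
  next
    fix j :: int assume "even j"
    then show "cD (- j) * exp (\<i> * of_int (- j) * of_real (pi / 2)) = cD j * exp (\<i> * of_int j * of_real (pi / 2))"
      unfolding exp_half_pi_neg by simp
  qed (auto simp: cD_def)
  then show ?thesis by (simp add: N_series_def)
qed

text \<open>The series for \<open>C\<close>, \<open>D\<close>, \<open>S\<close> diverge at \<open>\<pi>/2 + ih\<close>. Subtracting the geometric leading part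
  \<open>\<kappa> e\<^sup>j\<^sup>h\<close> of the coefficients with \<open>j < 0\<close> leaves a series converging for \<open>-h < Im w < 3h\<close>.\<close>

definition reflected :: "(int \<Rightarrow> complex) \<Rightarrow> int \<Rightarrow> complex" where
  "reflected a j = (if 0 \<le> j then a j else - of_real (exp (of_int j * h) ^ 2) * a (- j))"

text \<open>For j < 0 the factor exp (2jh) and the decay exp (jh) of \<open>a (- j)\<close> combine
  to exp (3jh). The upper edge moves to 3h, past the height h of the critical point.\<close>

lemma lconv_reflected:
  assumes "M \<ge> 0" "\<And>j. norm (a j) \<le> M * exp (- \<bar>of_int j * h\<bar>)"
  shows "lconv (- h) (3 * h) (reflected a)"
proof (rule lconv_bounded[OF assms(1)])
  fix j :: int
  show "norm (reflected a j) \<le> M * exp (of_int j * - h)" if "j \<ge> 0"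
    using assms(2)[of j] that h_pos by (simp add: abs_mult reflected_def)
  show "norm (reflected a j) \<le> M * exp (of_int j * (3 * h))" if "j < 0"
  proof -
    have "norm (reflected a j) = exp (of_int j * h) ^ 2 * norm (a (- j))"
      using that by (simp add: reflected_def norm_mult norm_power)
    also have "\<dots> \<le> exp (of_int j * h) ^ 2 * (M * exp (of_int j * h))"
      using assms(2)[of "- j"] that h_pos by (intro mult_left_mono) (auto simp: abs_mult)
    also have "\<dots> = M * exp (of_int j * (3 * h))"
      by (simp add: power2_eq_square exp_add[symmetric] algebra_simps)
    finally show ?thesis .
  qed
qed

lemma lconv_reflected_main:
  "lconv (- h) (3 * h) (reflected cC)" "lconv (- h) (3 * h) (reflected cD)" "lconv (- h) (3 * h) (reflected cS)"
  by (rule lconv_reflected[OF _ norm_coeff_le(1)] lconv_reflected[OF _ norm_coeff_le(2)]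
      lconv_reflected[OF _ norm_coeff_le(3)], use h_pos in simp)+

text \<open>With x = exp (jh), s = 2x/(1 + x^2) rearranges to s = 2x - x^2 s. For csch the sign of
  x^2 is opposite, which the oddness of \<open>cS\<close> compensates, so one definition of
  \<open>reflected\<close> serves all three.\<close>

lemma reflected_decomp:
  "cC j = 2 * (geo True (- j) * of_real (exp (of_int j * h))) + reflected cC j"
  "cD j = 2 * (geo False (- j) * of_real (exp (of_int j * h))) + reflected cD j"
  "cS j = 2 * \<i> * (geo True (- j) * of_real (exp (of_int j * h))) + reflected cS j"
proof -
  define x where "x = exp (of_int j * h)"
  have x: "x > 0" by (simp add: x_def)
  then have p: "1 + x\<^sup>2 \<noteq> 0" by (simp add: add_pos_pos less_imp_neq[THEN not_sym])
  have se: "1 / cosh (of_int j * h) = 2 * x / (1 + x\<^sup>2)"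
    using sech_eq[of "- (of_int j * h)"] by (simp add: x_def)
  define s where "s = 1 / cosh (of_int j * h)"
  have "s = 2 * x - x\<^sup>2 * s"
    unfolding s_def se using p by (simp add: field_simps)
  then have "complex_of_real s = of_real (2 * x - x\<^sup>2 * s)" by (rule arg_cong)
  then have eq: "of_real s = 2 * of_real x + - of_real (x\<^sup>2) * complex_of_real s" by simp
  have c: "cC j = (if odd j then of_real s else 0)" "cD j = (if even j then of_real s else 0)"
    by (simp_all add: cC_def cD_def s_def)
  show "cC j = 2 * (geo True (- j) * of_real (exp (of_int j * h))) + reflected cC j"
    unfolding reflected_def coeff_neg c x_def[symmetric] geo_def using eq by auto
  show "cD j = 2 * (geo False (- j) * of_real (exp (of_int j * h))) + reflected cD j"
    unfolding reflected_def coeff_neg c x_def[symmetric] geo_def using eq by auto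
  show "cS j = 2 * \<i> * (geo True (- j) * of_real (exp (of_int j * h))) + reflected cS j"
  proof (cases "odd j \<and> j < 0")
    case True
    have nz: "- (of_int j * h) \<noteq> 0" using True h_pos by auto
    then have "x \<noteq> 1" by (simp add: x_def)
    then have ne: "1 - x\<^sup>2 \<noteq> 0" using x by (simp add: power2_eq_1_iff)
    have cs: "- (1 / sinh (of_int j * h)) = 2 * x / (1 - x\<^sup>2)"
      using csch_eq[OF nz] by (simp add: x_def)
    have "2 * x / (1 - x\<^sup>2) = 2 * x + x\<^sup>2 * (2 * x / (1 - x\<^sup>2))"
      using ne by (simp add: field_simps)
    then have e: "- (1 / sinh (of_int j * h)) = 2 * x - x\<^sup>2 * (1 / sinh (of_int j * h))" using cs by algebra
    have "cS j = \<i> * of_real (- (1 / sinh (of_int j * h)))" using True by (simp add: cS_def)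
    also have "\<dots> = \<i> * of_real (2 * x - x\<^sup>2 * (1 / sinh (of_int j * h)))" unfolding e ..
    also have "\<dots> = 2 * \<i> * of_real x + of_real (x\<^sup>2) * (- \<i> * of_real (1 / sinh (of_int j * h)))"
      by (simp add: algebra_simps)
    also have "- \<i> * of_real (1 / sinh (of_int j * h)) = cS j" using True by (simp add: cS_def)
    finally show ?thesis using True by (simp add: reflected_def geo_def x_def)
  next
    case False
    then show ?thesis by (auto simp: reflected_def geo_def cS_def)
  qed
qed

text \<open>Under j \<mapsto> -j the subtracted part becomes a geometric series at ih - w, whose
  imaginary part is positive throughout the strip.\<close>

lemma reflected_series:
  assumes dec: "\<And>j. a j = \<kappa> * (geo p (- j) * of_real (exp (of_int j * h))) + reflected a j"
    and ref: "lconv (- h) (3 * h) (reflected a)"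
    and w: "- h < Im w" "Im w < h"
  shows "lser (lder (2 * m) a) w = \<kappa> * lser (lder (2 * m) (geo p)) (\<i> * of_real h - w) + lser (lder (2 * m) (reflected a)) w"
proof -
  let ?e = "\<lambda>j w. exp (\<i> * of_int j * w)"
  let ?G = "\<lambda>j. lder (2 * m) (geo p) j * ?e j (\<i> * of_real h - w)"
  have "(?G has_sum lser (lder (2 * m) (geo p)) (\<i> * of_real h - w)) UNIV"
    by (rule lconv_has_sum[OF lconv_lder[OF lconv_geo[of "h - Im w + 1"]]]) (use w in auto)
  from has_sum_cmult_right[OF has_sum_int_uminus[OF this], of \<kappa>]
  have 1: "((\<lambda>j. \<kappa> * ?G (- j)) has_sum \<kappa> * lser (lder (2 * m) (geo p)) (\<i> * of_real h - w)) UNIV" .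
  have 2: "((\<lambda>j. lder (2 * m) (reflected a) j * ?e j w) has_sum lser (lder (2 * m) (reflected a)) w) UNIV"
    by (rule lconv_has_sum[OF lconv_lder[OF ref]]) (use w h_pos in auto)
  have "\<kappa> * ?G (- j) + lder (2 * m) (reflected a) j * ?e j w = lder (2 * m) a j * ?e j w" for j
  proof -
    have "\<i> * of_int (- j) * (\<i> * of_real h - w) = of_real (of_int j * h) + \<i> * of_int j * w"
      by (simp add: algebra_simps)
    then have e: "?e (- j) (\<i> * of_real h - w) = of_real (exp (of_int j * h)) * ?e j w"
      by (simp only: exp_add exp_of_real)
    have n: "of_int (- j) ^ (2 * m) = (of_int j ^ (2 * m) :: complex)" by simp
    show ?thesis unfolding lder_even e n dec[of j] by (simp only: algebra_simps)
  qed
  with has_sum_add[OF 1 2] have "((\<lambda>j. lder (2 * m) a j * ?e j w) has_sum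
      (\<kappa> * lser (lder (2 * m) (geo p)) (\<i> * of_real h - w) + lser (lder (2 * m) (reflected a)) w)) UNIV"
    by simp
  then show ?thesis unfolding lser_def[of "lder (2 * m) a"] by (rule infsumI)
qed

text \<open>The point K + iK' in the variable w = u/z; dn vanishes there.\<close>

definition corner :: complex where "corner = of_real (pi / 2) + \<i> * of_real h"

lemma corner_in: "- h < Im corner" "Im corner < 3 * h"
  using h_pos by (auto simp: corner_def)

lemma exp_corner: "exp (\<i> * of_int j * corner) = exp (\<i> * of_int j * of_real (pi / 2)) * of_real (exp (- (of_int j * h)))"
proof -
  have "\<i> * of_int j * corner = \<i> * of_int j * of_real (pi / 2) + of_real (- (of_int j * h))"
    by (simp add: corner_def complex_eq_iff algebra_simps)
  then show ?thesis by (simp only: exp_add exp_of_real)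
qed

text \<open>The remainder is continuous at the corner, so only the geometric part needs a limit, and
  that one is known in closed form.\<close>

lemma reflected_limit:
  assumes dec: "\<And>j. a j = \<kappa> * (geo p (- j) * of_real (exp (of_int j * h))) + reflected a j"
    and ref: "lconv (- h) (3 * h) (reflected a)"
    and L: "((\<lambda>y. lser (lder (2 * m) (geo p)) (\<i> * of_real (h - y) - of_real (pi / 2))) \<longlongrightarrow> L) (at_left h)"
  shows "((\<lambda>y. lser (lder (2 * m) a) (of_real (pi / 2) + \<i> * of_real y)) \<longlongrightarrow> \<kappa> * L + lser (lder (2 * m) (reflected a)) corner) (at_left h)"
proof -
  have "isCont (lser (lder (2 * m) (reflected a))) corner"
    by (rule DERIV_isCont[OF has_field_derivative_lser_lder[OF ref corner_in]])
  moreover have "((\<lambda>y. of_real (pi / 2) + \<i> * of_real y) \<longlongrightarrow> corner) (at_left h)"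
    unfolding corner_def by (intro tendsto_intros)
  ultimately have R: "((\<lambda>y. lser (lder (2 * m) (reflected a)) (of_real (pi / 2) + \<i> * of_real y)) \<longlongrightarrow> lser (lder (2 * m) (reflected a)) corner) (at_left h)"
    by (rule isCont_tendsto_compose)
  have "\<forall>\<^sub>F y in at_left h. y \<in> {0<..<h}" using h_pos by (intro eventually_at_leftI[of 0]) auto
  then have ev: "\<forall>\<^sub>F y in at_left h. \<kappa> * lser (lder (2 * m) (geo p)) (\<i> * of_real (h - y) - of_real (pi / 2))
      + lser (lder (2 * m) (reflected a)) (of_real (pi / 2) + \<i> * of_real y)
      = lser (lder (2 * m) a) (of_real (pi / 2) + \<i> * of_real y)"
  proof eventually_elim
    case (elim y)
    let ?w = "of_real (pi / 2) + \<i> * of_real y"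
    have "- h < Im ?w" "Im ?w < h" using elim h_pos by auto
    note r = reflected_series[OF dec ref this, of m]
    have eq: "\<i> * of_real h - ?w = \<i> * of_real (h - y) - of_real (pi / 2)" by (simp add: algebra_simps)
    show ?case using r unfolding eq by (rule sym)
  qed
  show ?thesis
    by (rule Lim_transform_eventually[OF tendsto_add[OF tendsto_mult_left[OF L] R] ev])
qed

text \<open>At the corner index -j carries exp (jh) and phase -1 relative to j; the factor -exp
  (-2jh) in \<open>reflected\<close> cancels the sign and restores exp (-jh).\<close>

lemma reflected_odd_sym:
  assumes "odd j" and a: "\<And>j. even j \<Longrightarrow> a j = 0"
  shows "reflected a (- j) * exp (\<i> * of_int (- j) * corner) = reflected a j * exp (\<i> * of_int j * corner)"
proof -
  have pos: "reflected a (- j) * exp (\<i> * of_int (- j) * corner) = reflected a j * exp (\<i> * of_int j * corner)"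
    if "odd j" "j > 0" for j
  proof -
    have "exp (of_int (- j) * h) ^ 2 * exp (- (of_int (- j) * h)) = exp (- (of_int j * h))"
      by (simp add: power2_eq_square exp_add[symmetric])
    then have e: "complex_of_real (exp (of_int (- j) * h) ^ 2) * of_real (exp (- (of_int (- j) * h))) = of_real (exp (- (of_int j * h)))"
      by (simp only: of_real_mult[symmetric])
    have "reflected a (- j) * exp (\<i> * of_int (- j) * corner)
      = a j * exp (\<i> * of_int j * of_real (pi / 2)) * (complex_of_real (exp (of_int (- j) * h) ^ 2) * of_real (exp (- (of_int (- j) * h))))"
      unfolding exp_corner exp_half_pi_neg reflected_def using that by (simp add: mult_ac)
    then show ?thesis unfolding e exp_corner using that by (simp add: reflected_def mult_ac)
  qed
  show ?thesis
  proof (cases "j > 0")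
    case True
    then show ?thesis using pos[OF assms(1)] by simp
  next
    case False
    moreover have "j \<noteq> 0" using assms(1) by auto
    ultimately have "- j > 0" "odd (- j)" using assms(1) by auto
    then show ?thesis using pos[of "- j"] by simp
  qed
qed

text \<open>The corner contributes a second factor exp (-jh), which replaces the half-integer power
  of the nome by the full power in the numerator of \<open>R_series\<close>.\<close>

lemma R_series_C: "lser (lder (2 * m) (reflected cC)) corner = (- 1) ^ m * (4 * \<i>) * of_real (R_series m nome)"
proof -
  have "lser (lder (2 * m) (reflected cC)) corner = (- 1) ^ m * 2 * (2 * \<i>) * of_real (\<Sum>\<^sub>\<infinity>r\<in>{1::nat..}. (2 * real r - 1) ^ (2 * m) * ((- 1) ^ (r + 1) * (nome ^ (2 * r - 1) / (1 + nome ^ (2 * r - 1)))))"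
  proof (rule lser_odd_eval[OF lconv_reflected_main(1) corner_in])
    fix r :: nat assume r: "1 \<le> r"
    have "reflected cC (2 * int r - 1) = cC (2 * int r - 1)" using r by (simp add: reflected_def)
    then show "reflected cC (2 * int r - 1) * exp (\<i> * of_int (2 * int r - 1) * corner) =
        2 * \<i> * of_real ((- 1) ^ (r + 1) * (nome ^ (2 * r - 1) / (1 + nome ^ (2 * r - 1))))"
      unfolding exp_corner odd_coeff exp_half_pi_odd sech_eq nome_powers[OF r]
      by (simp add: mult_ac power2_eq_square)
  next
    fix j :: int
    show "reflected cC j = 0" if "even j" using that by (simp add: reflected_def cC_def)
    show "reflected cC (- j) * exp (\<i> * of_int (- j) * corner) = reflected cC j * exp (\<i> * of_int j * corner)" if "odd j"
      using that by (rule reflected_odd_sym) (simp add: cC_def)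
  qed auto
  then show ?thesis by (simp add: R_series_def mult_ac)
qed

text \<open>For odd j the csch denominator 1 - q^j equals 1 + (-q)^j, hence the argument
  \<open>- nome\<close>.\<close>

lemma R_series_S: "lser (lder (2 * m) (reflected cS)) corner = (- 1) ^ m * - 4 * of_real (R_series m (- nome))"
proof -
  have "lser (lder (2 * m) (reflected cS)) corner = (- 1) ^ m * 2 * - 2 * of_real (\<Sum>\<^sub>\<infinity>r\<in>{1::nat..}. (2 * real r - 1) ^ (2 * m) * ((- 1) ^ (r + 1) * ((- nome) ^ (2 * r - 1) / (1 + (- nome) ^ (2 * r - 1)))))"
  proof (rule lser_odd_eval[OF lconv_reflected_main(3) corner_in])
    fix r :: nat assume r: "1 \<le> r"
    have n: "(- nome) ^ (2 * r - 1) = - (nome ^ (2 * r - 1))" using r by simp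
    have "reflected cS (2 * int r - 1) = cS (2 * int r - 1)" using r by (simp add: reflected_def)
    then show "reflected cS (2 * int r - 1) * exp (\<i> * of_int (2 * int r - 1) * corner) =
        - 2 * of_real ((- 1) ^ (r + 1) * ((- nome) ^ (2 * r - 1) / (1 + (- nome) ^ (2 * r - 1))))"
      unfolding exp_corner odd_coeff exp_half_pi_odd csch_eq[OF odd_nonzero[OF r]] n nome_powers[OF r]
      by (simp add: mult_ac power2_eq_square)
  next
    fix j :: int
    show "reflected cS j = 0" if "even j" using that by (simp add: reflected_def cS_def)
    show "reflected cS (- j) * exp (\<i> * of_int (- j) * corner) = reflected cS j * exp (\<i> * of_int j * corner)" if "odd j"
      using that by (rule reflected_odd_sym) (simp add: cS_def)
  qed auto
  then show ?thesis by (simp add: R_series_def mult_ac)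
qed

text \<open>For even indices nothing compensates the minus sign in \<open>reflected\<close>, so j
  and -j cancel and only j = 0 remains. Adding the series to its reflection counts that term
  twice.\<close>

lemma D_reflected_corner: "lser (reflected cD) corner = 1"
proof -
  let ?f = "\<lambda>j. reflected cD j * exp (\<i> * of_int j * corner)"
  have f: "(?f has_sum lser (reflected cD) corner) UNIV"
    by (rule lconv_has_sum[OF lconv_reflected_main(2) corner_in])
  have pos: "?f j + ?f (- j) = 0" if "j > 0" for j
  proof (cases "even j")
    case True
    have "exp (of_int (- j) * h) ^ 2 * exp (- (of_int (- j) * h)) = exp (- (of_int j * h))"
      by (simp add: power2_eq_square exp_add[symmetric])
    then have e: "complex_of_real (exp (of_int (- j) * h) ^ 2) * of_real (exp (- (of_int (- j) * h))) = of_real (exp (- (of_int j * h)))"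
      by (simp only: of_real_mult[symmetric])
    have m: "?f (- j)
      = - cD j * exp (\<i> * of_int j * of_real (pi / 2)) * (complex_of_real (exp (of_int (- j) * h) ^ 2) * of_real (exp (- (of_int (- j) * h))))"
      unfolding exp_corner exp_half_pi_neg reflected_def using that True by (simp add: mult_ac)
    have "?f j = cD j * exp (\<i> * of_int j * of_real (pi / 2)) * of_real (exp (- (of_int j * h)))"
      unfolding exp_corner reflected_def using that by simp
    then show ?thesis unfolding m e by simp
  next
    case False
    then show ?thesis by (auto simp: reflected_def cD_def)
  qed
  have "?f j + ?f (- j) = (if j = 0 then 2 else 0)" for j
  proof (cases "j = 0")
    case True
    then show ?thesis by (simp add: reflected_def cD_def)
  next
    case False
    then have "j > 0 \<or> - j > 0" by auto
    then show ?thesis using pos[of j] pos[of "- j"] False by (auto simp: add.commute)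
  qed
  with has_sum_add[OF f has_sum_int_uminus[OF f]]
  have "((\<lambda>j :: int. if j = 0 then 2 else 0) has_sum (lser (reflected cD) corner + lser (reflected cD) corner)) UNIV" by simp
  moreover have "((\<lambda>j :: int. if j = 0 then 2 else 0 :: complex) has_sum 2) UNIV"
    by (rule has_sum_finite_neutralI[of "{0}"]) auto
  ultimately have "lser (reflected cD) corner + lser (reflected cD) corner = 2" by (rule has_sum_unique)
  then show ?thesis by simp
qed

end

lemma det_mat2: "det (mat2 a b c d) = a * d - b * c"
  by (simp add: mat2_def det_2)

section \<open>Closed forms of the six determinants\<close>

context half_period
begin

abbreviation "zz \<equiv> rD 0"
abbreviation "kk \<equiv> modulus"

lemma al_be: "al = of_real (kk\<^sup>2 * zz\<^sup>2)" "be = of_real (zz\<^sup>2)"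
  using modulus(3) by (simp_all add: al_real be_real power_mult_distrib)

text \<open>The signs (-1)^m cancel because 1 + 3 = 2 + 2, and 16 = 4^2. At 0, Y = al and 2 e Y + b
  = -be.\<close>

lemma T_det_nome: "T_det nome = 9 / 4 * (kk\<^sup>2 * zz\<^sup>2)\<^sup>2 * (zz\<^sup>2) ^ 3"
proof -
  have "16 * complex_of_real (T_det nome) = hankel (- 1) (2 * al - be) (al * (be - al)) al"
    using strip_hankel(2)[OF zero_in_strip(1,2)] C_series_0[of 1] C_series_0[of 2] C_series_0[of 3]
    by (simp add: T_det_def det_mat2 al_def power2_eq_square)
  also have "\<dots> = 36 * - 1 * al\<^sup>2 * (2 * - 1 * al + (2 * al - be)) ^ 3"
    by (rule hankel_root) algebra
  also have "\<dots> = 16 * of_real (9 / 4 * (kk\<^sup>2 * zz\<^sup>2)\<^sup>2 * (zz\<^sup>2) ^ 3)"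
    unfolding al_be by simp
  finally show ?thesis by (simp only: mult_cancel_left of_real_eq_iff) simp
qed

text \<open>C vanishes at pi/2, so Y = al and 2 e Y + b = al - be.\<close>

lemma That_det_nome: "That_det nome = - 9 / 4 * (kk\<^sup>2 * zz\<^sup>2)\<^sup>2 * (zz\<^sup>2 - kk\<^sup>2 * zz\<^sup>2) ^ 3"
proof -
  have S: "(S (of_real (pi / 2)))\<^sup>2 = al"
    using strip_squares(1)[OF zero_in_strip(3,4)] unfolding C_half_pi by simp
  have "16 * complex_of_real (That_det nome) = hankel 1 (- (al + be)) (al * be) ((S (of_real (pi / 2)))\<^sup>2)"
    using strip_hankel(1)[OF zero_in_strip(3,4)]
      S_series_half_pi[of 1] S_series_half_pi[of 2] S_series_half_pi[of 3]
    by (simp add: That_det_def det_mat2 power2_eq_square)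
  also have "\<dots> = 36 * 1 * al\<^sup>2 * (2 * 1 * al + - (al + be)) ^ 3"
    unfolding S by (rule hankel_root) algebra
  also have "\<dots> = 16 * of_real (- 9 / 4 * (kk\<^sup>2 * zz\<^sup>2)\<^sup>2 * (zz\<^sup>2 - kk\<^sup>2 * zz\<^sup>2) ^ 3)"
    unfolding al_be of_real_mult of_real_diff of_real_power of_real_divide of_real_minus by (simp add: field_simps) algebra
  finally show ?thesis by (simp only: mult_cancel_left of_real_eq_iff) simp
qed

text \<open>4096 = 4^2 * 4^4, the second factor from the even indices 2r. Here Y = be and 2 e Y + b
  = -al.\<close>

lemma N_det_nome: "N_det nome = 9 / 1024 * (zz\<^sup>2)\<^sup>2 * (kk\<^sup>2 * zz\<^sup>2) ^ 3"
proof -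
  have "4096 * complex_of_real (N_det nome) = hankel (- 1) (2 * be - al) (be * (al - be)) be"
    using strip_hankel(3)[OF zero_in_strip(1,2)] D_series_0[of 1] D_series_0[of 2] D_series_0[of 3]
    by (simp add: N_det_def det_mat2 be_def power2_eq_square)
  also have "\<dots> = 36 * - 1 * be\<^sup>2 * (2 * - 1 * be + (2 * be - al)) ^ 3"
    by (rule hankel_root) algebra
  also have "\<dots> = 4096 * of_real (9 / 1024 * (zz\<^sup>2)\<^sup>2 * (kk\<^sup>2 * zz\<^sup>2) ^ 3)"
    unfolding al_be by simp
  finally show ?thesis by (simp only: mult_cancel_left of_real_eq_iff) simp
qed

lemma N_det_minus_nome: "N_det (- nome) = - 9 / 1024 * (zz\<^sup>2 - kk\<^sup>2 * zz\<^sup>2)\<^sup>2 * (kk\<^sup>2 * zz\<^sup>2) ^ 3"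
proof -
  have D: "(D (of_real (pi / 2)))\<^sup>2 = be - al"
    using strip_squares[OF zero_in_strip(3,4)] unfolding C_half_pi by simp
  have "4096 * complex_of_real (N_det (- nome)) = hankel (- 1) (2 * be - al) (be * (al - be)) ((D (of_real (pi / 2)))\<^sup>2)"
    using strip_hankel(3)[OF zero_in_strip(3,4)] D_series_half_pi[of 1] D_series_half_pi[of 2] D_series_half_pi[of 3]
    by (simp add: N_det_def det_mat2 power2_eq_square)
  also have "\<dots> = 36 * - 1 * (be - al)\<^sup>2 * (2 * - 1 * (be - al) + (2 * be - al)) ^ 3"
    unfolding D by (rule hankel_root) algebra
  also have "\<dots> = 4096 * of_real (- 9 / 1024 * (zz\<^sup>2 - kk\<^sup>2 * zz\<^sup>2)\<^sup>2 * (kk\<^sup>2 * zz\<^sup>2) ^ 3)"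
    unfolding al_be of_real_mult of_real_diff of_real_power of_real_divide of_real_minus by (simp add: field_simps)
  finally show ?thesis by (simp only: mult_cancel_left of_real_eq_iff) simp
qed

lemma corner_path:
  "\<forall>\<^sub>F y in at_left h. - h < Im (of_real (pi / 2) + \<i> * of_real y) \<and> Im (of_real (pi / 2) + \<i> * of_real y) < h"
proof -
  have "\<forall>\<^sub>F y in at_left h. y \<in> {0<..<h}" using h_pos by (intro eventually_at_leftI[of 0]) auto
  then show ?thesis by eventually_elim (use h_pos in auto)
qed

text \<open>The regularised limit of D is 2 * (-1/2) + 1 = 0; the conserved quantities then give the
  other two squares.\<close>

lemma corner_squares:
  "((\<lambda>y. (S (of_real (pi / 2) + \<i> * of_real y))\<^sup>2) \<longlongrightarrow> be) (at_left h)"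
  "((\<lambda>y. (C (of_real (pi / 2) + \<i> * of_real y))\<^sup>2) \<longlongrightarrow> al - be) (at_left h)"
proof -
  have "((\<lambda>y. D (of_real (pi / 2) + \<i> * of_real y)) \<longlongrightarrow> 2 * (- 1 / 2) + lser (reflected cD) corner) (at_left h)"
    using reflected_limit[OF reflected_decomp(2) lconv_reflected_main(2), of 0 "- 1 / 2"] geo_limits(4)[OF h_pos] by simp
  then have D: "((\<lambda>y. D (of_real (pi / 2) + \<i> * of_real y)) \<longlongrightarrow> 0) (at_left h)"
    unfolding D_reflected_corner by simp
  have "((\<lambda>y. be - (D (of_real (pi / 2) + \<i> * of_real y))\<^sup>2) \<longlongrightarrow> be - 0\<^sup>2) (at_left h)"
    by (intro tendsto_intros D)
  moreover have "\<forall>\<^sub>F y in at_left h. be - (D (of_real (pi / 2) + \<i> * of_real y))\<^sup>2 = (S (of_real (pi / 2) + \<i> * of_real y))\<^sup>2"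
    using corner_path by eventually_elim (use strip_squares(2) in simp)
  ultimately have "((\<lambda>y. (S (of_real (pi / 2) + \<i> * of_real y))\<^sup>2) \<longlongrightarrow> be - 0\<^sup>2) (at_left h)"
    by (rule Lim_transform_eventually)
  then show S: "((\<lambda>y. (S (of_real (pi / 2) + \<i> * of_real y))\<^sup>2) \<longlongrightarrow> be) (at_left h)" by simp
  have "((\<lambda>y. al - (S (of_real (pi / 2) + \<i> * of_real y))\<^sup>2) \<longlongrightarrow> al - be) (at_left h)"
    by (intro tendsto_intros S)
  moreover have "\<forall>\<^sub>F y in at_left h. al - (S (of_real (pi / 2) + \<i> * of_real y))\<^sup>2 = (C (of_real (pi / 2) + \<i> * of_real y))\<^sup>2"
    using corner_path by eventually_elim (use strip_squares(1) in simp)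
  ultimately show "((\<lambda>y. (C (of_real (pi / 2) + \<i> * of_real y))\<^sup>2) \<longlongrightarrow> al - be) (at_left h)"
    by (rule Lim_transform_eventually)
qed

text \<open>The identity is polynomial, so it survives the passage to the limit, where regularised
  values replace the divergent series.\<close>

lemma corner_hankel:
  assumes "\<And>w. - h < Im w \<Longrightarrow> Im w < h \<Longrightarrow>
      lser (lder 2 a) w * lser (lder 6 a) w - (lser (lder 4 a) w)\<^sup>2 = hankel e b c ((lser a w)\<^sup>2)"
    and "((\<lambda>y. lser (lder 2 a) (of_real (pi / 2) + \<i> * of_real y)) \<longlongrightarrow> L2) (at_left h)"
    and "((\<lambda>y. lser (lder 4 a) (of_real (pi / 2) + \<i> * of_real y)) \<longlongrightarrow> L4) (at_left h)"
    and "((\<lambda>y. lser (lder 6 a) (of_real (pi / 2) + \<i> * of_real y)) \<longlongrightarrow> L6) (at_left h)"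
    and "((\<lambda>y. (lser a (of_real (pi / 2) + \<i> * of_real y))\<^sup>2) \<longlongrightarrow> Y) (at_left h)"
  shows "L2 * L6 - L4\<^sup>2 = hankel e b c Y"
proof (rule tendsto_unique)
  let ?w = "\<lambda>y. of_real (pi / 2) + \<i> * of_real y"
  have "((\<lambda>y. lser (lder 2 a) (?w y) * lser (lder 6 a) (?w y) - (lser (lder 4 a) (?w y))\<^sup>2) \<longlongrightarrow> L2 * L6 - L4\<^sup>2) (at_left h)"
    by (intro tendsto_intros assms(2-4))
  moreover have "\<forall>\<^sub>F y in at_left h. lser (lder 2 a) (?w y) * lser (lder 6 a) (?w y) - (lser (lder 4 a) (?w y))\<^sup>2 = hankel e b c ((lser a (?w y))\<^sup>2)"
    using corner_path by eventually_elim (use assms(1) in blast)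
  ultimately show "((\<lambda>y. hankel e b c ((lser a (?w y))\<^sup>2)) \<longlongrightarrow> L2 * L6 - L4\<^sup>2) (at_left h)"
    by (rule Lim_transform_eventually)
  show "((\<lambda>y. hankel e b c ((lser a (?w y))\<^sup>2)) \<longlongrightarrow> hankel e b c Y) (at_left h)"
    unfolding hankel_def by (intro tendsto_intros assms(5))
qed simp

text \<open>The three limits are the entries of \<open>R_det\<close> multiplied by -i, i and -i
  respectively, so their Hankel expression is \<open>- R_det nome\<close>.\<close>

lemma R_det_nome: "R_det nome = 36 * (zz\<^sup>2 - kk\<^sup>2 * zz\<^sup>2)\<^sup>2 * (zz\<^sup>2) ^ 3"
proof -
  note lim = reflected_limit[OF reflected_decomp(1) lconv_reflected_main(1), unfolded R_series_C]
  have "(2 * (- \<i> / 2) + (- 1) ^ 1 * (4 * \<i>) * of_real (R_series 1 nome))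
      * (2 * (- 61 * \<i> / 2) + (- 1) ^ 3 * (4 * \<i>) * of_real (R_series 3 nome))
      - (2 * (- 5 * \<i> / 2) + (- 1) ^ 2 * (4 * \<i>) * of_real (R_series 2 nome))\<^sup>2
      = hankel (- 1) (2 * al - be) (al * (be - al)) (al - be)"
  proof (rule corner_hankel[OF strip_hankel(2)])
    let ?w = "\<lambda>y. of_real (pi / 2) + \<i> * of_real y"
    show "((\<lambda>y. lser (lder 2 cC) (?w y)) \<longlongrightarrow> 2 * (- \<i> / 2) + (- 1) ^ 1 * (4 * \<i>) * of_real (R_series 1 nome)) (at_left h)"
      using lim[of 1 "- \<i> / 2"] geo_limits(1)[OF h_pos] by simp
    show "((\<lambda>y. lser (lder 4 cC) (?w y)) \<longlongrightarrow> 2 * (- 5 * \<i> / 2) + (- 1) ^ 2 * (4 * \<i>) * of_real (R_series 2 nome)) (at_left h)"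
      using lim[of 2 "- 5 * \<i> / 2"] geo_limits(2)[OF h_pos] by simp
    show "((\<lambda>y. lser (lder 6 cC) (?w y)) \<longlongrightarrow> 2 * (- 61 * \<i> / 2) + (- 1) ^ 3 * (4 * \<i>) * of_real (R_series 3 nome)) (at_left h)"
      using lim[of 3 "- 61 * \<i> / 2"] geo_limits(3)[OF h_pos] by simp
  qed (assumption | rule corner_squares)+
  also have "\<dots> = 36 * - 1 * (al - be)\<^sup>2 * (2 * - 1 * (al - be) + (2 * al - be)) ^ 3"
    by (rule hankel_root) algebra
  also have "\<dots> = - of_real (36 * (zz\<^sup>2 - kk\<^sup>2 * zz\<^sup>2)\<^sup>2 * (zz\<^sup>2) ^ 3)"
    unfolding al_be of_real_mult of_real_diff of_real_power by (simp add: power2_commute)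
  also have "(2 * (- \<i> / 2) + (- 1) ^ 1 * (4 * \<i>) * of_real (R_series 1 nome))
      * (2 * (- 61 * \<i> / 2) + (- 1) ^ 3 * (4 * \<i>) * of_real (R_series 3 nome))
      - (2 * (- 5 * \<i> / 2) + (- 1) ^ 2 * (4 * \<i>) * of_real (R_series 2 nome))\<^sup>2 = - of_real (R_det nome)"
    by (simp add: R_det_def det_mat2 complex_eq_iff power2_eq_square algebra_simps)
  finally have "complex_of_real (R_det nome) = of_real (36 * (zz\<^sup>2 - kk\<^sup>2 * zz\<^sup>2)\<^sup>2 * (zz\<^sup>2) ^ 3)"
    by (simp only: neg_equal_iff_equal)
  then show ?thesis by (simp only: of_real_eq_iff)
qed

text \<open>Here the limits are real and equal the entries of \<open>R_det\<close> up to the sign of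
  the off-diagonal one, which is squared.\<close>

lemma R_det_minus_nome: "R_det (- nome) = 36 * (zz\<^sup>2)\<^sup>2 * (zz\<^sup>2 - kk\<^sup>2 * zz\<^sup>2) ^ 3"
proof -
  note lim = reflected_limit[OF reflected_decomp(3) lconv_reflected_main(3), unfolded R_series_S]
  have "(2 * \<i> * (- \<i> / 2) + (- 1) ^ 1 * - 4 * of_real (R_series 1 (- nome)))
      * (2 * \<i> * (- 61 * \<i> / 2) + (- 1) ^ 3 * - 4 * of_real (R_series 3 (- nome)))
      - (2 * \<i> * (- 5 * \<i> / 2) + (- 1) ^ 2 * - 4 * of_real (R_series 2 (- nome)))\<^sup>2
      = hankel 1 (- (al + be)) (al * be) be"
  proof (rule corner_hankel[OF strip_hankel(1)])
    let ?w = "\<lambda>y. of_real (pi / 2) + \<i> * of_real y"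
    show "((\<lambda>y. lser (lder 2 cS) (?w y)) \<longlongrightarrow> 2 * \<i> * (- \<i> / 2) + (- 1) ^ 1 * - 4 * of_real (R_series 1 (- nome))) (at_left h)"
      using lim[of 1 "- \<i> / 2"] geo_limits(1)[OF h_pos] by simp
    show "((\<lambda>y. lser (lder 4 cS) (?w y)) \<longlongrightarrow> 2 * \<i> * (- 5 * \<i> / 2) + (- 1) ^ 2 * - 4 * of_real (R_series 2 (- nome))) (at_left h)"
      using lim[of 2 "- 5 * \<i> / 2"] geo_limits(2)[OF h_pos] by simp
    show "((\<lambda>y. lser (lder 6 cS) (?w y)) \<longlongrightarrow> 2 * \<i> * (- 61 * \<i> / 2) + (- 1) ^ 3 * - 4 * of_real (R_series 3 (- nome))) (at_left h)"
      using lim[of 3 "- 61 * \<i> / 2"] geo_limits(3)[OF h_pos] by simp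
  qed (assumption | rule corner_squares)+
  also have "\<dots> = 36 * 1 * be\<^sup>2 * (2 * 1 * be + - (al + be)) ^ 3"
    by (rule hankel_root) algebra
  also have "\<dots> = of_real (36 * (zz\<^sup>2)\<^sup>2 * (zz\<^sup>2 - kk\<^sup>2 * zz\<^sup>2) ^ 3)"
    unfolding al_be of_real_mult of_real_diff of_real_power by simp
  also have "(2 * \<i> * (- \<i> / 2) + (- 1) ^ 1 * - 4 * of_real (R_series 1 (- nome)))
      * (2 * \<i> * (- 61 * \<i> / 2) + (- 1) ^ 3 * - 4 * of_real (R_series 3 (- nome)))
      - (2 * \<i> * (- 5 * \<i> / 2) + (- 1) ^ 2 * - 4 * of_real (R_series 2 (- nome)))\<^sup>2 = of_real (R_det (- nome))"
    by (simp add: R_det_def det_mat2 complex_eq_iff power2_eq_square algebra_simps)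
  finally show ?thesis by (simp only: of_real_eq_iff)
qed

end

theorem theorem5p21:
  fixes k z q T That Np Nm Rp Rm :: real
  assumes "0 < k" and "k < 1"
    and "z = 2 * elliptic_K k / pi"
    and "q = exp (- pi * elliptic_K (sqrt (1 - k\<^sup>2)) / elliptic_K k)"
    and "T = T_det q" and "That = That_det q"
    and "Np = N_det q" and "Nm = N_det (- q)"
    and "Rp = R_det q" and "Rm = R_det (- q)"
  shows "(k * z) ^ 10 = 2 ^ 10 / 3 * (Np - Nm) - 2 ^ 3 / 3 ^ 2 * (T + That)
       \<and> k ^ 8 * z ^ 10 = 2 ^ 10 / 3 ^ 2 * (2 * Np - Nm) - 2 ^ 2 / 3 ^ 2 * (T + That)
       \<and> k ^ 6 * z ^ 10 = 2 ^ 10 / 3 ^ 2 * Np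
       \<and> k ^ 4 * z ^ 10 = 2 ^ 2 / 3 ^ 2 * T
       \<and> k ^ 2 * z ^ 10 = 2 ^ 3 / 3 ^ 2 * T - 2 ^ 10 / 3 ^ 2 * Np + 1 / 6 ^ 2 * (Rp - Rm)
       \<and> z ^ 10 = 2 ^ 2 / 3 * T - 2 ^ 11 / 3 ^ 2 * Np + 1 / 18 * (3 / 2 * Rp - Rm)"
proof -
  have k2: "0 < k\<^sup>2" "k\<^sup>2 < 1" using assms(1,2) by (auto simp: power_less_one_iff)
  have K: "elliptic_K k > 0" "elliptic_K (sqrt (1 - k\<^sup>2)) > 0"
    using assms(1,2) k2 by (auto intro!: elliptic_K_pos)
  \<comment> \<open>Chosen so that exp (-2h) is the given nome.\<close>
  define h where "h = pi / 2 * (elliptic_K (sqrt (1 - k\<^sup>2)) / elliptic_K k)"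
  interpret half_period h by unfold_locales (use K in \<open>simp add: h_def\<close>)
  have "elliptic_K (sqrt (1 - modulus\<^sup>2)) / elliptic_K modulus = 2 * h / pi"
    unfolding elliptic_K_modulus elliptic_K_comodulus using rD_0_pos by (simp add: field_simps)
  also have "\<dots> = elliptic_K (sqrt (1 - k\<^sup>2)) / elliptic_K k" by (simp add: h_def)
  finally have k: "modulus = k"
    using elliptic_ratio_inj[OF assms(1,2) modulus(1,2)] by simp
  have z: "rD 0 = z" using elliptic_K_modulus unfolding k assms(3) by (simp add: field_simps)
  have "- 2 * h = - pi * elliptic_K (sqrt (1 - k\<^sup>2)) / elliptic_K k" by (simp add: h_def)
  then have q: "nome = q" unfolding nome_def assms(4) by (simp only:)
  \<comment> \<open>In these variables the determinants are, up to constants, a^2 b^3, a^2 (b -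
    a)^3, b^2 a^3, (b - a)^2 a^3, (b - a)^2 b^3 and b^2 (b - a)^3, and the claims are polynomial
    identities.\<close>
  define a b where "a = k\<^sup>2 * z\<^sup>2" and "b = z\<^sup>2"
  note dets = T_det_nome That_det_nome N_det_nome N_det_minus_nome R_det_nome R_det_minus_nome
  note dets' = dets[unfolded k z q, folded assms(5-10) a_def b_def]
  have "(k * z) ^ 10 = a ^ 5" "k ^ 8 * z ^ 10 = a ^ 4 * b" "k ^ 6 * z ^ 10 = a ^ 3 * b ^ 2"
    "k ^ 4 * z ^ 10 = a ^ 2 * b ^ 3" "k ^ 2 * z ^ 10 = a * b ^ 4" "z ^ 10 = b ^ 5"
    unfolding a_def b_def by algebra+
  then show ?thesis unfolding dets'
    by (intro conjI; simp add: field_simps power2_eq_square power3_eq_cube eval_nat_numeral)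
qed

end
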